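(* Let $H:\mathbf{R}_+\to(0,1)$ be $\beta$-Hölder-continuous with $\beta>0$, and let $X=\{X_t;\ t\in\mathbf{R}_+\}$ be the multifractional Brownian motion with regularity function $H$, given by $$X_t=\int_{\mathbf{R}}\frac{e^{it\xi}-1}{|\xi|^{H(t)+1/2}}\,\widehat{\mathbb{W}}(d\xi).$$ Let $\widetilde{\alpha}_H(t_0)$ and $\underline{\alpha}_H(t_0)$ be respectively the local Hölder exponent and the local sub-exponent of $H$ at $t_0\in\mathbf{R}_+$. In the three following cases, the Hausdorff dimension of the graph satisfies: (i) If $H(t_0)<\widetilde{\alpha}_H(t_0)\le\underline{\alpha}_H(t_0)$ for $t_0\in\mathbf{R}_+$, then almost surely $\lim_{\rho\to0}\dim_{\mathcal H}(\mathrm{Gr}_X(B(t_0,\rho)))=2-H(t_0)$. (ii) If $\widetilde{\alpha}_H(t_0)<H(t_0)\le\underline{\alpha}_H(t_0)$ for $t_0\in\mathbf{R}_+$, then almost surely $2-H(t_0)\le\lim_{\rho\to0}\dim_{\mathcal H}(\mathrm{Gr}_X(B(t_0,\rho)))\le 2-\widetilde{\alpha}_H(t_0)$. (iii) If $\widetilde{\alpha}_H(t_0)\le\underline{\alpha}_H(t_0)<H(t_0)$ for $t_0\in\mathbf{R}_+$, then almost surely $2-\underline{\alpha}_H(t_0)\le\lim_{\rho\to0}\dim_{\mathcal H}(\mathrm{Gr}_X(B(t_0,\rho)))\le 2-\widetilde{\alpha}_H(t_0)$. With probability one, the range satisfies: for all $t_0\in\mathbf{R}_+$, $\lim_{\rho\to0}\dim_{\mathcal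 H}(\mathrm{Rg}_X(B(t_0,\rho)))=1$. Moreover, if in addition $H(t)<\beta$ for all $t\in\mathbf{R}_+$, then, with probability one, for all $t_0\in\mathbf{R}_+$, $\lim_{\rho\to0}\dim_{\mathcal H}(\mathrm{Gr}_X(B(t_0,\rho)))=2-H(t_0)$.
   Context: $\mathbf{R}_+=[0,\infty)$; $B(t_0,\rho)$ is the ball (interval) of $\mathbf{R}_+$ with center $t_0$ and radius $\rho$. $\widehat{\mathbb{W}}$ is the Fourier transform of a Gaussian measure (white noise) $\mathbb{W}$, understood in the usual sense $\int\widehat f\,d\widehat{\mathbb{W}}=\int f\,d\mathbb{W}$ for real $f\in L^2(\mathbf{R})$ (up to normalization), so that $X$ is a real-valued zero-mean Gaussian process. The local Hölder exponent and the local sub-exponent of the function $H$ at $t_0$ are $$\widetilde{\alpha}_H(t_0)=\sup\Big\{\alpha>0:\ \lim_{\rho\to0}\sup_{s,t\in B(t_0,\rho)}\frac{|H(t)-H(s)|}{|t-s|^{\alpha}}<+\infty\Big\},$$ $$\underline{\alpha}_H(t_0)=\inf\Big\{\alpha>0:\ \lim_{\rho\to0}\inf_{s,t\in B(t_0,\rho)}\frac{|H(t)-H(s)|}{|t-s|^{\alpha}}=+\infty\Big\}$$ (sup and inf over $s\ne t$; $\inf\emptyset=+\infty$). $\mathrm{Rg}_X(A)=\{X_t;\ t\in A\}$ and $\mathrm{Gr}_X(A)=\{(t,X_t);\ t\in A\}$ are the range and graph of $X$ over $A$, and $\dim_{\mathcal H}$ is Hausdorff dimension. "With probability one, for all $t_0$"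 means on a single event of probability one, simultaneously for all $t_0$. *)

theory Defs
  imports "HOL-Probability.Probability"
begin

section \<open>Hausdorff dimension\<close>

text \<open>
  The sets of a cover are required to be bounded because \<^const>\<open>diameter\<close> is only meaningful on
  bounded sets. Since \<open>0 powr 0 = 0\<close>, the measure below is used for exponents \<open>s > 0\<close> only.
\<close>

definition hausdorff_premeasure :: "real \<Rightarrow> real \<Rightarrow> 'a::metric_space set \<Rightarrow> ennreal" where
  "hausdorff_premeasure s \<delta> A =
     (INF U \<in> {U :: nat \<Rightarrow> 'a set. A \<subseteq> (\<Union>i. U i) \<and> (\<forall>i. bounded (U i) \<and> diameter (U i) \<le> \<delta>)}.
        (\<Sum>i. ennreal (diameter (U i) powr s)))"

definition hausdorff_outer_measure :: "real \<Rightarrow> 'a::metric_space set \<Rightarrow> ennreal" where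
  "hausdorff_outer_measure s A = (SUP \<delta> \<in> {0<..}. hausdorff_premeasure s \<delta> A)"

definition hausdorff_dim :: "'a::metric_space set \<Rightarrow> ereal" where
  "hausdorff_dim A = Inf (ereal ` {s. 0 < s \<and> hausdorff_outer_measure s A = 0})"


section \<open>Hoelder regularity of functions on the half-line\<close>

text \<open>Functions on $[0,\infty)$ are represented by total functions on \<^typ>\<open>real\<close> whose values
  at negative arguments are never used.\<close>

definition half_line_ball :: "real \<Rightarrow> real \<Rightarrow> real set" where
  "half_line_ball t\<^sub>0 \<rho> = ball t\<^sub>0 \<rho> \<inter> {0..}"

definition hoelder_continuous_on :: "real \<Rightarrow> real set \<Rightarrow> (real \<Rightarrow> real) \<Rightarrow> bool" where
  "hoelder_continuous_on \<beta> S h \<longleftrightarrow> (\<exists>C. \<forall>s\<in>S. \<forall>t\<in>S. \<bar>h t - h s\<bar> \<le> C * \<bar>t - s\<bar> powr \<beta>)"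

definition sup_quotient :: "(real \<Rightarrow> real) \<Rightarrow> real \<Rightarrow> real \<Rightarrow> real \<Rightarrow> ereal" where
  "sup_quotient h t\<^sub>0 \<alpha> \<rho> =
     Sup {ereal (\<bar>h t - h s\<bar> / \<bar>t - s\<bar> powr \<alpha>) | s t.
            s \<in> half_line_ball t\<^sub>0 \<rho> \<and> t \<in> half_line_ball t\<^sub>0 \<rho> \<and> s \<noteq> t}"

definition inf_quotient :: "(real \<Rightarrow> real) \<Rightarrow> real \<Rightarrow> real \<Rightarrow> real \<Rightarrow> ereal" where
  "inf_quotient h t\<^sub>0 \<alpha> \<rho> =
     Inf {ereal (\<bar>h t - h s\<bar> / \<bar>t - s\<bar> powr \<alpha>) | s t.
            s \<in> half_line_ball t\<^sub>0 \<rho> \<and> t \<in> half_line_ball t\<^sub>0 \<rho> \<and> s \<noteq> t}"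

text \<open>Both exponents are extended reals: the local exponent is \<open>\<infinity>\<close> for a locally constant
  function, and the sub-exponent is \<open>\<infinity>\<close> if no \<open>\<alpha>\<close> qualifies.\<close>

definition local_hoelder_exponent :: "(real \<Rightarrow> real) \<Rightarrow> real \<Rightarrow> ereal" where
  "local_hoelder_exponent h t\<^sub>0 =
     Sup (ereal ` {\<alpha>. 0 < \<alpha> \<and> (\<exists>L. L < \<infinity> \<and> (sup_quotient h t\<^sub>0 \<alpha> \<longlongrightarrow> L) (at_right 0))})"

definition local_sub_exponent :: "(real \<Rightarrow> real) \<Rightarrow> real \<Rightarrow> ereal" where
  "local_sub_exponent h t\<^sub>0 =
     Inf (ereal ` {\<alpha>. 0 < \<alpha> \<and> (inf_quotient h t\<^sub>0 \<alpha> \<longlongrightarrow> \<infinity>) (at_right 0)})"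


section \<open>White noise and its Fourier transform\<close>

text \<open>Centered normal law of variance \<open>v\<close>, the Dirac mass at \<open>0\<close> being included as \<open>v = 0\<close>.\<close>

definition centered_gaussian :: "'w measure \<Rightarrow> ('w \<Rightarrow> real) \<Rightarrow> real \<Rightarrow> bool" where
  "centered_gaussian M Y v \<longleftrightarrow> Y \<in> borel_measurable M \<and>
     (if v = 0 then AE \<omega> in M. Y \<omega> = 0
      else 0 < v \<and> distributed M lborel Y (\<lambda>x. ennreal (normal_density 0 (sqrt v) x)))"

text \<open>Independently scattered Gaussian random measure on the real line whose control measure is
  Lebesgue measure; \<open>W\<close> is only constrained on Borel sets of finite measure.\<close>

definition white_noise :: "'w measure \<Rightarrow> (real set \<Rightarrow> 'w \<Rightarrow> real) \<Rightarrow> bool" where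
  "white_noise M W \<longleftrightarrow> prob_space M \<and>
     (\<forall>A\<in>sets lborel. emeasure lborel A < \<infinity> \<longrightarrow> centered_gaussian M (W A) (measure lborel A)) \<and>
     (\<forall>A :: nat \<Rightarrow> real set.
        disjoint_family A \<and> (\<forall>i. A i \<in> sets lborel \<and> emeasure lborel (A i) < \<infinity>) \<longrightarrow>
          prob_space.indep_vars M (\<lambda>_. borel) (\<lambda>i. W (A i)) UNIV) \<and>
     (\<forall>A :: nat \<Rightarrow> real set.
        disjoint_family A \<and> (\<forall>i. A i \<in> sets lborel) \<and> emeasure lborel (\<Union>i. A i) < \<infinity> \<longrightarrow>
          (AE \<omega> in M. (\<lambda>i. W (A i) \<omega>) sums W (\<Union>i. A i) \<omega>))"

text \<open>Integral of a simple function supported on a set of finite measure; the summand \<open>y = 0\<close>, for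
  which the level set has infinite measure, vanishes.\<close>

definition simple_white_noise_integral ::
    "(real set \<Rightarrow> 'w \<Rightarrow> real) \<Rightarrow> (real \<Rightarrow> real) \<Rightarrow> 'w \<Rightarrow> real" where
  "simple_white_noise_integral W s \<omega> = (\<Sum>y\<in>range s. y * W {x. s x = y} \<omega>)"

text \<open>\<open>Y\<close> is a version of \<open>\<integral> f dW\<close>: the isometric extension from simple functions to the real
  space $L^2(\mathbf{R})$, expressed by mean-square limits.\<close>

definition white_noise_integral ::
    "'w measure \<Rightarrow> (real set \<Rightarrow> 'w \<Rightarrow> real) \<Rightarrow> (real \<Rightarrow> real) \<Rightarrow> ('w \<Rightarrow> real) \<Rightarrow> bool" where
  "white_noise_integral M W f Y \<longleftrightarrow>
     f \<in> borel_measurable lborel \<and> integrable lborel (\<lambda>x. (f x)\<^sup>2) \<and> Y \<in> borel_measurable M \<and>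
     (\<exists>s :: nat \<Rightarrow> real \<Rightarrow> real.
        (\<forall>k. simple_function lborel (s k) \<and> emeasure lborel {x. s k x \<noteq> 0} < \<infinity>) \<and>
        (\<lambda>k. \<integral>\<^sup>+ x. ennreal ((f x - s k x)\<^sup>2) \<partial>lborel) \<longlonglongrightarrow> 0 \<and>
        (\<lambda>k. \<integral>\<^sup>+ \<omega>. ennreal ((Y \<omega> - simple_white_noise_integral W (s k) \<omega>)\<^sup>2) \<partial>M) \<longlonglongrightarrow> 0)"

text \<open>\<open>g\<close> is the $L^2$ (Plancherel) Fourier transform of the real function \<open>f\<close>, in the unitary
  normalization, i.e. the mean-square limit of the Fourier integrals over \<open>[-n, n]\<close>.\<close>

definition L2_fourier_transform :: "(real \<Rightarrow> real) \<Rightarrow> (real \<Rightarrow> complex) \<Rightarrow> bool" where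
  "L2_fourier_transform f g \<longleftrightarrow>
     f \<in> borel_measurable lborel \<and> integrable lborel (\<lambda>x. (f x)\<^sup>2) \<and> g \<in> borel_measurable lborel \<and>
     (\<lambda>n. \<integral>\<^sup>+ \<xi>. ennreal ((cmod
          (complex_of_real (1 / sqrt (2 * pi)) *
             set_lebesgue_integral lborel {- real n..real n}
               (\<lambda>x. exp (- (\<i> * complex_of_real (x * \<xi>))) * complex_of_real (f x))
           - g \<xi>))\<^sup>2) \<partial>lborel) \<longlonglongrightarrow> 0"

text \<open>\<open>Y\<close> is a version of the integral of \<open>g\<close> against the Fourier transform of the white noise,
  defined by \<open>\<integral> \<F>f d(\<F>W) = \<integral> f dW\<close> for real \<open>f\<close> in $L^2(\mathbf{R})$.\<close>

definition fourier_white_noise_integral ::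
    "'w measure \<Rightarrow> (real set \<Rightarrow> 'w \<Rightarrow> real) \<Rightarrow> (real \<Rightarrow> complex) \<Rightarrow> ('w \<Rightarrow> real) \<Rightarrow> bool" where
  "fourier_white_noise_integral M W g Y \<longleftrightarrow>
     (\<exists>f. L2_fourier_transform f g \<and> white_noise_integral M W f Y)"


section \<open>Multifractional Brownian motion\<close>

text \<open>The stochastic integral determines each \<open>X t\<close> only up to a null set depending on \<open>t\<close>; as
  usual, the process is taken with almost surely continuous sample paths.\<close>

definition multifractional_brownian_motion ::
    "'w measure \<Rightarrow> (real set \<Rightarrow> 'w \<Rightarrow> real) \<Rightarrow> (real \<Rightarrow> real) \<Rightarrow> (real \<Rightarrow> 'w \<Rightarrow> real) \<Rightarrow> bool" where
  "multifractional_brownian_motion M W H X \<longleftrightarrow>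
     (\<forall>t\<ge>0. fourier_white_noise_integral M W
        (\<lambda>\<xi>. (exp (\<i> * complex_of_real (t * \<xi>)) - 1)
               / complex_of_real (\<bar>\<xi>\<bar> powr (H t + 1 / 2))) (X t)) \<and>
     (AE \<omega> in M. continuous_on {0..} (\<lambda>t. X t \<omega>))"

definition path_range :: "(real \<Rightarrow> 'w \<Rightarrow> real) \<Rightarrow> 'w \<Rightarrow> real set \<Rightarrow> real set" where
  "path_range X \<omega> A = (\<lambda>t. X t \<omega>) ` A"

definition path_graph :: "(real \<Rightarrow> 'w \<Rightarrow> real) \<Rightarrow> 'w \<Rightarrow> real set \<Rightarrow> (real \<times> real) set" where
  "path_graph X \<omega> A = (\<lambda>t. (t, X t \<omega>)) ` A"

end

theory Submission
  imports Defs "HOL-Real_Asymp.Real_Asymp"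
begin

text \<open>
  An increment of \<open>X\<close> is a mean-square limit of centered Gaussian variables whose variances tend, by Plancherel's
  identity, to the squared $L^2$ norm of the difference \<open>g\<^sub>t - g\<^sub>s\<close> of the kernels.
  This squared norm is at most a constant times $|t-s|^{2H(t)} + (H(t)-H(s))^2$, and at least a constant times
  $|t-s|^{2H(t)}$ for close \<open>s\<close> and \<open>t\<close>. By Fatou's lemma the Gaussian bounds on even moments and on negative
  moments of order \<open>b < 1\<close> carry over to the increments, whose exact law is never needed.
  The even moments give a modulus of continuity by dyadic chaining, hence covers of the graph by squares. The
  negative moments give finite energies for the kernel $|t-s|^{-a} |X_t-X_s|^{-b}$ with \<open>a + b < 2 - H\<close>,
  hence the lower bounds. Almost sure bounds on all intervals with rational end points then control every \<open>t\<^sub>0\<close> at once.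

  The third case never occurs: a local sub-exponent below \<open>1\<close> would force \<open>H\<close> to be monotone near \<open>t\<^sub>0\<close> with increments
  too large to add up to a finite total.
\<close>

section \<open>Bounds for the Hausdorff dimension\<close>

text \<open>The value of the lower bound comes from a balance. The mean energy is finite when
  \<open>a + b * H < 1\<close>, so \<open>s = a + b\<close> may be anything below
  \<open>1 + b * (1 - H)\<close>; \<open>b\<close> can approach 1 but not reach it, since a Gaussian
  density is positive at 0. In the upper bound, chaining with moments of order \<open>2 * k\<close>
  loses \<open>1 / (2 * k)\<close> in the exponent, so arbitrarily high moments are used. The two
  directions see the roughness of \<open>H\<close> differently. In the lower bound a change of
  exponent enters through \<open>\<bar>H t - H s\<bar> * ln (1 / \<bar>t - s\<bar>)\<close>, which
  tends to 0 for every positive Hoelder exponent; so \<open>2 - H\<close> is a lower bound at every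
  point. In the upper bound \<open>\<bar>H t - H s\<bar>\<close> competes directly with
  \<open>\<bar>t - s\<bar> powr H\<close>, and the smaller of \<open>H\<close> and the local Hoelder
  exponent decides. This separates the first two cases. The time-domain integrands behind
  \<open>X\<close> are only known to exist, so every variance has to be read off the kernels, by
  Plancherel's identity for differences of two given L2 transforms.\<close>

lemma hausdorff_premeasure_mono:
  "A \<subseteq> B \<Longrightarrow> hausdorff_premeasure s \<delta> A \<le> hausdorff_premeasure s \<delta> B"
  unfolding hausdorff_premeasure_def by (rule INF_superset_mono) auto

lemma hausdorff_outer_measure_mono:
  "A \<subseteq> B \<Longrightarrow> hausdorff_outer_measure s A \<le> hausdorff_outer_measure s B"
  unfolding hausdorff_outer_measure_def by (intro SUP_mono) (auto intro: hausdorff_premeasure_mono)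

lemma hausdorff_dim_mono: "A \<subseteq> B \<Longrightarrow> hausdorff_dim A \<le> hausdorff_dim B"
  unfolding hausdorff_dim_def
  by (intro Inf_superset_mono image_mono)
    (auto, metis hausdorff_outer_measure_mono le_zero_eq)

lemma hausdorff_dim_geI:
  assumes "\<And>s. 0 < s \<Longrightarrow> s < d \<Longrightarrow> hausdorff_outer_measure s A \<noteq> 0"
  shows "ereal d \<le> hausdorff_dim A"
  unfolding hausdorff_dim_def
  by (intro Inf_greatest) (use assms in force)

lemma hausdorff_dim_leI:
  assumes "\<And>s. d < s \<Longrightarrow> hausdorff_outer_measure s A = 0" "0 \<le> d"
  shows "hausdorff_dim A \<le> ereal d"
proof (rule ereal_le_epsilon2)
  show "hausdorff_dim A \<le> ereal d + ereal e" if "0 < e" for e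
  proof -
    from that have "d + e \<in> {s. 0 < s \<and> hausdorff_outer_measure s A = 0}"
      using assms by auto
    then show ?thesis
      unfolding hausdorff_dim_def by (auto intro!: Inf_lower)
  qed
qed

section \<open>Upper bounds by counting the sets of a cover\<close>

text \<open>Box counting: as soon as \<open>d n\<close> is below the scale, the single cover
  \<open>C n\<close> bounds the premeasure at that scale by the number of its sets times
  \<open>d n powr s\<close>. This tends to 0, so every premeasure vanishes, and so does their
  supremum.\<close>

lemma hausdorff_outer_measure_zeroI:
  fixes A :: "'a::metric_space set"
  assumes "0 < s"
    and cov: "\<And>n. A \<subseteq> \<Union>(C n)" and fin: "\<And>n. finite (C n)"
    and sm: "\<And>n U. U \<in> C n \<Longrightarrow> bounded U \<and> diameter U \<le> d n"
    and d: "d \<longlonglongrightarrow> 0" and lim: "(\<lambda>n. real (card (C n)) * d n powr s) \<longlonglongrightarrow> 0"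
  shows "hausdorff_outer_measure s A = 0"
proof -
  have bound: "hausdorff_premeasure s \<delta> A \<le> ennreal (real (card (C n)) * d n powr s)"
    if "d n \<le> \<delta>" "0 \<le> \<delta>" for n \<delta>
  proof -
    define N where "N = card (C n)"
    obtain e where e: "bij_betw e {..<N} (C n)"
      using ex_bij_betw_nat_finite[OF fin] unfolding N_def atLeast0LessThan by blast
    \<comment> \<open>A cover is by definition a sequence of sets. The finite cover is filled up
      with empty sets, which cost nothing because their diameter is 0 and
      \<open>0 powr s = 0\<close>.\<close>
    define U where "U i = (if i < N then e i else {})" for i
    have Ce: "C n = e ` {..<N}" using e unfolding bij_betw_def by blast
    then have eC: "e i \<in> C n" if "i < N" for i using that by blast
    have "U i = e i" if "i < N" for i using that by (simp add: U_def)
    then have "e ` {..<N} \<subseteq> range U" by (metis image_subsetI lessThan_iff rangeI)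
    then have AU: "A \<subseteq> (\<Union>i. U i)"
      using cov[of n] Ce by (metis Sup_subset_mono order_trans)
    have bdU: "bounded (U i) \<and> diameter (U i) \<le> \<delta>" for i
      using sm[OF eC, of i] that by (cases "i < N") (auto simp: U_def)
    have "hausdorff_premeasure s \<delta> A \<le> (\<Sum>i. ennreal (diameter (U i) powr s))"
      unfolding hausdorff_premeasure_def
      by (intro INF_lower) (use AU bdU in simp)
    also have "\<dots> = (\<Sum>i<N. ennreal (diameter (U i) powr s))"
      by (intro suminf_finite) (auto simp: U_def)
    also have "\<dots> \<le> (\<Sum>i<N. ennreal (d n powr s))"
    proof (intro sum_mono ennreal_leI powr_mono2)
      fix i assume "i \<in> {..<N}"
      then show "diameter (U i) \<le> d n" using sm[OF eC, of i] by (simp add: U_def)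
      show "0 \<le> diameter (U i)" using bdU[of i] by (simp add: diameter_ge_0)
    qed (use \<open>0 < s\<close> in simp)
    also have "\<dots> = ennreal (real (card (C n)) * d n powr s)"
      by (simp add: N_def ennreal_mult ennreal_of_nat_eq_real_of_nat)
    finally show ?thesis .
  qed
  have "hausdorff_premeasure s \<delta> A = 0" if "0 < \<delta>" for \<delta>
  proof -
    have "eventually (\<lambda>n. d n \<le> \<delta>) sequentially"
      using order_tendstoD(2)[OF d that] by eventually_elim simp
    then have "eventually (\<lambda>n. hausdorff_premeasure s \<delta> A \<le> ennreal (real (card (C n)) * d n powr s)) sequentially"
      by eventually_elim (use bound that in auto)
    moreover have "(\<lambda>n. ennreal (real (card (C n)) * d n powr s)) \<longlonglongrightarrow> ennreal 0"
      using lim by (intro tendsto_ennrealI)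
    ultimately have "hausdorff_premeasure s \<delta> A \<le> ennreal 0"
      by (intro tendsto_lowerbound) auto
    then show ?thesis by simp
  qed
  then show ?thesis unfolding hausdorff_outer_measure_def by simp
qed

section \<open>Lower bounds by finite energy\<close>

text \<open>Mass distribution: a cover of the image has to carry the Lebesgue measure of the times.
  Among times whose potential is at most \<open>m\<close>, a set of diameter \<open>d\<close>
  receives measure at most \<open>m * d powr s\<close>, because \<open>K\<close> is at least the
  inverse of \<open>d powr s\<close> there. An abstract majorant \<open>K\<close> of the inverse
  power of the distance lets time and space enter the kernel with separate exponents.\<close>

lemma hausdorff_outer_measure_nonzero_energy:
  fixes z :: "real \<Rightarrow> 'a::metric_space"
  assumes "a < b" and z: "continuous_on {a..b} z"
    and K: "case_prod K \<in> borel_measurable (borel \<Otimes>\<^sub>M borel)"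
    and KK: "\<And>t u d. t \<in> {a..b} \<Longrightarrow> u \<in> {a..b} \<Longrightarrow> dist (z t) (z u) \<le> d \<Longrightarrow> inverse (ennreal (d powr s)) \<le> K t u"
    and fin: "(\<integral>\<^sup>+t. (\<integral>\<^sup>+u. K t u * indicator {a..b} u \<partial>lborel) * indicator {a..b} t \<partial>lborel) < \<infinity>"
  shows "hausdorff_outer_measure s (z ` {a..b}) \<noteq> 0"
proof -
  define \<Phi> where "\<Phi> t = (\<integral>\<^sup>+u. K t u * indicator {a..b} u \<partial>lborel)" for t
  have [measurable]: "case_prod K \<in> borel_measurable (borel \<Otimes>\<^sub>M borel)" by (rule K)
  have [measurable]: "\<Phi> \<in> borel_measurable borel" unfolding \<Phi>_def by measurable
  \<comment> \<open>Finite energy makes the potential finite almost everywhere, so these sublevel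
    sets exhaust the interval up to a null set and one of them has positive measure.\<close>
  define B where "B m = {t \<in> {a..b}. \<Phi> t \<le> of_nat m}" for m :: nat
  have [measurable]: "B m \<in> sets borel" for m unfolding B_def by measurable
  have "AE t in lborel. \<Phi> t * indicator {a..b} t \<noteq> \<infinity>"
    using fin unfolding \<Phi>_def[symmetric] by (intro nn_integral_PInf_AE) auto
  then have AEB: "AE t in lborel. t \<in> {a..b} \<longrightarrow> t \<in> (\<Union>m. B m)"
  proof eventually_elim
    case (elim t)
    show ?case
    proof
      assume t: "t \<in> {a..b}"
      then have "\<Phi> t < \<infinity>" using elim by (auto simp: top.not_eq_extremum)
      then obtain m :: nat where "\<Phi> t < of_nat m"
        using ennreal_Ex_less_of_nat by auto
      then show "t \<in> (\<Union>m. B m)" using t by (auto simp: B_def intro!: exI[of _ m])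
    qed
  qed
  have "\<exists>m. emeasure lborel (B m) \<noteq> 0"
  proof (rule ccontr)
    assume "\<not> ?thesis"
    then have "B m \<in> null_sets lborel" for m by auto
    then have "(\<Union>m. B m) \<in> null_sets lborel" by auto
    then have "AE t in lborel. t \<notin> (\<Union>m. B m)" by (rule AE_not_in)
    with AEB have "AE t in lborel. t \<notin> {a..b}" by eventually_elim auto
    then have "emeasure lborel {a..b} = 0"
      by (subst (asm) AE_iff_null_sets[symmetric]) auto
    then show False using \<open>a < b\<close> by simp
  qed
  then obtain m where m: "emeasure lborel (B m) \<noteq> 0" ..
  have lower: "emeasure lborel (B m) \<le> of_nat m * (\<Sum>i. ennreal (diameter (U i) powr s))"
    if cov: "z ` {a..b} \<subseteq> (\<Union>i. U i)" and bd: "\<And>i. bounded (U i)" for U :: "nat \<Rightarrow> 'a set"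
  proof -
    \<comment> \<open>The sets of a cover need not be measurable. Their closures have the same
      diameter, and the preimage of a closed set under the continuous \<open>z\<close> is closed,
      hence Borel.\<close>
    define V where "V i = {t \<in> {a..b}. z t \<in> closure (U i)}" for i
    have clV: "closed (V i)" for i
      unfolding V_def using continuous_closed_preimage[OF z, of "closure (U i)"]
      by (simp add: vimage_def Int_def)
    have V[measurable]: "V i \<in> sets borel" for i by (rule borel_closed[OF clV])
    have VB: "emeasure lborel (V i \<inter> B m) \<le> of_nat m * ennreal (diameter (U i) powr s)" for i
    proof (cases "V i \<inter> B m = {}")
      case False
      then obtain t where t: "t \<in> V i" "t \<in> B m" by auto
      define d where "d = diameter (U i)"
      have d: "dist (z t) (z u) \<le> d" if "u \<in> V i" for u
        using t that bd[of i] diameter_bounded_bound[of "closure (U i)" "z t" "z u"]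
        by (auto simp: V_def d_def diameter_closure)
      have "inverse (ennreal (d powr s)) * emeasure lborel (V i) =
          (\<integral>\<^sup>+u. inverse (ennreal (d powr s)) * indicator (V i) u \<partial>lborel)"
        by (subst nn_integral_cmult_indicator) (simp_all add: V)
      also have "\<dots> \<le> \<Phi> t"
        unfolding \<Phi>_def
        by (intro nn_integral_mono) (use t d KK in \<open>auto simp: V_def split: split_indicator\<close>)
      also have "\<dots> \<le> of_nat m" using t by (auto simp: B_def)
      finally have *: "inverse (ennreal (d powr s)) * emeasure lborel (V i) \<le> of_nat m" .
      have "emeasure lborel (V i) \<le> of_nat m * ennreal (d powr s)"
      \<comment> \<open>For diameter 0 the inverse is infinite, so the finite bound forces
        \<open>V i\<close> to be a null set.\<close>
      proof (cases "d powr s = 0")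
        case True
        then have "emeasure lborel (V i) = 0"
          using * by (auto simp: ennreal_top_mult top_unique split: if_splits)
        then show ?thesis by simp
      next
        case False
        then have p: "d powr s > 0" by simp
        have "emeasure lborel (V i) = ennreal (d powr s) * (inverse (ennreal (d powr s)) * emeasure lborel (V i))"
          using p by (simp add: mult.assoc[symmetric] inverse_ennreal ennreal_mult[symmetric])
        also have "\<dots> \<le> ennreal (d powr s) * of_nat m"
          by (intro mult_left_mono *) auto
        finally show ?thesis by (simp add: mult.commute)
      qed
      moreover have "emeasure lborel (V i \<inter> B m) \<le> emeasure lborel (V i)"
        by (intro emeasure_mono) auto
      ultimately show ?thesis by (simp add: d_def)
    qed simp
    have "B m \<subseteq> (\<Union>i. V i \<inter> B m)"
    proof
      fix t assume t: "t \<in> B m"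
      then have "z t \<in> (\<Union>i. U i)" using cov unfolding B_def by blast
      then obtain i where "z t \<in> U i" by auto
      then have "z t \<in> closure (U i)" using closure_subset by blast
      then show "t \<in> (\<Union>i. V i \<inter> B m)" using t by (auto simp: V_def B_def)
    qed
    then have "emeasure lborel (B m) \<le> emeasure lborel (\<Union>i. V i \<inter> B m)"
      by (intro emeasure_mono) auto
    also have "\<dots> \<le> (\<Sum>i. emeasure lborel (V i \<inter> B m))"
      by (intro emeasure_subadditive_countably) auto
    also have "\<dots> \<le> (\<Sum>i. of_nat m * ennreal (diameter (U i) powr s))"
      by (intro suminf_le VB) auto
    also have "\<dots> = of_nat m * (\<Sum>i. ennreal (diameter (U i) powr s))"
      by (rule ennreal_suminf_cmult)
    finally show ?thesis .
  qed
  show ?thesis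
  proof
    assume z0: "hausdorff_outer_measure s (z ` {a..b}) = 0"
    have "hausdorff_premeasure s 1 (z ` {a..b}) \<le> hausdorff_outer_measure s (z ` {a..b})"
      unfolding hausdorff_outer_measure_def by (intro SUP_upper) auto
    then have p0: "hausdorff_premeasure s 1 (z ` {a..b}) = 0" using z0 by simp
    have le: "emeasure lborel (B m) \<le> ennreal e" if e: "0 < e" for e
    proof -
      \<comment> \<open>The tolerance is divided by \<open>m + 1\<close> because
        \<open>lower\<close> multiplies the cost of the cover by \<open>m\<close>; the summand 1
        takes care of \<open>m = 0\<close>.\<close>
      have "hausdorff_premeasure s 1 (z ` {a..b}) < ennreal (e / (real m + 1))"
        using e p0 by simp
      then obtain U where U: "z ` {a..b} \<subseteq> (\<Union>i. U i)" "\<And>i. bounded (U i)"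
        "(\<Sum>i. ennreal (diameter (U i) powr s)) < ennreal (e / (real m + 1))"
        unfolding hausdorff_premeasure_def INF_less_iff by auto
      have "emeasure lborel (B m) \<le> of_nat m * (\<Sum>i. ennreal (diameter (U i) powr s))"
        by (rule lower[OF U(1,2)])
      also have "\<dots> \<le> of_nat m * ennreal (e / (real m + 1))"
        using U(3) by (intro mult_left_mono) auto
      also have "\<dots> = ennreal (real m * (e / (real m + 1)))"
        using e by (simp add: ennreal_mult[symmetric] ennreal_of_nat_eq_real_of_nat)
      also have "\<dots> \<le> ennreal e"
        using e by (intro ennreal_leI) (simp add: field_simps)
      finally show ?thesis .
    qed
    have "emeasure lborel (B m) \<le> 0"
      by (rule ennreal_le_epsilon) (use le in auto)
    then show False using m by simp
  qed
qed

lemma dyadic_piece: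
  fixes a b t :: real
  assumes "a < b" "t \<in> {a..b}"
  obtains i :: nat where "i < 2 ^ n" "t \<in> {a + real i * (b - a) / 2 ^ n .. a + (real i + 1) * (b - a) / 2 ^ n}"
\<comment> \<open>Rounding down would give the index \<open>2 ^ n\<close> at the right end point,
  which is therefore assigned to the last interval.\<close>
proof (cases "t = b")
  case True
  have "real (2 ^ n - 1) = 2 ^ n - 1" by (simp add: of_nat_diff)
  then show ?thesis using True assms
    by (intro that[of "2 ^ n - 1"]) (auto simp: field_simps)
next
  case False
  define y where "y = (t - a) / (b - a) * 2 ^ n"
  have y: "0 \<le> y" "y < 2 ^ n" using assms False by (auto simp: y_def field_simps)
  have t: "t = a + y * (b - a) / 2 ^ n" using assms by (simp add: y_def)
  have "nat \<lfloor>y\<rfloor> < 2 ^ n" using y by (simp add: nat_less_iff floor_less_iff)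
  moreover have "real (nat \<lfloor>y\<rfloor>) \<le> y" "y \<le> real (nat \<lfloor>y\<rfloor>) + 1" using y by linarith+
  ultimately show ?thesis using assms
    by (intro that[of "nat \<lfloor>y\<rfloor>"]) (auto simp: t divide_right_mono mult_right_mono)
qed

text \<open>Over each of the \<open>2 ^ n\<close> dyadic intervals the function varies by at most
  the order of \<open>(1 / 2 ^ n) powr \<alpha>\<close>, so the order of
  \<open>2 powr (n * (1 - \<alpha>))\<close> boxes with sides comparable to \<open>1 / 2 ^ n\<close>
  suffice. For \<open>s > 2 - \<alpha>\<close> the power \<open>s\<close> of the size beats the
  total number \<open>2 powr (n * (2 - \<alpha>))\<close>.\<close>

lemma hausdorff_dim_graph_le:
  fixes f :: "real \<Rightarrow> real"
  assumes "a < b" "0 < \<alpha>" "\<alpha> \<le> 1" "0 \<le> C"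
    and osc: "\<And>n i t. i < 2 ^ n \<Longrightarrow> t \<in> {a + real i * (b - a) / 2 ^ n .. a + (real i + 1) * (b - a) / 2 ^ n}
       \<Longrightarrow> \<bar>f t - f (a + real i * (b - a) / 2 ^ n)\<bar> \<le> C * (1 / 2 ^ n) powr \<alpha>"
  shows "hausdorff_dim ((\<lambda>t. (t, f t)) ` {a..b}) \<le> ereal (2 - \<alpha>)"
proof (rule hausdorff_dim_leI)
  show "0 \<le> 2 - \<alpha>" using assms by simp
  fix s assume s: "2 - \<alpha> < s"
  then have s0: "0 < s" using assms by simp
  define q where "q n i = a + real i * (b - a) / 2 ^ n" for n i
  \<comment> \<open>The oscillation divided by the height \<open>1 / 2 ^ n\<close> of a box: the
    number of boxes needed on either side of the value at the left end of a dyadic interval.\<close>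
  define J where "J n = \<lceil>C * 2 powr (real n * (1 - \<alpha>))\<rceil>" for n
  define S where "S n i j = {q n i .. q n i + (b - a) / 2 ^ n} \<times>
      {f (q n i) + of_int j / 2 ^ n .. f (q n i) + (of_int j + 1) / 2 ^ n}" for n i and j :: int
  define Cv where "Cv n = (\<lambda>(i, j). S n i j) ` ({..<2 ^ n} \<times> {- J n .. J n})" for n :: nat
  define d where "d n = (b - a + 1) / 2 ^ n" for n :: nat
  have q1: "a + (real i + 1) * (b - a) / 2 ^ n = q n i + (b - a) / 2 ^ n" for n i
    by (simp add: q_def field_simps)
  have pw: "(1 / 2 ^ n) powr x = 2 powr (- real n * x)" for n and x :: real
    by (simp add: powr_realpow[symmetric] powr_minus_divide[symmetric] powr_powr)
  have two_pow: "(2::real) ^ n = 2 powr real n" for n by (simp add: powr_realpow)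
  show "hausdorff_outer_measure s ((\<lambda>t. (t, f t)) ` {a..b}) = 0"
  proof (rule hausdorff_outer_measure_zeroI[OF s0, where C = Cv and d = d])
    fix n
    show "finite (Cv n)" by (simp add: Cv_def)
    show "(\<lambda>t. (t, f t)) ` {a..b} \<subseteq> \<Union>(Cv n)"
    proof
      fix p assume "p \<in> (\<lambda>t. (t, f t)) ` {a..b}"
      then obtain t where t: "t \<in> {a..b}" and p: "p = (t, f t)" by auto
      obtain i where i: "i < 2 ^ n" "t \<in> {a + real i * (b - a) / 2 ^ n .. a + (real i + 1) * (b - a) / 2 ^ n}"
        using dyadic_piece[OF \<open>a < b\<close> t] by blast
      define y where "y = (f t - f (q n i)) * 2 ^ n"
      have "\<bar>f t - f (q n i)\<bar> \<le> C * (1 / 2 ^ n) powr \<alpha>" using osc[OF i] by (simp add: q_def)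
      then have "\<bar>y\<bar> \<le> C * (1 / 2 ^ n) powr \<alpha> * 2 ^ n"
        by (simp add: y_def abs_mult)
      also have "\<dots> = C * 2 powr (real n * (1 - \<alpha>))"
        unfolding pw unfolding mult.assoc two_pow powr_add[symmetric] by (simp add: algebra_simps)
      finally have "\<bar>y\<bar> \<le> of_int (J n)" unfolding J_def by linarith
      then have "\<lfloor>y\<rfloor> \<in> {- J n..J n}" by (auto simp: le_floor_iff floor_le_iff)
      moreover have "p \<in> S n i \<lfloor>y\<rfloor>"
      proof -
        have ft: "f t = f (q n i) + y / 2 ^ n" by (simp add: y_def)
        have "of_int \<lfloor>y\<rfloor> \<le> y" "y \<le> of_int \<lfloor>y\<rfloor> + 1" by linarith+
        then show ?thesis using i(2) unfolding p S_def q1[symmetric]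
          by (auto simp: ft q_def[symmetric] divide_right_mono)
      qed
      ultimately show "p \<in> \<Union>(Cv n)" using i(1) 
        unfolding Cv_def by (intro UnionI[OF imageI[of "(i, \<lfloor>y\<rfloor>)"]]) auto
    qed
  next
    fix n U assume "U \<in> Cv n"
    then obtain i j where U: "U = S n i j" by (auto simp: Cv_def)
    have "bounded U" unfolding U S_def by (intro bounded_Times) auto
    moreover have "diameter U \<le> d n"
    proof (rule diameter_le)
      show "U \<noteq> {} \<or> 0 \<le> d n" using assms by (simp add: d_def)
      fix x y assume "x \<in> U" "y \<in> U"
      then have "\<bar>fst x - fst y\<bar> \<le> (b - a) / 2 ^ n" "\<bar>snd x - snd y\<bar> \<le> 1 / 2 ^ n"
        unfolding U S_def by (auto simp: add_divide_distrib)
      moreover have "norm (x - y) = norm (fst x - fst y, snd x - snd y)" by (simp add: norm_prod_def)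
      then have "norm (x - y) \<le> \<bar>fst x - fst y\<bar> + \<bar>snd x - snd y\<bar>"
        using norm_Pair_le[of "fst x - fst y" "snd x - snd y"] by simp
      ultimately show "norm (x - y) \<le> d n" by (simp add: d_def add_divide_distrib)
    qed
    ultimately show "bounded U \<and> diameter U \<le> d n" by simp
  next
    show "d \<longlonglongrightarrow> 0" unfolding d_def by real_asymp
  next
    define D where "D = b - a + 1"
    have D: "D > 0" using assms by (simp add: D_def)
    have card: "real (card (Cv n)) \<le> (2 * C + 3) * 2 powr (real n * (2 - \<alpha>))" for n
    proof -
      have "0 \<le> C * 2 powr (real n * (1 - \<alpha>))" using \<open>0 \<le> C\<close> by simp
      then have J0: "0 \<le> J n" unfolding J_def by linarith
      have "card (Cv n) \<le> card ({..<2 ^ n :: nat} \<times> {- J n .. J n})"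
        unfolding Cv_def by (intro card_image_le) auto
      also have "\<dots> = 2 ^ n * nat (2 * J n + 1)" by (simp add: card_cartesian_product)
      finally have "real (card (Cv n)) \<le> real (2 ^ n * nat (2 * J n + 1))" by linarith
      also have "\<dots> = 2 ^ n * (2 * real_of_int (J n) + 1)" using J0 by simp
      also have "\<dots> \<le> 2 ^ n * (2 * (C * 2 powr (real n * (1 - \<alpha>)) + 1) + 1)"
      proof -
        have "real_of_int (J n) \<le> C * 2 powr (real n * (1 - \<alpha>)) + 1" unfolding J_def by linarith
        then show ?thesis by (intro mult_left_mono) auto
      qed
      \<comment> \<open>Of the 3, two come from rounding up \<open>J n\<close> on both sides and one
        from the box with index 0. They are absorbed because \<open>\<alpha> \<le> 1\<close> makes
        the power of 2 at least 1.\<close>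
      also have "\<dots> \<le> 2 ^ n * ((2 * C + 3) * 2 powr (real n * (1 - \<alpha>)))"
      proof -
        have "1 \<le> 2 powr (real n * (1 - \<alpha>))" using assms by (intro ge_one_powr_ge_zero) auto
        then show ?thesis by (intro mult_left_mono) (auto simp: algebra_simps)
      qed
      also have "\<dots> = (2 * C + 3) * 2 powr (real n * (2 - \<alpha>))"
        by (simp add: powr_realpow[symmetric] powr_add[symmetric] algebra_simps)
      finally show ?thesis .
    qed
    have L: "(\<lambda>n. (2 * C + 3) * D powr s * 2 powr (real n * (2 - \<alpha> - s))) \<longlonglongrightarrow> 0"
    proof -
      have "(\<lambda>n. (2 powr (2 - \<alpha> - s)) ^ n) \<longlonglongrightarrow> 0"
        using s by (intro LIMSEQ_realpow_zero) (auto simp: powr_less_one)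
      moreover have "(2 powr (2 - \<alpha> - s)) ^ n = 2 powr (real n * (2 - \<alpha> - s))" for n
        by (simp add: powr_realpow[symmetric] powr_powr mult.commute)
      ultimately show ?thesis using tendsto_mult_right_zero by fastforce
    qed
    have le: "real (card (Cv n)) * d n powr s \<le> (2 * C + 3) * D powr s * 2 powr (real n * (2 - \<alpha> - s))" for n
    proof -
      have "d n powr s = D powr s * 2 powr (- real n * s)"
        using D unfolding d_def D_def[symmetric]
        by (simp add: powr_divide powr_realpow[symmetric] powr_powr powr_minus_divide)
      then have "real (card (Cv n)) * d n powr s \<le> (2 * C + 3) * 2 powr (real n * (2 - \<alpha>)) * (D powr s * 2 powr (- real n * s))"
        using card[of n] by (intro mult_mono) auto
      also have "\<dots> = (2 * C + 3) * D powr s * (2 powr (real n * (2 - \<alpha>)) * 2 powr (- real n * s))"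
        by (simp add: mult_ac)
      also have "2 powr (real n * (2 - \<alpha>)) * 2 powr (- real n * s) = 2 powr (real n * (2 - \<alpha> - s))"
        by (simp add: powr_add[symmetric] algebra_simps)
      finally show ?thesis .
    qed
    show "(\<lambda>n. real (card (Cv n)) * d n powr s) \<longlonglongrightarrow> 0"
      by (rule tendsto_sandwich[OF _ _ tendsto_const L]) (auto simp: le)
  qed
qed

lemma hausdorff_dim_real_bounded_le_1:
  fixes A :: "real set"
  assumes "A \<subseteq> {c..d}"
  shows "hausdorff_dim A \<le> 1"
proof -
  \<comment> \<open>One more than the length, so that the dyadic subdivision applies to a single
    point as well.\<close>
  define R where "R = d - c + 1"
  have "hausdorff_dim {c..d} \<le> ereal 1"
  proof (cases "c \<le> d")
    case True
    then have R: "R > 0" by (simp add: R_def)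
    show ?thesis
    proof (rule hausdorff_dim_leI)
      fix s :: real assume s: "1 < s"
      define Cv where "Cv n = (\<lambda>i::nat. {c + real i * R / 2 ^ n .. c + (real i + 1) * R / 2 ^ n}) ` {..<2 ^ n}" for n :: nat
      show "hausdorff_outer_measure s {c..d} = 0"
      proof (rule hausdorff_outer_measure_zeroI[where C = Cv and d = "\<lambda>n. R / 2 ^ n"])
        fix n
        show "{c..d} \<subseteq> \<Union>(Cv n)"
        proof
          fix t assume "t \<in> {c..d}"
          then have "t \<in> {c..c+R}" by (simp add: R_def)
          then obtain i :: nat where "i < 2 ^ n" "t \<in> {c + real i * (c + R - c) / 2 ^ n .. c + (real i + 1) * (c + R - c) / 2 ^ n}"
            using dyadic_piece[of c "c + R" t n] R by auto
          then show "t \<in> \<Union>(Cv n)" by (auto simp: Cv_def)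
        qed
        show "finite (Cv n)" by (simp add: Cv_def)
        show "bounded U \<and> diameter U \<le> R / 2 ^ n" if "U \<in> Cv n" for U
          using that R by (auto simp: Cv_def field_simps)
      next
        show "(\<lambda>n. R / 2 ^ n) \<longlonglongrightarrow> 0" by real_asymp
        have "real (card (Cv n)) \<le> 2 ^ n" for n
        proof -
          have "card (Cv n) \<le> 2 ^ n" unfolding Cv_def using card_image_le[of "{..<2 ^ n :: nat}"] by fastforce
          then have "real (card (Cv n)) \<le> real (2 ^ n)" by (rule of_nat_mono)
          then show ?thesis by simp
        qed
        then have le: "real (card (Cv n)) * (R / 2 ^ n) powr s \<le> 2 ^ n * (R / 2 ^ n) powr s" for n
          by (intro mult_right_mono) auto
        have "(\<lambda>n. R powr s * (2 powr (1 - s)) ^ n) \<longlonglongrightarrow> R powr s * 0"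
          using s by (intro tendsto_intros LIMSEQ_realpow_zero) (auto simp: powr_less_one)
        moreover have "2 ^ n * (R / 2 ^ n) powr s = R powr s * (2 powr (1 - s)) ^ n" for n
        proof -
          have "2 ^ n * (R / 2 ^ n) powr s = R powr s * (2 powr real n * 2 powr (- real n * s))"
            using R by (simp add: powr_divide powr_realpow[symmetric] powr_powr powr_minus_divide)
          also have "2 powr real n * 2 powr (- real n * s) = (2 powr (1 - s)) ^ n"
            unfolding powr_add[symmetric] powr_realpow[symmetric, of "2 powr (1 - s)" n, simplified] powr_powr
            by (simp add: algebra_simps)
          finally show ?thesis .
        qed
        ultimately have "(\<lambda>n. 2 ^ n * (R / 2 ^ n) powr s) \<longlonglongrightarrow> 0" by simp
        then show "(\<lambda>n. real (card (Cv n)) * (R / 2 ^ n) powr s) \<longlonglongrightarrow> 0"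
          by (rule tendsto_sandwich[OF _ _ tendsto_const, rotated 2]) (auto simp: le)
        show "0 < s" using s by simp
      qed
    qed simp
  next
    case False
    \<comment> \<open>The interval is empty here. It is put inside a one-point set, which covers
      itself at diameter 0.\<close>
    then have "{c..d} \<subseteq> {0..0}" by simp
    moreover have "hausdorff_dim {0..0::real} \<le> ereal 1"
      by (rule hausdorff_dim_leI, rule hausdorff_outer_measure_zeroI[where C = "\<lambda>_. {{0}}" and d = "\<lambda>_. 0"]) auto
    ultimately show ?thesis using hausdorff_dim_mono order_trans by blast
  qed
  then show ?thesis using hausdorff_dim_mono[OF assms] by (simp add: one_ereal_def)
qed

lemma hausdorff_premeasure_antimono_size:
  "\<delta> \<le> \<delta>' \<Longrightarrow> hausdorff_premeasure s \<delta>' A \<le> hausdorff_premeasure s \<delta> A"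
  unfolding hausdorff_premeasure_def by (rule INF_superset_mono) (auto intro: order_trans)

text \<open>Powers of a number at most 1 decrease with the exponent; hence the restriction to scales
  at most 1.\<close>

lemma hausdorff_premeasure_antimono_exponent:
  assumes "s \<le> s'" "\<delta> \<le> 1"
  shows "hausdorff_premeasure s' \<delta> A \<le> hausdorff_premeasure s \<delta> A"
  unfolding hausdorff_premeasure_def
proof (intro INF_mono)
  fix U :: "nat \<Rightarrow> 'a set"
  assume U: "U \<in> {U. A \<subseteq> (\<Union>i. U i) \<and> (\<forall>i. bounded (U i) \<and> diameter (U i) \<le> \<delta>)}"
  have "diameter (U i) powr s' \<le> diameter (U i) powr s" for i
    using U assms by (intro powr_mono') (auto simp: diameter_ge_0 intro: order_trans)
  then have "(\<Sum>i. ennreal (diameter (U i) powr s')) \<le> (\<Sum>i. ennreal (diameter (U i) powr s))"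
    by (intro suminf_le ennreal_leI) auto
  then show "\<exists>V\<in>{U. A \<subseteq> (\<Union>i. U i) \<and> (\<forall>i. bounded (U i) \<and> diameter (U i) \<le> \<delta>)}.
      (\<Sum>i. ennreal (diameter (V i) powr s')) \<le> (\<Sum>i. ennreal (diameter (U i) powr s))"
    using U by blast
qed

lemma hausdorff_outer_measure_zero_mono:
  assumes "hausdorff_outer_measure s A = 0" "s \<le> s'"
  shows "hausdorff_outer_measure s' A = 0"
proof -
  have "hausdorff_premeasure s' \<delta> A = 0" if "0 < \<delta>" for \<delta>
  proof -
    \<comment> \<open>Premeasures grow as the scale shrinks, so the scale may first be lowered to at
      most 1, where exponents can be compared.\<close>
    have "hausdorff_premeasure s' \<delta> A \<le> hausdorff_premeasure s' (min \<delta> 1) A"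
      by (rule hausdorff_premeasure_antimono_size) simp
    also have "\<dots> \<le> hausdorff_premeasure s (min \<delta> 1) A"
      by (rule hausdorff_premeasure_antimono_exponent[OF assms(2)]) simp
    also have "\<dots> \<le> hausdorff_outer_measure s A"
      unfolding hausdorff_outer_measure_def using that by (intro SUP_upper) auto
    finally show ?thesis using assms(1) by simp
  qed
  then show ?thesis unfolding hausdorff_outer_measure_def by simp
qed

lemma hausdorff_dim_ge_of_nonzero:
  "hausdorff_outer_measure s A \<noteq> 0 \<Longrightarrow> ereal s \<le> hausdorff_dim A"
  by (rule hausdorff_dim_geI) (metis hausdorff_outer_measure_zero_mono less_imp_le)

section \<open>White-noise integrals\<close>

lemma centered_gaussian_measurable: "centered_gaussian M Y v \<Longrightarrow> Y \<in> borel_measurable M"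
  by (simp add: centered_gaussian_def)

lemma centered_gaussian_variance_nonneg: "centered_gaussian M Y v \<Longrightarrow> 0 \<le> v"
  by (auto simp: centered_gaussian_def split: if_splits)

lemma (in prob_space) centered_gaussian_AE_cong:
  assumes "centered_gaussian M Y v" "AE \<omega> in M. Y \<omega> = Z \<omega>" "Z \<in> borel_measurable M"
  shows "centered_gaussian M Z v"
proof (cases "v = 0")
  case True
  then have "AE \<omega> in M. Y \<omega> = 0" using assms(1) by (simp add: centered_gaussian_def)
  with assms(2) have "AE \<omega> in M. Z \<omega> = 0" by eventually_elim simp
  then show ?thesis using True assms by (simp add: centered_gaussian_def)
next
  case False
  have "distr M lborel Y = distr M lborel Z"
    using assms by (intro distr_cong_AE) (auto simp: centered_gaussian_def)
  then show ?thesis using False assms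
    by (auto simp: centered_gaussian_def distributed_def)
qed

lemma (in prob_space) centered_gaussian_scale:
  assumes "centered_gaussian M Y v"
  shows "centered_gaussian M (\<lambda>\<omega>. c * Y \<omega>) (c\<^sup>2 * v)"
proof (cases "v = 0 \<or> c = 0")
  case True
  then show ?thesis using assms by (auto simp: centered_gaussian_def)
next
  case False
  then have "distributed M lborel (\<lambda>x. 0 + c * Y x) (normal_density (0 + c * 0) (\<bar>c\<bar> * sqrt v))"
    using assms by (intro normal_density_affine) (auto simp: centered_gaussian_def)
  moreover have "\<bar>c\<bar> * sqrt v = sqrt (c\<^sup>2 * v)" by (simp add: real_sqrt_mult)
  ultimately show ?thesis using False assms by (auto simp: centered_gaussian_def)
qed

text \<open>The sum rule for independent normal variables asks for positive variances. Degenerate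
  summands vanish almost surely, so they are discarded first and the result is transferred along
  almost sure equality.\<close>

lemma (in prob_space) centered_gaussian_sum:
  assumes "finite I" and indep: "indep_vars (\<lambda>_. borel) Y I"
    and Y: "\<And>i. i \<in> I \<Longrightarrow> centered_gaussian M (Y i) (v i)"
  shows "centered_gaussian M (\<lambda>\<omega>. \<Sum>i\<in>I. Y i \<omega>) (\<Sum>i\<in>I. v i)"
proof -
  define P where "P = {i \<in> I. v i \<noteq> 0}"
  have P: "P \<subseteq> I" "finite P" using assms(1) by (auto simp: P_def)
  have vpos: "0 < v i" if "i \<in> P" for i
    using Y[of i] that by (auto simp: P_def centered_gaussian_def)
  have vP: "(\<Sum>i\<in>I. v i) = (\<Sum>i\<in>P. v i)"
    using assms(1) by (intro sum.mono_neutral_right) (auto simp: P_def)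
  have m: "Y i \<in> borel_measurable M" if "i \<in> I" for i
    using Y[OF that] by (rule centered_gaussian_measurable)
  have "AE \<omega> in M. \<forall>i\<in>I - P. Y i \<omega> = 0"
    using assms(1) Y by (intro AE_finite_allI) (auto simp: P_def centered_gaussian_def)
  then have AE: "AE \<omega> in M. (\<Sum>i\<in>P. Y i \<omega>) = (\<Sum>i\<in>I. Y i \<omega>)"
    by eventually_elim (use P assms(1) in \<open>auto intro!: sum.mono_neutral_left\<close>)
  have "centered_gaussian M (\<lambda>\<omega>. \<Sum>i\<in>P. Y i \<omega>) (\<Sum>i\<in>P. v i)"
  proof (cases "P = {}")
    case True
    then show ?thesis by (simp add: centered_gaussian_def)
  next
    case False
    have "distributed M lborel (\<lambda>x. \<Sum>i\<in>P. Y i x) (normal_density (\<Sum>i\<in>P. 0) (sqrt (\<Sum>i\<in>P. (sqrt (v i))\<^sup>2)))"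
    proof (rule sum_indep_normal[OF P(2) False])
      show "indep_vars (\<lambda>i. borel) Y P" by (rule indep_vars_subset[OF indep P(1)])
    qed (use vpos Y P in \<open>auto simp: centered_gaussian_def P_def\<close>)
    moreover have "(\<Sum>i\<in>P. (sqrt (v i))\<^sup>2) = (\<Sum>i\<in>P. v i)"
      using vpos by (intro sum.cong) (auto simp: less_imp_le)
    moreover have "0 < (\<Sum>i\<in>P. v i)" using vpos False P by (intro sum_pos) auto
    ultimately show ?thesis using m P by (auto simp: centered_gaussian_def intro!: borel_measurable_sum)
  qed
  then have "centered_gaussian M (\<lambda>\<omega>. \<Sum>i\<in>I. Y i \<omega>) (\<Sum>i\<in>P. v i)"
    by (rule centered_gaussian_AE_cong[OF _ AE]) (use m in auto)
  then show ?thesis by (simp add: vP)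
qed

section \<open>White noise on finitely many sets, and simple integrands\<close>

lemma white_noise_gaussian:
  "white_noise M W \<Longrightarrow> A \<in> sets borel \<Longrightarrow> emeasure lborel A < \<infinity> \<Longrightarrow>
    centered_gaussian M (W A) (measure lborel A)"
  by (simp add: white_noise_def)

lemma white_noise_indep_finite:
  fixes A :: "nat \<Rightarrow> real set"
  assumes W: "white_noise M W" and disj: "disjoint_family_on A {..<N}"
    and A: "\<And>i. i < N \<Longrightarrow> A i \<in> sets borel \<and> emeasure lborel (A i) < \<infinity>"
  shows "prob_space.indep_vars M (\<lambda>_. borel) (\<lambda>i. W (A i)) {..<N}"
proof -
  interpret prob_space M using W by (simp add: white_noise_def)
  define B where "B n = (if n < N then A n else {})" for n
  have "disjoint_family B"
    using disj by (auto simp: disjoint_family_on_def B_def)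
  moreover have "B n \<in> sets lborel \<and> emeasure lborel (B n) < \<infinity>" for n
    using A[of n] by (simp add: B_def)
  ultimately have "indep_vars (\<lambda>_. borel) (\<lambda>n. W (B n)) UNIV"
    using W by (simp add: white_noise_def)
  then have "indep_vars (\<lambda>_. borel) (\<lambda>n. W (B n)) {..<N}"
    by (rule indep_vars_subset) simp
  then show ?thesis
    by (subst indep_vars_cong[OF refl]) (auto simp: B_def)
qed

text \<open>Countable additivity is applied to the finite family continued by empty sets, which
  turns the series into a finite sum.\<close>

lemma white_noise_finite_additive:
  assumes W: "white_noise M W" and I: "finite I" and disj: "disjoint_family_on A I"
    and A: "\<And>i. i \<in> I \<Longrightarrow> A i \<in> sets borel \<and> emeasure lborel (A i) < \<infinity>"
  shows "AE \<omega> in M. W (\<Union>i\<in>I. A i) \<omega> = (\<Sum>i\<in>I. W (A i) \<omega>)"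
proof -
  interpret prob_space M using W by (simp add: white_noise_def)
  obtain e where e: "bij_betw e {..<card I} I"
    using ex_bij_betw_nat_finite[OF I] by (auto simp: atLeast0LessThan)
  define B where "B n = (if n < card I then A (e n) else {})" for n
  have eI: "e n \<in> I" if "n < card I" for n using e that by (auto simp: bij_betw_def)
  have "disjoint_family B"
    unfolding disjoint_family_on_def
  proof (intro ballI impI)
    fix m n :: nat assume "m \<noteq> n"
    show "B m \<inter> B n = {}"
    proof (cases "m < card I \<and> n < card I")
      case True
      then have "e m \<noteq> e n" using \<open>m \<noteq> n\<close> e by (auto simp: bij_betw_def inj_on_def)
      then show ?thesis
        using True eI disj by (simp add: B_def disjoint_family_on_def)
    qed (auto simp: B_def)
  qed
  moreover have "B n \<in> sets lborel" for n using A[OF eI] by (simp add: B_def)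
  moreover have "(\<Union>n. B n) = (\<Union>i\<in>e ` {..<card I}. A i)" by (auto simp: B_def split: if_splits)
  then have BU: "(\<Union>n. B n) = (\<Union>i\<in>I. A i)" using e by (metis bij_betw_imp_surj_on)
  moreover have "emeasure lborel (\<Union>i\<in>I. A i) < \<infinity>"
  proof -
    have "emeasure lborel (\<Union>i\<in>I. A i) \<le> (\<Sum>i\<in>I. emeasure lborel (A i))"
      using A I by (intro emeasure_subadditive_finite) auto
    also have "\<dots> < \<infinity>" using A I by (simp add: less_top[symmetric])
    finally show ?thesis .
  qed
  ultimately have sums: "AE \<omega> in M. (\<lambda>n. W (B n) \<omega>) sums W (\<Union>i\<in>I. A i) \<omega>"
    using W[unfolded white_noise_def, THEN conjunct2, THEN conjunct2, THEN conjunct2, rule_format, of B]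
    by simp
  \<comment> \<open>The empty sets that were added contribute nothing almost surely, because
    \<open>W {}\<close> is a centered Gaussian of variance 0.\<close>
  have "centered_gaussian M (W {}) 0" using white_noise_gaussian[OF W, of "{}"] by simp
  then have "AE \<omega> in M. W {} \<omega> = 0" by (simp add: centered_gaussian_def)
  with sums show ?thesis
  proof eventually_elim
    case (elim \<omega>)
    have "(\<lambda>n. W (B n) \<omega>) sums (\<Sum>n<card I. W (B n) \<omega>)"
      using elim by (intro sums_finite) (auto simp: B_def)
    then have "W (\<Union>i\<in>I. A i) \<omega> = (\<Sum>n<card I. W (B n) \<omega>)" using elim(1) sums_unique2 by blast
    also have "\<dots> = (\<Sum>n<card I. W (A (e n)) \<omega>)" by (simp add: B_def)
    also have "\<dots> = (\<Sum>i\<in>I. W (A i) \<omega>)"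
      using e by (rule sum.reindex_bij_betw)
    finally show ?case .
  qed
qed

text \<open>The isometry on step functions: the variance is the squared L2 norm of the step function
  with value \<open>c i\<close> on \<open>A i\<close>. Disjointness gives independence, so variances
  add.\<close>

lemma white_noise_combination_gaussian:
  assumes W: "white_noise M W" and I: "finite I" and disj: "disjoint_family_on A I"
    and A: "\<And>i. i \<in> I \<Longrightarrow> A i \<in> sets borel \<and> emeasure lborel (A i) < \<infinity>"
  shows "centered_gaussian M (\<lambda>\<omega>. \<Sum>i\<in>I. c i * W (A i) \<omega>) (\<Sum>i\<in>I. (c i)\<^sup>2 * measure lborel (A i))"
proof -
  interpret prob_space M using W by (simp add: white_noise_def)
  obtain e where e: "bij_betw e {..<card I} I"
    using ex_bij_betw_nat_finite[OF I] by (auto simp: atLeast0LessThan)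
  have eI: "e n \<in> I" if "n < card I" for n using e that by (auto simp: bij_betw_def)
  have disj': "disjoint_family_on (\<lambda>n. A (e n)) {..<card I}"
    unfolding disjoint_family_on_def
  proof (intro ballI impI)
    fix m n assume mn: "m \<in> {..<card I}" "n \<in> {..<card I}" "m \<noteq> n"
    then have "e m \<noteq> e n" using e by (auto simp: bij_betw_def inj_on_def)
    then show "A (e m) \<inter> A (e n) = {}" using mn eI disj by (auto simp: disjoint_family_on_def)
  qed
  have "centered_gaussian M (\<lambda>\<omega>. \<Sum>n<card I. c (e n) * W (A (e n)) \<omega>)
      (\<Sum>n<card I. (c (e n))\<^sup>2 * measure lborel (A (e n)))"
  proof (rule centered_gaussian_sum)
    show "indep_vars (\<lambda>_. borel) (\<lambda>n \<omega>. c (e n) * W (A (e n)) \<omega>) {..<card I}"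
      by (rule indep_vars_compose2[OF white_noise_indep_finite[OF W disj']]) (use A eI in auto)
    show "centered_gaussian M (\<lambda>\<omega>. c (e n) * W (A (e n)) \<omega>) ((c (e n))\<^sup>2 * measure lborel (A (e n)))"
      if "n \<in> {..<card I}" for n
      using A[OF eI, of n] that by (intro centered_gaussian_scale white_noise_gaussian[OF W]) auto
  qed simp
  moreover have "(\<Sum>n<card I. c (e n) * W (A (e n)) \<omega>) = (\<Sum>i\<in>I. c i * W (A i) \<omega>)" for \<omega>
    by (rule sum.reindex_bij_betw[OF e])
  moreover have "(\<Sum>n<card I. (c (e n))\<^sup>2 * measure lborel (A (e n))) = (\<Sum>i\<in>I. (c i)\<^sup>2 * measure lborel (A i))"
    by (rule sum.reindex_bij_betw[OF e])
  ultimately show ?thesis by simp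
qed

text \<open>The level sets of both integrands are refined to a common partition.\<close>

lemma simple_white_noise_integral_diff_gaussian:
  assumes W: "white_noise M W"
    and s: "simple_function lborel s" "emeasure lborel {x. s x \<noteq> 0} < \<infinity>"
    and s': "simple_function lborel s'" "emeasure lborel {x. s' x \<noteq> 0} < \<infinity>"
  shows "integrable lborel (\<lambda>x. (s x - s' x)\<^sup>2)"
    and "\<exists>Z. centered_gaussian M Z (\<integral>x. (s x - s' x)\<^sup>2 \<partial>lborel) \<and>
    (AE \<omega> in M. simple_white_noise_integral W s \<omega> - simple_white_noise_integral W s' \<omega> = Z \<omega>)"
proof -
  interpret prob_space M using W by (simp add: white_noise_def)
  \<comment> \<open>The pair \<open>(0, 0)\<close> is left out: its cell has infinite measure, where
    \<open>W\<close> is unconstrained, and both integrands vanish on it.\<close>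
  define I where "I = range s \<times> range s' - {(0, 0)}"
  define A where "A = (\<lambda>(y, y'). {x. s x = y \<and> s' x = y'})"
  have fin: "finite (range s)" "finite (range s')" using s(1) s'(1) by (auto simp: simple_function_def)
  then have I: "finite I" by (simp add: I_def)
  have [measurable]: "s \<in> borel_measurable borel" "s' \<in> borel_measurable borel"
    using borel_measurable_simple_function[OF s(1)] borel_measurable_simple_function[OF s'(1)] by auto
  have "{x. s x = y \<and> s' x = y'} \<in> sets borel" for y y' by measurable
  then have Am: "A p \<in> sets borel" for p by (cases p) (simp add: A_def)
  have disj: "disjoint_family_on A J" for J by (auto simp: disjoint_family_on_def A_def)
  have Afin: "emeasure lborel (A (y, y')) < \<infinity>" if "y \<noteq> 0 \<or> y' \<noteq> 0" for y y'
    using that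
  proof
    assume "y \<noteq> 0"
    then have "emeasure lborel (A (y, y')) \<le> emeasure lborel {x. s x \<noteq> 0}"
      by (intro emeasure_mono) (auto simp: A_def)
    then show ?thesis using s(2) by simp
  next
    assume "y' \<noteq> 0"
    then have "emeasure lborel (A (y, y')) \<le> emeasure lborel {x. s' x \<noteq> 0}"
      by (intro emeasure_mono) (auto simp: A_def)
    then show ?thesis using s'(2) by simp
  qed
  then have A: "A p \<in> sets borel \<and> emeasure lborel (A p) < \<infinity>" if "p \<in> I" for p
    using that Am by (cases p) (auto simp: I_def)
  define Z where "Z \<omega> = (\<Sum>p\<in>I. (fst p - snd p) * W (A p) \<omega>)" for \<omega>
  define v where "v = (\<Sum>p\<in>I. (fst p - snd p)\<^sup>2 * measure lborel (A p))"
  have sq: "(s x - s' x)\<^sup>2 = (\<Sum>p\<in>I. (fst p - snd p)\<^sup>2 * indicator (A p) x)" for x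
  proof (cases "s x = 0 \<and> s' x = 0")
    case True
    then have "(\<Sum>p\<in>I. (fst p - snd p)\<^sup>2 * indicator (A p) x) = 0"
      by (intro sum.neutral) (auto simp: A_def I_def split: split_indicator)
    then show ?thesis using True by simp
  next
    case False
    then have "(s x, s' x) \<in> I" by (auto simp: I_def)
    then have "(\<Sum>p\<in>I. (fst p - snd p)\<^sup>2 * indicator (A p) x) =
        (\<Sum>p\<in>{(s x, s' x)}. (fst p - snd p)\<^sup>2 * indicator (A p) x)"
      using I by (intro sum.mono_neutral_right) (auto simp: A_def split: split_indicator)
    then show ?thesis by (simp add: A_def)
  qed
  show int: "integrable lborel (\<lambda>x. (s x - s' x)\<^sup>2)"
    unfolding sq using A by (intro Bochner_Integration.integrable_sum) auto
  have "centered_gaussian M Z v"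
    unfolding Z_def v_def by (rule white_noise_combination_gaussian[OF W I disj A])
  moreover have "(\<integral>x. (s x - s' x)\<^sup>2 \<partial>lborel) = v"
  proof -
    have "(\<integral>x. (s x - s' x)\<^sup>2 \<partial>lborel) =
        (\<integral>x. (\<Sum>p\<in>I. (fst p - snd p)\<^sup>2 * indicator (A p) x) \<partial>lborel)" by (simp add: sq)
    also have "\<dots> = (\<Sum>p\<in>I. \<integral>x. (fst p - snd p)\<^sup>2 * indicator (A p) x \<partial>lborel)"
      using A by (intro Bochner_Integration.integral_sum) auto
    also have "\<dots> = v" unfolding v_def
      using A by (intro sum.cong) auto
    finally show ?thesis .
  qed
  moreover have "AE \<omega> in M. simple_white_noise_integral W s \<omega> - simple_white_noise_integral W s' \<omega> = Z \<omega>"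
  proof -
    \<comment> \<open>Each level set of one function is cut along those of the other. Additivity
      holds only almost surely, but finitely many level sets are involved. The level 0 is excluded
      because of its infinite measure; its coefficient in the integral is 0.\<close>
    have 1: "AE \<omega> in M. \<forall>y\<in>range s - {0}. W {x. s x = y} \<omega> = (\<Sum>y'\<in>range s'. W (A (y, y')) \<omega>)"
    proof (intro AE_finite_allI)
      fix y assume y: "y \<in> range s - {0}"
      have U: "(\<Union>y'\<in>range s'. A (y, y')) = {x. s x = y}" by (auto simp: A_def)
      show "AE \<omega> in M. W {x. s x = y} \<omega> = (\<Sum>y'\<in>range s'. W (A (y, y')) \<omega>)"
        unfolding U[symmetric]
        by (rule white_noise_finite_additive[OF W fin(2)])
          (use y Am Afin in \<open>auto simp: disjoint_family_on_def A_def\<close>)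
    qed (use fin in simp)
    have 2: "AE \<omega> in M. \<forall>y'\<in>range s' - {0}. W {x. s' x = y'} \<omega> = (\<Sum>y\<in>range s. W (A (y, y')) \<omega>)"
    proof (intro AE_finite_allI)
      fix y' assume y: "y' \<in> range s' - {0}"
      have U: "(\<Union>y\<in>range s. A (y, y')) = {x. s' x = y'}" by (auto simp: A_def)
      show "AE \<omega> in M. W {x. s' x = y'} \<omega> = (\<Sum>y\<in>range s. W (A (y, y')) \<omega>)"
        unfolding U[symmetric]
        by (rule white_noise_finite_additive[OF W fin(1)])
          (use y Am Afin in \<open>auto simp: disjoint_family_on_def A_def\<close>)
    qed (use fin in simp)
    from 1 2 show ?thesis
    proof eventually_elim
      case (elim \<omega>)
      have "simple_white_noise_integral W s \<omega> = (\<Sum>y\<in>range s. \<Sum>y'\<in>range s'. y * W (A (y, y')) \<omega>)"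
        unfolding simple_white_noise_integral_def
        by (intro sum.cong refl) (use elim in \<open>auto simp: sum_distrib_left[symmetric]\<close>)
      then have e1: "simple_white_noise_integral W s \<omega> = (\<Sum>p\<in>range s \<times> range s'. fst p * W (A p) \<omega>)"
        by (simp add: sum.cartesian_product case_prod_beta)
      have "simple_white_noise_integral W s' \<omega> = (\<Sum>y'\<in>range s'. \<Sum>y\<in>range s. y' * W (A (y, y')) \<omega>)"
        unfolding simple_white_noise_integral_def
        by (intro sum.cong refl) (use elim in \<open>auto simp: sum_distrib_left[symmetric]\<close>)
      also have "\<dots> = (\<Sum>y\<in>range s. \<Sum>y'\<in>range s'. y' * W (A (y, y')) \<omega>)" by (rule sum.swap)
      finally have e2: "simple_white_noise_integral W s' \<omega> = (\<Sum>p\<in>range s \<times> range s'. snd p * W (A p) \<omega>)"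
        by (simp add: sum.cartesian_product case_prod_beta)
      have "simple_white_noise_integral W s \<omega> - simple_white_noise_integral W s' \<omega> =
          (\<Sum>p\<in>range s \<times> range s'. (fst p - snd p) * W (A p) \<omega>)"
        unfolding e1 e2 by (simp add: sum_subtractf[symmetric] left_diff_distrib)
      also have "\<dots> = Z \<omega>"
        unfolding Z_def I_def using fin by (intro sum.mono_neutral_right) auto
      finally show ?case .
    qed
  qed
  ultimately show "\<exists>Z. centered_gaussian M Z (\<integral>x. (s x - s' x)\<^sup>2 \<partial>lborel) \<and>
    (AE \<omega> in M. simple_white_noise_integral W s \<omega> - simple_white_noise_integral W s' \<omega> = Z \<omega>)"
    by auto
qed

section \<open>Moments of Gaussian variables\<close>

lemma nn_integral_abs_powr_neg:
  fixes L c :: real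
  assumes "0 < L" "0 \<le> c" "c < 1"
  shows "(\<integral>\<^sup>+y. inverse (ennreal (\<bar>y\<bar> powr c)) * indicator {-L..L} y \<partial>lborel) \<le> ennreal (2 * (L powr (1 - c) / (1 - c)))"
proof -
  define g where "g y = ennreal (y powr (- c)) * indicator {0..L} y" for y
  have [measurable]: "g \<in> borel_measurable borel" unfolding g_def by measurable
  have "((\<lambda>y. y powr (- c)) has_integral (L powr (- c + 1) / (- c + 1))) {0..L}"
    using assms by (intro has_integral_powr_from_0) auto
  from nn_integral_has_integral_lebesgue'[OF _ this]
  have g: "integral\<^sup>N lborel g = ennreal (L powr (1 - c) / (1 - c))" unfolding g_def by simp
  have "(\<integral>\<^sup>+y. inverse (ennreal (\<bar>y\<bar> powr c)) * indicator {-L..L} y \<partial>lborel) \<le> (\<integral>\<^sup>+y. g y + g (- y) \<partial>lborel)"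
  \<comment> \<open>Only almost everywhere: at 0 the left integrand is infinite, whereas the right
    one vanishes because a power of 0 is 0.\<close>
  proof (rule nn_integral_mono_AE)
    have "AE y in lborel. y \<noteq> (0::real)" by (rule AE_lborel_singleton)
    then show "AE y in lborel. inverse (ennreal (\<bar>y\<bar> powr c)) * indicator {-L..L} y \<le> g y + g (- y)"
      by eventually_elim
        (auto simp: g_def powr_minus inverse_ennreal abs_if split: split_indicator)
  qed
  also have "\<dots> = (\<integral>\<^sup>+y. g y \<partial>lborel) + (\<integral>\<^sup>+y. g (- y) \<partial>lborel)"
    by (intro nn_integral_add) auto
  also have "(\<integral>\<^sup>+y. g (- y) \<partial>lborel) = (\<integral>\<^sup>+y. g y \<partial>lborel)"
    using nn_integral_real_affine[of g "-1" 0] by simp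
  also have "(\<integral>\<^sup>+y. g y \<partial>lborel) + (\<integral>\<^sup>+y. g y \<partial>lborel) = ennreal (2 * (L powr (1 - c) / (1 - c)))"
    using assms by (simp add: g ennreal_plus[symmetric] del: ennreal_plus)
  finally show ?thesis .
qed

lemma centered_gaussian_nn_integral:
  assumes "centered_gaussian M Z v" "0 < v" and [measurable]: "G \<in> borel_measurable borel"
  shows "(\<integral>\<^sup>+\<omega>. G (Z \<omega>) \<partial>M) = (\<integral>\<^sup>+x. ennreal (normal_density 0 (sqrt v) x) * G x \<partial>lborel)"
  using assms by (intro distributed_nn_integral[symmetric]) (auto simp: centered_gaussian_def)

lemma (in prob_space) centered_gaussian_even_moment:
  assumes "centered_gaussian M Z v" "0 < k"
  shows "(\<integral>\<^sup>+\<omega>. ennreal (Z \<omega> ^ (2 * k)) \<partial>M) = ennreal (fact (2 * k) / (2 ^ k * fact k) * v ^ k)"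
proof (cases "v = 0")
  case True
  then have "AE \<omega> in M. Z \<omega> = 0" using assms by (simp add: centered_gaussian_def)
  then have "(\<integral>\<^sup>+\<omega>. ennreal (Z \<omega> ^ (2 * k)) \<partial>M) = (\<integral>\<^sup>+\<omega>. 0 \<partial>M)"
    using assms by (intro nn_integral_cong_AE) (auto elim: eventually_mono)
  then show ?thesis using True assms by simp
next
  case False
  then have v: "0 < v" using assms centered_gaussian_variance_nonneg by force
  have "(\<integral>\<^sup>+\<omega>. ennreal (Z \<omega> ^ (2 * k)) \<partial>M) =
      (\<integral>\<^sup>+x. ennreal (normal_density 0 (sqrt v) x) * ennreal (x ^ (2 * k)) \<partial>lborel)"
    by (rule centered_gaussian_nn_integral[OF assms(1) v]) simp
  also have "\<dots> = (\<integral>\<^sup>+x. ennreal (normal_density 0 (sqrt v) x * (x - 0) ^ (2 * k)) \<partial>lborel)"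
    by (simp add: ennreal_mult)
  also have "\<dots> = ennreal (\<integral>x. normal_density 0 (sqrt v) x * (x - 0) ^ (2 * k) \<partial>lborel)"
    using integrable_normal_moment[of "sqrt v" 0 "2 * k"] v
    by (intro nn_integral_eq_integral) (auto simp: zero_le_even_power)
  also have "(\<integral>x. normal_density 0 (sqrt v) x * (x - 0) ^ (2 * k) \<partial>lborel) = fact (2 * k) / (2 ^ k * fact k) * v ^ k"
    using v by (subst integral_normal_moment_even) (auto simp: power_divide)
  finally show ?thesis .
qed

text \<open>The integral is split at the standard deviation \<open>\<sigma>\<close>. Inside, the
  density is at most \<open>1 / \<sigma>\<close> and the inverse power is integrable because
  \<open>b < 1\<close>; outside, the inverse power is at most \<open>\<sigma> powr (- b)\<close> and
  the density has total mass 1. Both parts scale like \<open>\<sigma> powr (- b)\<close>.\<close>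

lemma centered_gaussian_negative_moment:
  assumes Z: "centered_gaussian M Z v" and v: "0 < v" and b: "0 \<le> b" "b < 1"
  shows "(\<integral>\<^sup>+\<omega>. inverse (ennreal (\<bar>Z \<omega>\<bar> powr b)) \<partial>M) \<le> ennreal ((1 + 2 / (1 - b)) * v powr (- b / 2))"
proof -
  define \<sigma> where "\<sigma> = sqrt v"
  have \<sigma>: "0 < \<sigma>" using v by (simp add: \<sigma>_def)
  have \<sigma>b: "\<sigma> powr (- b) = v powr (- b / 2)"
    using v by (simp add: \<sigma>_def powr_half_sqrt[symmetric] powr_powr)
  have "(\<integral>\<^sup>+\<omega>. inverse (ennreal (\<bar>Z \<omega>\<bar> powr b)) \<partial>M) =
      (\<integral>\<^sup>+x. ennreal (normal_density 0 \<sigma> x) * inverse (ennreal (\<bar>x\<bar> powr b)) \<partial>lborel)"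
    unfolding \<sigma>_def by (rule centered_gaussian_nn_integral[OF Z v]) simp
  also have "\<dots> \<le> (\<integral>\<^sup>+x. ennreal (\<sigma> powr (- b)) * ennreal (normal_density 0 \<sigma> x) +
      ennreal (1 / \<sigma>) * (inverse (ennreal (\<bar>x\<bar> powr b)) * indicator {-\<sigma>..\<sigma>} x) \<partial>lborel)"
  proof (rule nn_integral_mono)
    fix x :: real
    show "ennreal (normal_density 0 \<sigma> x) * inverse (ennreal (\<bar>x\<bar> powr b)) \<le>
      ennreal (\<sigma> powr (- b)) * ennreal (normal_density 0 \<sigma> x) +
      ennreal (1 / \<sigma>) * (inverse (ennreal (\<bar>x\<bar> powr b)) * indicator {-\<sigma>..\<sigma>} x)"
    proof (cases "\<bar>x\<bar> \<le> \<sigma>")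
      case True
      have "normal_density 0 \<sigma> x \<le> 1 / \<sigma>"
      proof -
        have "exp (- (x - 0)\<^sup>2 / (2 * \<sigma>\<^sup>2)) \<le> 1" by (auto intro!: divide_nonpos_nonneg)
        moreover have "1 / sqrt (2 * pi * \<sigma>\<^sup>2) \<le> 1 / \<sigma>"
        proof -
          have "1 \<le> 2 * pi" using pi_gt3 by simp
          then have "\<sigma>\<^sup>2 \<le> 2 * pi * \<sigma>\<^sup>2" by (simp add: mult_le_cancel_right1)
          then have "\<sigma> \<le> sqrt (2 * pi * \<sigma>\<^sup>2)" using real_le_rsqrt by blast
          then show ?thesis using \<sigma> by (intro divide_left_mono) auto
        qed
        ultimately have "1 / sqrt (2 * pi * \<sigma>\<^sup>2) * exp (- (x - 0)\<^sup>2 / (2 * \<sigma>\<^sup>2)) \<le> 1 / \<sigma> * 1"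
          using \<sigma> by (intro mult_mono) auto
        then show ?thesis by (simp add: normal_density_def)
      qed
      then have "ennreal (normal_density 0 \<sigma> x) * inverse (ennreal (\<bar>x\<bar> powr b)) \<le>
          ennreal (1 / \<sigma>) * inverse (ennreal (\<bar>x\<bar> powr b))"
        by (intro mult_right_mono ennreal_leI) auto
      then show ?thesis using True by (auto simp: abs_le_iff intro: add_increasing)
    next
      case False
      then have "\<bar>x\<bar> powr (- b) \<le> \<sigma> powr (- b)"
        using \<sigma> b by (intro powr_mono2') auto
      moreover have "inverse (ennreal (\<bar>x\<bar> powr b)) = ennreal (\<bar>x\<bar> powr (- b))"
        using False \<sigma> by (subst inverse_ennreal) (auto simp: powr_minus)
      ultimately have "ennreal (normal_density 0 \<sigma> x) * inverse (ennreal (\<bar>x\<bar> powr b)) \<le>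
          ennreal (normal_density 0 \<sigma> x) * ennreal (\<sigma> powr (- b))"
        by (auto intro!: mult_left_mono ennreal_leI)
      then show ?thesis by (simp add: mult.commute add_increasing2)
    qed
  qed
  also have "\<dots> = ennreal (\<sigma> powr (- b)) * (\<integral>\<^sup>+x. ennreal (normal_density 0 \<sigma> x) \<partial>lborel) +
      ennreal (1 / \<sigma>) * (\<integral>\<^sup>+x. inverse (ennreal (\<bar>x\<bar> powr b)) * indicator {-\<sigma>..\<sigma>} x \<partial>lborel)"
    by (subst nn_integral_add) (auto simp: nn_integral_cmult)
  also have "\<dots> \<le> ennreal (\<sigma> powr (- b)) * 1 + ennreal (1 / \<sigma>) * ennreal (2 * (\<sigma> powr (1 - b) / (1 - b)))"
  proof (intro add_mono mult_left_mono nn_integral_abs_powr_neg[OF \<sigma> b])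
    show "(\<integral>\<^sup>+x. ennreal (normal_density 0 \<sigma> x) \<partial>lborel) \<le> 1"
      using \<sigma> by (subst nn_integral_eq_integral) auto
  qed auto
  also have "\<dots> = ennreal (\<sigma> powr (- b) + 1 / \<sigma> * (2 * (\<sigma> powr (1 - b) / (1 - b))))"
    using \<sigma> b by (simp add: ennreal_mult[symmetric] ennreal_plus[symmetric] del: ennreal_plus)
  also have "\<sigma> powr (- b) + 1 / \<sigma> * (2 * (\<sigma> powr (1 - b) / (1 - b))) = (1 + 2 / (1 - b)) * \<sigma> powr (- b)"
    using \<sigma> b by (simp add: powr_diff powr_minus field_simps)
  finally show ?thesis unfolding \<sigma>b .
qed

section \<open>Mean-square limits of squared norms\<close>

text \<open>Follows from \<open>2 * x * y \<le> e * x ^ 2 + y ^ 2 / e\<close>. The free weight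
  \<open>e\<close> brings the coefficient of the main term as close to 1 as desired, which replaces
  the triangle inequality when squared norms are handled as extended integrals.\<close>

lemma norm_sq_add_le:
  fixes x y :: "'a::real_normed_vector"
  assumes "0 < e"
  shows "(norm (x + y))\<^sup>2 \<le> (1 + e) * (norm x)\<^sup>2 + (1 + 1 / e) * (norm y)\<^sup>2"
proof -
  have "0 \<le> (sqrt e * norm x - norm y / sqrt e)\<^sup>2" by simp
  also have "\<dots> = e * (norm x)\<^sup>2 - 2 * norm x * norm y + (norm y)\<^sup>2 / e"
    using assms by (simp add: power2_diff power_mult_distrib power_divide field_simps)
  finally have "2 * norm x * norm y \<le> e * (norm x)\<^sup>2 + (norm y)\<^sup>2 / e" by simp
  moreover have "(norm (x + y))\<^sup>2 \<le> (norm x + norm y)\<^sup>2" by (intro power_mono norm_triangle_ineq) auto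
  ultimately show ?thesis by (simp add: power2_sum algebra_simps)
qed

lemma nn_integral_norm_sq_add_le:
  fixes f g :: "'a \<Rightarrow> 'b::{real_normed_vector, second_countable_topology}"
  assumes [measurable]: "f \<in> borel_measurable M" "g \<in> borel_measurable M" and e: "0 < e"
  shows "(\<integral>\<^sup>+x. ennreal ((norm (f x + g x))\<^sup>2) \<partial>M) \<le>
     ennreal (1 + e) * (\<integral>\<^sup>+x. ennreal ((norm (f x))\<^sup>2) \<partial>M) + ennreal (1 + 1 / e) * (\<integral>\<^sup>+x. ennreal ((norm (g x))\<^sup>2) \<partial>M)"
proof -
  have "(\<integral>\<^sup>+x. ennreal ((norm (f x + g x))\<^sup>2) \<partial>M) \<le>
     (\<integral>\<^sup>+x. ennreal (1 + e) * ennreal ((norm (f x))\<^sup>2) + ennreal (1 + 1 / e) * ennreal ((norm (g x))\<^sup>2) \<partial>M)"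
    using e norm_sq_add_le[OF e]
    by (intro nn_integral_mono)
      (auto simp: ennreal_mult[symmetric] ennreal_plus[symmetric] simp del: ennreal_plus intro!: ennreal_leI)
  also have "\<dots> = ennreal (1 + e) * (\<integral>\<^sup>+x. ennreal ((norm (f x))\<^sup>2) \<partial>M) + ennreal (1 + 1 / e) * (\<integral>\<^sup>+x. ennreal ((norm (g x))\<^sup>2) \<partial>M)"
    by (simp add: nn_integral_add nn_integral_cmult)
  finally show ?thesis .
qed

text \<open>Meant for \<open>a\<close> the squared norms of approximants, \<open>A\<close> that of
  their limit and \<open>b\<close> the squared errors. For fixed \<open>e\<close> the error terms
  vanish in the limit over \<open>k\<close>; only afterwards does \<open>e\<close> tend to
  0.\<close>

lemma tendsto_of_quadratic_bounds:
  fixes a b :: "nat \<Rightarrow> ennreal" and A :: real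
  assumes b: "b \<longlonglongrightarrow> 0" and A: "0 \<le> A"
    and up: "\<And>k e. 0 < e \<Longrightarrow> a k \<le> ennreal (1 + e) * ennreal A + ennreal (1 + 1 / e) * b k"
    and low: "\<And>k e. 0 < e \<Longrightarrow> ennreal A \<le> ennreal (1 + e) * a k + ennreal (1 + 1 / e) * b k"
  shows "a \<longlonglongrightarrow> ennreal A"
proof -
  have lim: "(\<lambda>k. c + ennreal (1 + 1 / e) * b k) \<longlonglongrightarrow> c" for c :: ennreal and e :: real
  proof -
    have "(\<lambda>k. c + ennreal (1 + 1 / e) * b k) \<longlonglongrightarrow> c + ennreal (1 + 1 / e) * 0"
      by (intro tendsto_add tendsto_const ennreal_tendsto_cmult b) auto
    then show ?thesis by simp
  qed
  have U: "limsup a \<le> ennreal (1 + e) * ennreal A" if "0 < e" for e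
  proof -
    have "limsup a \<le> limsup (\<lambda>k. ennreal (1 + e) * ennreal A + ennreal (1 + 1 / e) * b k)"
      using up[OF that] by (intro Limsup_mono) auto
    also have "\<dots> = ennreal (1 + e) * ennreal A"
      using lim[of "ennreal (1 + e) * ennreal A" e] by (intro lim_imp_Limsup) auto
    finally show ?thesis .
  qed
  have "limsup a \<le> ennreal A"
  proof (rule tendsto_lowerbound)
    have "((\<lambda>e. ennreal ((1 + e) * A)) \<longlongrightarrow> ennreal ((1 + 0) * A)) (at_right 0)"
      by (intro tendsto_ennrealI tendsto_intros)
    then show "((\<lambda>e. ennreal ((1 + e) * A)) \<longlongrightarrow> ennreal A) (at_right 0)" by simp
    show "eventually (\<lambda>e. limsup a \<le> ennreal ((1 + e) * A)) (at_right 0)"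
      using U A by (auto simp: eventually_at_right_less ennreal_mult intro!: eventually_mono[OF eventually_at_right_less])
  qed simp
  \<comment> \<open>The second bound is divided by \<open>1 + e\<close>, which turns the coefficient
    of the error into \<open>(1 + 1 / e) / (1 + e) = 1 / e\<close>.\<close>
  moreover have L: "ennreal (A / (1 + e)) \<le> liminf a" if "0 < e" for e
  proof -
    have e1: "ennreal (1 / (1 + e)) * ennreal (1 + e) = 1"
      using that by (simp add: ennreal_mult[symmetric] del: ennreal_plus)
    have "1 / (1 + e) * (1 + 1 / e) = 1 / e" using that by (simp add: divide_simps)
    then have e2: "ennreal (1 / (1 + e)) * ennreal (1 + 1 / e) = ennreal (1 / e)"
      using that by (simp add: ennreal_mult[symmetric] del: ennreal_plus)
    have le: "ennreal (A / (1 + e)) \<le> a k + ennreal (1 / e) * b k" for k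
    proof -
      have "ennreal (1 / (1 + e)) * ennreal A \<le> ennreal (1 / (1 + e)) * (ennreal (1 + e) * a k + ennreal (1 + 1 / e) * b k)"
        by (intro mult_left_mono low[OF that]) auto
      also have "\<dots> = a k + ennreal (1 / e) * b k"
        by (simp only: distrib_left mult.assoc[symmetric] e1 e2 mult_1_left)
      finally show ?thesis using that A by (simp add: ennreal_mult[symmetric] del: ennreal_plus)
    qed
    have "(\<lambda>k. ennreal (1 / e) * b k) \<longlonglongrightarrow> ennreal (1 / e) * 0"
      by (intro ennreal_tendsto_cmult b) auto
    then have "(\<lambda>k. ennreal (A / (1 + e)) - ennreal (1 / e) * b k) \<longlonglongrightarrow> ennreal (A / (1 + e)) - 0"
      by (intro tendsto_diff_ennreal tendsto_const) auto
    then have "ennreal (A / (1 + e)) = liminf (\<lambda>k. ennreal (A / (1 + e)) - ennreal (1 / e) * b k)"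
      by (intro lim_imp_Liminf[symmetric]) auto
    also have "\<dots> \<le> liminf a"
      using le by (intro Liminf_mono always_eventually allI) (simp add: ennreal_minus_le_iff add.commute)
    finally show ?thesis .
  qed
  have "ennreal A \<le> liminf a"
  proof (rule tendsto_upperbound)
    have "((\<lambda>e. ennreal (A / (1 + e))) \<longlongrightarrow> ennreal (A / (1 + 0))) (at_right 0)"
      by (intro tendsto_ennrealI tendsto_intros) auto
    then show "((\<lambda>e. ennreal (A / (1 + e))) \<longlongrightarrow> ennreal A) (at_right 0)" by simp
    show "eventually (\<lambda>e. ennreal (A / (1 + e)) \<le> liminf a) (at_right 0)"
      using L by (intro eventually_mono[OF eventually_at_right_less]) auto
  qed simp
  ultimately show ?thesis
    by (metis Liminf_le_Limsup antisym order_trans sequentially_bot tendsto_iff_Liminf_eq_Limsup trivial_limit_sequentially)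
qed

lemma nn_integral_norm_sq_tendsto:
  fixes f :: "'a \<Rightarrow> 'b::{real_normed_vector, second_countable_topology}"
  assumes [measurable]: "f \<in> borel_measurable M" "\<And>k. u k \<in> borel_measurable M"
    and fin: "(\<integral>\<^sup>+x. ennreal ((norm (f x))\<^sup>2) \<partial>M) < \<infinity>"
    and lim: "(\<lambda>k. \<integral>\<^sup>+x. ennreal ((norm (f x - u k x))\<^sup>2) \<partial>M) \<longlonglongrightarrow> 0"
  shows "(\<lambda>k. \<integral>\<^sup>+x. ennreal ((norm (u k x))\<^sup>2) \<partial>M) \<longlonglongrightarrow> (\<integral>\<^sup>+x. ennreal ((norm (f x))\<^sup>2) \<partial>M)"
proof -
  obtain A where A: "(\<integral>\<^sup>+x. ennreal ((norm (f x))\<^sup>2) \<partial>M) = ennreal A" "0 \<le> A"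
    using fin by (cases "\<integral>\<^sup>+x. ennreal ((norm (f x))\<^sup>2) \<partial>M") auto
  show ?thesis
    unfolding A(1)
  proof (rule tendsto_of_quadratic_bounds[OF lim A(2)])
    fix k and e :: real assume e: "0 < e"
    show "(\<integral>\<^sup>+x. ennreal ((norm (u k x))\<^sup>2) \<partial>M) \<le> ennreal (1 + e) * ennreal A +
        ennreal (1 + 1 / e) * (\<integral>\<^sup>+x. ennreal ((norm (f x - u k x))\<^sup>2) \<partial>M)"
      using nn_integral_norm_sq_add_le[of f M "\<lambda>x. u k x - f x" e] e
      by (simp add: A norm_minus_commute)
    show "ennreal A \<le> ennreal (1 + e) * (\<integral>\<^sup>+x. ennreal ((norm (u k x))\<^sup>2) \<partial>M) +
        ennreal (1 + 1 / e) * (\<integral>\<^sup>+x. ennreal ((norm (f x - u k x))\<^sup>2) \<partial>M)"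
      using nn_integral_norm_sq_add_le[of "u k" M "\<lambda>x. f x - u k x" e] e
      by (simp add: A)
  qed
qed

lemma integrable_diff_sq:
  fixes f g :: "'a \<Rightarrow> real"
  assumes [measurable]: "f \<in> borel_measurable M" "g \<in> borel_measurable M"
    and "integrable M (\<lambda>x. (f x)\<^sup>2)" "integrable M (\<lambda>x. (g x)\<^sup>2)"
  shows "integrable M (\<lambda>x. (f x - g x)\<^sup>2)"
proof (rule Bochner_Integration.integrable_bound)
  show "integrable M (\<lambda>x. 2 * (f x)\<^sup>2 + 2 * (g x)\<^sup>2)" using assms by simp
  have "(f x - g x)\<^sup>2 \<le> 2 * (f x)\<^sup>2 + 2 * (g x)\<^sup>2" for x
    using zero_le_power2[of "f x + g x"] by (simp add: power2_sum power2_diff)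
  then show "AE x in M. norm ((f x - g x)\<^sup>2) \<le> norm (2 * (f x)\<^sup>2 + 2 * (g x)\<^sup>2)"
    by (intro AE_I2) (simp add: abs_of_nonneg)
qed simp

lemma simple_white_noise_integral_measurable:
  assumes W: "white_noise M W"
    and s: "simple_function lborel s" "emeasure lborel {x. s x \<noteq> 0} < \<infinity>"
  shows "simple_white_noise_integral W s \<in> borel_measurable M"
proof -
  have [measurable]: "s \<in> borel_measurable borel"
    using borel_measurable_simple_function[OF s(1)] by auto
  have "(\<lambda>\<omega>. y * W {x. s x = y} \<omega>) \<in> borel_measurable M" for y
  \<comment> \<open>For \<open>y = 0\<close> the level set has infinite measure, so nothing is known
    about \<open>W\<close> on it; the factor 0 makes the summand constant.\<close>
  proof (cases "y = 0")
    case False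
    then have "emeasure lborel {x. s x = y} \<le> emeasure lborel {x. s x \<noteq> 0}"
      by (intro emeasure_mono) auto
    then have "emeasure lborel {x. s x = y} < \<infinity>" using s(2) by simp
    then have "W {x. s x = y} \<in> borel_measurable M"
      by (intro centered_gaussian_measurable[OF white_noise_gaussian[OF W]]) auto
    then show ?thesis by simp
  qed simp
  then show ?thesis unfolding simple_white_noise_integral_def by (intro borel_measurable_sum)
qed

lemma nn_integral_diff_diff_sq_tendsto:
  fixes F G :: "'a \<Rightarrow> real" and u w :: "nat \<Rightarrow> 'a \<Rightarrow> real"
  assumes [measurable]: "F \<in> borel_measurable M" "G \<in> borel_measurable M"
      "\<And>k. u k \<in> borel_measurable M" "\<And>k. w k \<in> borel_measurable M"
    and u: "(\<lambda>k. \<integral>\<^sup>+x. ennreal ((F x - u k x)\<^sup>2) \<partial>M) \<longlonglongrightarrow> 0"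
    and w: "(\<lambda>k. \<integral>\<^sup>+x. ennreal ((G x - w k x)\<^sup>2) \<partial>M) \<longlonglongrightarrow> 0"
  shows "(\<lambda>k. \<integral>\<^sup>+x. ennreal ((F x - G x - (u k x - w k x))\<^sup>2) \<partial>M) \<longlonglongrightarrow> 0"
proof (rule tendsto_sandwich[OF _ _ tendsto_const])
  have "(\<lambda>k. ennreal 2 * (\<integral>\<^sup>+x. ennreal ((F x - u k x)\<^sup>2) \<partial>M) + ennreal 2 * (\<integral>\<^sup>+x. ennreal ((G x - w k x)\<^sup>2) \<partial>M))
      \<longlonglongrightarrow> ennreal 2 * 0 + ennreal 2 * 0"
    by (intro tendsto_add ennreal_tendsto_cmult u w) auto
  then show "(\<lambda>k. ennreal 2 * (\<integral>\<^sup>+x. ennreal ((F x - u k x)\<^sup>2) \<partial>M) + ennreal 2 * (\<integral>\<^sup>+x. ennreal ((G x - w k x)\<^sup>2) \<partial>M))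
      \<longlonglongrightarrow> 0" by simp
  have "(\<integral>\<^sup>+x. ennreal ((F x - G x - (u k x - w k x))\<^sup>2) \<partial>M) \<le>
      ennreal 2 * (\<integral>\<^sup>+x. ennreal ((F x - u k x)\<^sup>2) \<partial>M) + ennreal 2 * (\<integral>\<^sup>+x. ennreal ((G x - w k x)\<^sup>2) \<partial>M)" for k
  proof -
    have "(\<integral>\<^sup>+x. ennreal ((F x - G x - (u k x - w k x))\<^sup>2) \<partial>M) =
        (\<integral>\<^sup>+x. ennreal ((norm ((F x - u k x) + (w k x - G x)))\<^sup>2) \<partial>M)"
      by (simp add: algebra_simps)
    also have "\<dots> \<le> ennreal (1 + 1) * (\<integral>\<^sup>+x. ennreal ((norm (F x - u k x))\<^sup>2) \<partial>M)
        + ennreal (1 + 1 / 1) * (\<integral>\<^sup>+x. ennreal ((norm (w k x - G x))\<^sup>2) \<partial>M)"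
      by (rule nn_integral_norm_sq_add_le) auto
    finally show ?thesis by (simp add: power2_commute[of "w k _"])
  qed
  then show "eventually (\<lambda>k. (\<integral>\<^sup>+x. ennreal ((F x - G x - (u k x - w k x))\<^sup>2) \<partial>M) \<le>
      ennreal 2 * (\<integral>\<^sup>+x. ennreal ((F x - u k x)\<^sup>2) \<partial>M) + ennreal 2 * (\<integral>\<^sup>+x. ennreal ((G x - w k x)\<^sup>2) \<partial>M)) sequentially"
    by simp
qed simp

section \<open>Moments of differences of white-noise integrals\<close>

text \<open>Linearity of the integral is bypassed. The two variables come with unrelated
  approximating sequences, but at each index the difference of the two simple integrals is almost
  surely a centered Gaussian, and its variance tends to the squared norm of
  \<open>f - f'\<close>.\<close>

lemma white_noise_integral_diff_approx:
  assumes W: "white_noise M W" and Y: "white_noise_integral M W f Y" and Y': "white_noise_integral M W f' Y'"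
  obtains Z v where "\<And>k::nat. centered_gaussian M (Z k) (v k)"
    "v \<longlonglongrightarrow> (\<integral>x. (f x - f' x)\<^sup>2 \<partial>lborel)"
    "(\<lambda>k. \<integral>\<^sup>+\<omega>. ennreal ((Y \<omega> - Y' \<omega> - Z k \<omega>)\<^sup>2) \<partial>M) \<longlonglongrightarrow> 0"
proof -
  from Y obtain s where f[measurable]: "f \<in> borel_measurable lborel" and fi: "integrable lborel (\<lambda>x. (f x)\<^sup>2)"
    and [measurable]: "Y \<in> borel_measurable M"
    and s: "\<And>k. simple_function lborel (s k)" "\<And>k. emeasure lborel {x. s k x \<noteq> 0} < \<infinity>"
    and s1: "(\<lambda>k. \<integral>\<^sup>+ x. ennreal ((f x - s k x)\<^sup>2) \<partial>lborel) \<longlonglongrightarrow> 0"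
    and s2: "(\<lambda>k. \<integral>\<^sup>+ \<omega>. ennreal ((Y \<omega> - simple_white_noise_integral W (s k) \<omega>)\<^sup>2) \<partial>M) \<longlonglongrightarrow> 0"
    unfolding white_noise_integral_def by blast
  from Y' obtain s' where f'[measurable]: "f' \<in> borel_measurable lborel" and fi': "integrable lborel (\<lambda>x. (f' x)\<^sup>2)"
    and [measurable]: "Y' \<in> borel_measurable M"
    and s': "\<And>k. simple_function lborel (s' k)" "\<And>k. emeasure lborel {x. s' k x \<noteq> 0} < \<infinity>"
    and s1': "(\<lambda>k. \<integral>\<^sup>+ x. ennreal ((f' x - s' k x)\<^sup>2) \<partial>lborel) \<longlonglongrightarrow> 0"
    and s2': "(\<lambda>k. \<integral>\<^sup>+ \<omega>. ennreal ((Y' \<omega> - simple_white_noise_integral W (s' k) \<omega>)\<^sup>2) \<partial>M) \<longlonglongrightarrow> 0"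
    unfolding white_noise_integral_def by blast
  define v where "v k = (\<integral>x. (s k x - s' k x)\<^sup>2 \<partial>lborel)" for k
  have [measurable]: "s k \<in> borel_measurable lborel" "s' k \<in> borel_measurable lborel" for k
    by (rule borel_measurable_simple_function[OF s(1)], rule borel_measurable_simple_function[OF s'(1)])
  have [measurable]: "simple_white_noise_integral W (s k) \<in> borel_measurable M"
      "simple_white_noise_integral W (s' k) \<in> borel_measurable M" for k
    by (rule simple_white_noise_integral_measurable[OF W s], rule simple_white_noise_integral_measurable[OF W s'])
  have si: "integrable lborel (\<lambda>x. (s k x - s' k x)\<^sup>2)" for k
    by (rule simple_white_noise_integral_diff_gaussian(1)[OF W s s'])
  have di: "integrable lborel (\<lambda>x. (f x - f' x)\<^sup>2)"
    by (intro integrable_diff_sq fi fi') auto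
  have "\<exists>Z. centered_gaussian M Z (v k) \<and>
    (AE \<omega> in M. simple_white_noise_integral W (s k) \<omega> - simple_white_noise_integral W (s' k) \<omega> = Z \<omega>)" for k
    unfolding v_def by (rule simple_white_noise_integral_diff_gaussian(2)[OF W s s'])
  then obtain Z where Z: "\<And>k. centered_gaussian M (Z k) (v k)"
    "\<And>k. AE \<omega> in M. simple_white_noise_integral W (s k) \<omega> - simple_white_noise_integral W (s' k) \<omega> = Z k \<omega>"
    by metis
  have "(\<lambda>k. \<integral>\<^sup>+ x. ennreal ((norm (f x - f' x - (s k x - s' k x)))\<^sup>2) \<partial>lborel) \<longlonglongrightarrow> 0"
    using nn_integral_diff_diff_sq_tendsto[OF _ _ _ _ s1 s1'] by simp
  moreover have "(\<integral>\<^sup>+x. ennreal ((norm (f x - f' x))\<^sup>2) \<partial>lborel) = ennreal (\<integral>x. (f x - f' x)\<^sup>2 \<partial>lborel)"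
    using di by (simp add: nn_integral_eq_integral)
  ultimately have "(\<lambda>k. \<integral>\<^sup>+x. ennreal ((norm (s k x - s' k x))\<^sup>2) \<partial>lborel) \<longlonglongrightarrow> ennreal (\<integral>x. (f x - f' x)\<^sup>2 \<partial>lborel)"
    using nn_integral_norm_sq_tendsto[of "\<lambda>x. f x - f' x" lborel "\<lambda>k x. s k x - s' k x"] by simp
  moreover have "(\<integral>\<^sup>+x. ennreal ((norm (s k x - s' k x))\<^sup>2) \<partial>lborel) = ennreal (v k)" for k
    using si by (simp add: nn_integral_eq_integral v_def)
  ultimately have "v \<longlonglongrightarrow> (\<integral>x. (f x - f' x)\<^sup>2 \<partial>lborel)"
    by (simp add: v_def[abs_def])
  moreover have "(\<lambda>k. \<integral>\<^sup>+\<omega>. ennreal ((Y \<omega> - Y' \<omega> - Z k \<omega>)\<^sup>2) \<partial>M) \<longlonglongrightarrow> 0"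
  proof -
    have "(\<integral>\<^sup>+\<omega>. ennreal ((Y \<omega> - Y' \<omega> - Z k \<omega>)\<^sup>2) \<partial>M) =
      (\<integral>\<^sup>+\<omega>. ennreal ((Y \<omega> - Y' \<omega> - (simple_white_noise_integral W (s k) \<omega> - simple_white_noise_integral W (s' k) \<omega>))\<^sup>2) \<partial>M)" for k
      using Z(2)[of k] by (intro nn_integral_cong_AE) (auto elim: eventually_mono)
    then show ?thesis
      using nn_integral_diff_diff_sq_tendsto[OF _ _ _ _ s2 s2'] by simp
  qed
  ultimately show ?thesis using Z(1) that by blast
qed

text \<open>Mean-square convergence gives almost sure convergence along a subsequence, and Fatou's
  lemma then carries upper bounds on the integrals to the limit. \<open>G\<close> has extended
  values, so that inverse powers with their infinite value at 0 are continuous and covered.\<close>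

lemma nn_integral_L2_limit_le:
  fixes G :: "real \<Rightarrow> ennreal"
  assumes [measurable]: "Y \<in> borel_measurable M" "\<And>k. Z k \<in> borel_measurable M"
    and lim: "(\<lambda>k. \<integral>\<^sup>+\<omega>. ennreal ((Y \<omega> - Z k \<omega>)\<^sup>2) \<partial>M) \<longlonglongrightarrow> 0"
    and G: "continuous_on UNIV G"
    and bound: "eventually (\<lambda>k. (\<integral>\<^sup>+\<omega>. G (Z k \<omega>) \<partial>M) \<le> c k) sequentially" and c: "c \<longlonglongrightarrow> c0"
  shows "(\<integral>\<^sup>+\<omega>. G (Y \<omega>) \<partial>M) \<le> c0"
proof -
  have [measurable]: "G \<in> borel_measurable borel" by (rule borel_measurable_continuous_onI[OF G])
  have "eventually (\<lambda>k. (\<integral>\<^sup>+\<omega>. ennreal ((Y \<omega> - Z k \<omega>)\<^sup>2) \<partial>M) < 1) sequentially"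
    using order_tendstoD(2)[OF lim] by simp
  \<comment> \<open>The subsequence argument works with integrable functions; from \<open>k0\<close>
    on the squared errors have finite integral.\<close>
  then obtain k0 where k0: "\<And>k. k \<ge> k0 \<Longrightarrow> (\<integral>\<^sup>+\<omega>. ennreal ((Y \<omega> - Z k \<omega>)\<^sup>2) \<partial>M) < 1"
    by (auto simp: eventually_sequentially)
  define u where "u n \<omega> = (Y \<omega> - Z (n + k0) \<omega>)\<^sup>2" for n \<omega>
  have int: "integrable M (u n)" for n
    unfolding u_def using k0[of "n + k0"]
    by (intro integrableI_bounded) (auto elim: less_trans)
  have u0: "(\<lambda>n. ennreal (\<integral>\<omega>. u n \<omega> \<partial>M)) \<longlonglongrightarrow> ennreal 0"
  proof -
    have "ennreal (\<integral>\<omega>. u n \<omega> \<partial>M) = (\<integral>\<^sup>+\<omega>. ennreal ((Y \<omega> - Z (n + k0) \<omega>)\<^sup>2) \<partial>M)" for n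
      using int[of n] by (subst nn_integral_eq_integral[symmetric]) (auto simp: u_def)
    then show ?thesis using LIMSEQ_ignore_initial_segment[OF lim, of k0] by simp
  qed
  have "(\<lambda>n. \<integral>\<omega>. u n \<omega> \<partial>M) \<longlonglongrightarrow> 0"
    by (rule tendsto_ennreal_iff[THEN iffD1, OF _ _ u0]) (simp_all add: u_def)
  moreover have "norm (u n \<omega>) = u n \<omega>" for n \<omega> by (simp add: u_def)
  ultimately have "(\<lambda>n. \<integral>\<omega>. norm (u n \<omega>) \<partial>M) \<longlonglongrightarrow> 0" by simp
  from tendsto_L1_AE_subseq[OF int this] obtain r :: "nat \<Rightarrow> nat"
    where r: "strict_mono r" and AE: "AE \<omega> in M. (\<lambda>n. u (r n) \<omega>) \<longlonglongrightarrow> 0" by auto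
  have "AE \<omega> in M. G (Y \<omega>) = liminf (\<lambda>n. G (Z (r n + k0) \<omega>))"
    using AE
  proof eventually_elim
    case (elim \<omega>)
    then have "(\<lambda>n. sqrt ((Y \<omega> - Z (r n + k0) \<omega>)\<^sup>2)) \<longlonglongrightarrow> sqrt 0"
      unfolding u_def by (intro tendsto_real_sqrt)
    then have "(\<lambda>n. Y \<omega> - Z (r n + k0) \<omega>) \<longlonglongrightarrow> 0" by (simp add: tendsto_rabs_zero_iff)
    then have "(\<lambda>n. Y \<omega> - (Y \<omega> - Z (r n + k0) \<omega>)) \<longlonglongrightarrow> Y \<omega> - 0" by (intro tendsto_intros)
    then have "(\<lambda>n. Z (r n + k0) \<omega>) \<longlonglongrightarrow> Y \<omega>" by simp
    then have "(\<lambda>n. G (Z (r n + k0) \<omega>)) \<longlonglongrightarrow> G (Y \<omega>)"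
      using continuous_on_tendsto_compose[OF G] by simp
    then show ?case by (intro lim_imp_Liminf[symmetric]) auto
  qed
  then have 1: "(\<integral>\<^sup>+\<omega>. G (Y \<omega>) \<partial>M) = (\<integral>\<^sup>+\<omega>. liminf (\<lambda>n. G (Z (r n + k0) \<omega>)) \<partial>M)"
    by (rule nn_integral_cong_AE)
  have 2: "(\<integral>\<^sup>+\<omega>. liminf (\<lambda>n. G (Z (r n + k0) \<omega>)) \<partial>M) \<le> liminf (\<lambda>n. \<integral>\<^sup>+\<omega>. G (Z (r n + k0) \<omega>) \<partial>M)"
    by (rule nn_integral_liminf) simp
  have 3: "liminf (\<lambda>n. \<integral>\<^sup>+\<omega>. G (Z (r n + k0) \<omega>) \<partial>M) \<le> liminf (\<lambda>n. c (r n + k0))"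
  proof (rule Liminf_mono)
    obtain N where N: "\<And>k. N \<le> k \<Longrightarrow> (\<integral>\<^sup>+\<omega>. G (Z k \<omega>) \<partial>M) \<le> c k"
      using bound unfolding eventually_sequentially by blast
    have "N \<le> r n + k0" if "N \<le> n" for n
      using seq_suble[OF r, of n] that by simp
    then show "eventually (\<lambda>n. (\<integral>\<^sup>+\<omega>. G (Z (r n + k0) \<omega>) \<partial>M) \<le> c (r n + k0)) sequentially"
      unfolding eventually_sequentially using N by blast
  qed
  have 4: "liminf (\<lambda>n. c (r n + k0)) = c0"
  proof (rule lim_imp_Liminf)
    show "(\<lambda>n. c (r n + k0)) \<longlonglongrightarrow> c0"
      using LIMSEQ_subseq_LIMSEQ[OF LIMSEQ_ignore_initial_segment[OF c, of k0] r] by (simp add: o_def)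
  qed simp
  show ?thesis by (rule ord_eq_le_trans[OF 1 ord_le_eq_trans[OF order_trans[OF 2 3] 4]])
qed

lemma white_noise_integral_diff_even_moment:
  assumes W: "white_noise M W" and Y: "white_noise_integral M W f Y" "white_noise_integral M W f' Y'" and k: "0 < k"
  shows "(\<integral>\<^sup>+\<omega>. ennreal ((Y \<omega> - Y' \<omega>) ^ (2 * k)) \<partial>M) \<le>
    ennreal (fact (2 * k) / (2 ^ k * fact k) * (\<integral>x. (f x - f' x)\<^sup>2 \<partial>lborel) ^ k)"
proof -
  interpret prob_space M using W by (simp add: white_noise_def)
  obtain Z v where Z: "\<And>j::nat. centered_gaussian M (Z j) (v j)"
    "v \<longlonglongrightarrow> (\<integral>x. (f x - f' x)\<^sup>2 \<partial>lborel)"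
    "(\<lambda>j. \<integral>\<^sup>+\<omega>. ennreal ((Y \<omega> - Y' \<omega> - Z j \<omega>)\<^sup>2) \<partial>M) \<longlonglongrightarrow> 0"
    by (rule white_noise_integral_diff_approx[OF W Y]) (rule that; assumption)
  have [measurable]: "Y \<in> borel_measurable M" "Y' \<in> borel_measurable M" "\<And>j. Z j \<in> borel_measurable M"
    using Y Z(1) by (auto simp: white_noise_integral_def intro: centered_gaussian_measurable)
  show ?thesis
  proof (rule nn_integral_L2_limit_le[OF _ _ Z(3), where G = "\<lambda>y. ennreal (y ^ (2 * k))"])
    show "continuous_on UNIV (\<lambda>y::real. ennreal (y ^ (2 * k)))"
      by (intro continuous_on_ennreal continuous_intros)
    show "eventually (\<lambda>j. (\<integral>\<^sup>+\<omega>. ennreal (Z j \<omega> ^ (2 * k)) \<partial>M) \<le> ennreal (fact (2 * k) / (2 ^ k * fact k) * v j ^ k)) sequentially"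
      using centered_gaussian_even_moment[OF Z(1) k] by simp
    show "(\<lambda>j. ennreal (fact (2 * k) / (2 ^ k * fact k) * v j ^ k)) \<longlonglongrightarrow>
      ennreal (fact (2 * k) / (2 ^ k * fact k) * (\<integral>x. (f x - f' x)\<^sup>2 \<partial>lborel) ^ k)"
      by (intro tendsto_ennrealI tendsto_intros Z(2))
  qed auto
qed

text \<open>A positive limit of the variances makes the variances of the approximants eventually
  positive, so the Gaussian bound applies to all but finitely many of them.\<close>

lemma white_noise_integral_diff_negative_moment:
  assumes W: "white_noise M W" and Y: "white_noise_integral M W f Y" "white_noise_integral M W f' Y'"
    and pos: "0 < (\<integral>x. (f x - f' x)\<^sup>2 \<partial>lborel)" and b: "0 < b" "b < 1"
  shows "(\<integral>\<^sup>+\<omega>. inverse (ennreal (\<bar>Y \<omega> - Y' \<omega>\<bar> powr b)) \<partial>M) \<le>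
    ennreal ((1 + 2 / (1 - b)) * (\<integral>x. (f x - f' x)\<^sup>2 \<partial>lborel) powr (- b / 2))"
proof -
  obtain Z v where Z: "\<And>j::nat. centered_gaussian M (Z j) (v j)"
    "v \<longlonglongrightarrow> (\<integral>x. (f x - f' x)\<^sup>2 \<partial>lborel)"
    "(\<lambda>j. \<integral>\<^sup>+\<omega>. ennreal ((Y \<omega> - Y' \<omega> - Z j \<omega>)\<^sup>2) \<partial>M) \<longlonglongrightarrow> 0"
    by (rule white_noise_integral_diff_approx[OF W Y]) (rule that; assumption)
  have [measurable]: "Y \<in> borel_measurable M" "Y' \<in> borel_measurable M" "\<And>j. Z j \<in> borel_measurable M"
    using Y Z(1) by (auto simp: white_noise_integral_def intro: centered_gaussian_measurable)
  show ?thesis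
  proof (rule nn_integral_L2_limit_le[OF _ _ Z(3), where G = "\<lambda>y. inverse (ennreal (\<bar>y\<bar> powr b))"])
    show "continuous_on UNIV (\<lambda>y::real. inverse (ennreal (\<bar>y\<bar> powr b)))"
      using b by (intro continuous_on_inverse_ennreal continuous_on_ennreal continuous_on_powr' continuous_intros) auto
    show "eventually (\<lambda>j. (\<integral>\<^sup>+\<omega>. inverse (ennreal (\<bar>Z j \<omega>\<bar> powr b)) \<partial>M) \<le> ennreal ((1 + 2 / (1 - b)) * v j powr (- b / 2))) sequentially"
      using order_tendstoD(1)[OF Z(2) pos]
      by eventually_elim (use centered_gaussian_negative_moment[OF Z(1)] b in auto)
    show "(\<lambda>j. ennreal ((1 + 2 / (1 - b)) * v j powr (- b / 2))) \<longlonglongrightarrow>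
      ennreal ((1 + 2 / (1 - b)) * (\<integral>x. (f x - f' x)\<^sup>2 \<partial>lborel) powr (- b / 2))"
      using pos by (intro tendsto_ennrealI tendsto_intros Z(2)) auto
  qed auto
qed

section \<open>The Plancherel identity\<close>

text \<open>The transform of an integrable function in the unitary normalization of
  \<open>L2_fourier_transform\<close>, whose truncated integrals are the values of
  \<open>fourier_integral\<close> at cut-off functions.\<close>

definition fourier_integral :: "(real \<Rightarrow> real) \<Rightarrow> real \<Rightarrow> complex" where
  "fourier_integral f \<xi> = complex_of_real (1 / sqrt (2 * pi)) *
     (\<integral>x. exp (- (\<i> * complex_of_real (x * \<xi>))) * complex_of_real (f x) \<partial>lborel)"

lemma norm_exp_neg_i [simp]: "norm (exp (- (\<i> * complex_of_real r))) = 1"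
proof -
  have "- (\<i> * complex_of_real r) = \<i> * complex_of_real (- r)" by simp
  then show ?thesis by (metis norm_exp_i_times)
qed

lemma fourier_integral_measurable[measurable]:
  assumes [measurable]: "f \<in> borel_measurable borel"
  shows "fourier_integral f \<in> borel_measurable borel"
  unfolding fourier_integral_def by measurable

lemma integrable_exp_mult:
  assumes [measurable]: "integrable lborel f"
  shows "integrable lborel (\<lambda>x. exp (- (\<i> * complex_of_real (x * \<xi>))) * complex_of_real (f x))"
proof (rule Bochner_Integration.integrable_bound[OF assms])
  have [measurable]: "f \<in> borel_measurable borel" using assms by (auto dest: borel_measurable_integrable)
  show "(\<lambda>x. exp (- (\<i> * complex_of_real (x * \<xi>))) * complex_of_real (f x)) \<in> borel_measurable lborel" by measurable
qed (simp add: norm_mult)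

lemma fourier_integral_diff:
  assumes "integrable lborel f" "integrable lborel g"
  shows "fourier_integral (\<lambda>x. f x - g x) \<xi> = fourier_integral f \<xi> - fourier_integral g \<xi>"
  using integrable_exp_mult[OF assms(1), of \<xi>] integrable_exp_mult[OF assms(2), of \<xi>]
  unfolding fourier_integral_def by (simp only: of_real_diff right_diff_distrib Bochner_Integration.integral_diff)

lemma cnj_fourier_integral:
  "cnj (fourier_integral f \<xi>) = complex_of_real (1 / sqrt (2 * pi)) *
     (\<integral>y. exp (\<i> * complex_of_real (y * \<xi>)) * complex_of_real (f y) \<partial>lborel)"
  unfolding fourier_integral_def by (simp add: Bochner_Integration.integral_cnj[symmetric] exp_cnj del: Bochner_Integration.integral_cnj)

lemma norm_fourier_integral_le:
  assumes "integrable lborel f"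
  shows "norm (fourier_integral f \<xi>) \<le> 1 / sqrt (2 * pi) * (\<integral>x. \<bar>f x\<bar> \<partial>lborel)"
proof -
  have "norm (\<integral>x. exp (- (\<i> * complex_of_real (x * \<xi>))) * complex_of_real (f x) \<partial>lborel) \<le>
      (\<integral>x. norm (exp (- (\<i> * complex_of_real (x * \<xi>))) * complex_of_real (f x)) \<partial>lborel)"
    by (rule integral_norm_bound)
  also have "\<dots> = (\<integral>x. \<bar>f x\<bar> \<partial>lborel)" by (simp add: norm_mult)
  finally show ?thesis
    unfolding fourier_integral_def norm_mult norm_of_real by (intro mult_mono) auto
qed

section \<open>Gaussian regularization of the Fourier side\<close>

text \<open>The characteristic function of the standard normal law after the substitution
  \<open>s = \<epsilon> * \<xi>\<close>. The outcome is rewritten as a normal density of standard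
  deviation \<open>\<epsilon>\<close>, ready to act as an approximate identity.\<close>

lemma gaussian_fourier_integral:
  assumes "0 < \<epsilon>"
  shows "integrable lborel (\<lambda>\<xi>. exp (- (\<epsilon> * \<xi>)\<^sup>2 / 2))"
    and "(\<integral>\<xi>. complex_of_real (exp (- (\<epsilon> * \<xi>)\<^sup>2 / 2)) * exp (- (\<i> * complex_of_real (u * \<xi>))) \<partial>lborel)
      = complex_of_real (2 * pi * normal_density 0 \<epsilon> u)"
proof -
  have e: "exp (- s\<^sup>2 / 2) = sqrt (2 * pi) * std_normal_density s" for s :: real
    by (simp add: std_normal_density_def)
  have "integrable lborel (\<lambda>s. sqrt (2 * pi) * std_normal_density s)" by simp
  then have "integrable lborel (\<lambda>s::real. exp (- s\<^sup>2 / 2))" unfolding e .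
  then show "integrable lborel (\<lambda>\<xi>. exp (- (\<epsilon> * \<xi>)\<^sup>2 / 2))"
    using lborel_integrable_real_affine[of "\<lambda>s. exp (- s\<^sup>2 / 2)" \<epsilon> 0] assms by simp
  have "complex_of_real (exp (- (- u / \<epsilon>)\<^sup>2 / 2)) = char std_normal_distribution (- u / \<epsilon>)"
    by (simp add: char_std_normal_distribution)
  also have "\<dots> = (\<integral>s. std_normal_density s *\<^sub>R exp (\<i> * complex_of_real (- u / \<epsilon> * s)) \<partial>lborel)"
    unfolding char_def by (subst integral_density) auto
  finally have c: "(\<integral>s. std_normal_density s *\<^sub>R exp (\<i> * complex_of_real (- u / \<epsilon> * s)) \<partial>lborel) =
      complex_of_real (exp (- (u / \<epsilon>)\<^sup>2 / 2))" by simp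
  have "(\<integral>\<xi>. complex_of_real (exp (- (\<epsilon> * \<xi>)\<^sup>2 / 2)) * exp (- (\<i> * complex_of_real (u * \<xi>))) \<partial>lborel)
      = \<bar>1 / \<epsilon>\<bar> *\<^sub>R (\<integral>s. complex_of_real (exp (- (\<epsilon> * (0 + 1 / \<epsilon> * s))\<^sup>2 / 2)) *
          exp (- (\<i> * complex_of_real (u * (0 + 1 / \<epsilon> * s)))) \<partial>lborel)"
    by (rule lborel_integral_real_affine) (use assms in simp)
  also have "(\<integral>s. complex_of_real (exp (- (\<epsilon> * (0 + 1 / \<epsilon> * s))\<^sup>2 / 2)) *
          exp (- (\<i> * complex_of_real (u * (0 + 1 / \<epsilon> * s)))) \<partial>lborel)
      = (\<integral>s. sqrt (2 * pi) *\<^sub>R (std_normal_density s *\<^sub>R exp (\<i> * complex_of_real (- u / \<epsilon> * s))) \<partial>lborel)"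
  proof (rule Bochner_Integration.integral_cong[OF refl])
    fix s
    have 1: "\<epsilon> * (0 + 1 / \<epsilon> * s) = s" using assms by simp
    have 2: "- (\<i> * complex_of_real (u * (0 + 1 / \<epsilon> * s))) = \<i> * complex_of_real (- u / \<epsilon> * s)" by simp
    show "complex_of_real (exp (- (\<epsilon> * (0 + 1 / \<epsilon> * s))\<^sup>2 / 2)) *
          exp (- (\<i> * complex_of_real (u * (0 + 1 / \<epsilon> * s))))
      = sqrt (2 * pi) *\<^sub>R (std_normal_density s *\<^sub>R exp (\<i> * complex_of_real (- u / \<epsilon> * s)))"
      unfolding 1 2 e by (simp add: scaleR_conv_of_real del: of_real_mult[symmetric])
  qed
  also have "\<dots> = sqrt (2 * pi) *\<^sub>R complex_of_real (exp (- (u / \<epsilon>)\<^sup>2 / 2))"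
    by (simp only: integral_scaleR_right c)
  also have "\<bar>1 / \<epsilon>\<bar> *\<^sub>R sqrt (2 * pi) *\<^sub>R complex_of_real (exp (- (u / \<epsilon>)\<^sup>2 / 2)) =
      complex_of_real (1 / \<epsilon> * sqrt (2 * pi) * exp (- (u / \<epsilon>)\<^sup>2 / 2))"
    using assms by (simp add: scaleR_conv_of_real mult.assoc)
  also have "1 / \<epsilon> * sqrt (2 * pi) * exp (- (u / \<epsilon>)\<^sup>2 / 2) = 2 * pi * normal_density 0 \<epsilon> u"
  proof -
    have "sqrt (2 * pi) * sqrt (2 * pi) = 2 * pi" by simp
    then have "2 * pi / sqrt (2 * pi) = sqrt (2 * pi)" by (metis nonzero_mult_div_cancel_right pi_neq_zero real_sqrt_eq_zero_cancel_iff mult_eq_0_iff zero_neq_numeral)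
    then show ?thesis using assms
      by (simp add: normal_density_def real_sqrt_mult power_divide field_simps)
  qed
  finally show "(\<integral>\<xi>. complex_of_real (exp (- (\<epsilon> * \<xi>)\<^sup>2 / 2)) * exp (- (\<i> * complex_of_real (u * \<xi>))) \<partial>lborel)
      = complex_of_real (2 * pi * normal_density 0 \<epsilon> u)" .
qed

lemma integrable_prod_lborel:
  fixes a b :: "real \<Rightarrow> real" and k :: "real \<Rightarrow> real \<Rightarrow> 'a::{banach, second_countable_topology}"
  assumes a: "integrable lborel a" and b: "integrable lborel b"
    and [measurable]: "case_prod k \<in> borel_measurable (borel \<Otimes>\<^sub>M borel)"
    and k: "\<And>x y. norm (k x y) \<le> C * \<bar>a x\<bar> * \<bar>b y\<bar>"
  shows "integrable (lborel \<Otimes>\<^sub>M lborel) (case_prod k)"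
proof (rule Bochner_Integration.integrable_bound)
  have [measurable]: "a \<in> borel_measurable borel" "b \<in> borel_measurable borel"
    using a b by (auto dest: borel_measurable_integrable)
  show "integrable (lborel \<Otimes>\<^sub>M lborel) (\<lambda>(x, y). C * \<bar>a x\<bar> * \<bar>b y\<bar>)"
  proof (rule lborel_pair.Fubini_integrable)
    show "integrable lborel (\<lambda>x. \<integral>y. norm (case (x, y) of (x, y) \<Rightarrow> C * \<bar>a x\<bar> * \<bar>b y\<bar>) \<partial>lborel)"
      using a b by (simp add: abs_mult)
    show "AE x in lborel. integrable lborel (\<lambda>y. case (x, y) of (x, y) \<Rightarrow> C * \<bar>a x\<bar> * \<bar>b y\<bar>)"
      using b by simp
  qed measurable
  show "AE p in lborel \<Otimes>\<^sub>M lborel. norm (case_prod k p) \<le> norm (case p of (x, y) \<Rightarrow> C * \<bar>a x\<bar> * \<bar>b y\<bar>)"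
    by (intro AE_I2) (auto split: prod.split intro: order_trans[OF k abs_ge_self])
qed (simp add: lborel_prod[symmetric] cong: measurable_cong_sets)

text \<open>The squared modulus is a double integral over \<open>x\<close> and \<open>y\<close>. The
  Gaussian weight makes everything absolutely integrable, so Fubini allows the frequency to be
  integrated first; this turns the weight into a normal density in \<open>x - y\<close>, that is,
  into smoothing at scale \<open>\<epsilon>\<close>.\<close>

lemma fourier_integral_gaussian_weight:
  assumes f: "integrable lborel f" and \<epsilon>: "0 < \<epsilon>"
  shows "(\<integral>\<xi>. exp (- (\<epsilon> * \<xi>)\<^sup>2 / 2) * (cmod (fourier_integral f \<xi>))\<^sup>2 \<partial>lborel) =
    (\<integral>x. f x * (\<integral>y. f y * normal_density 0 \<epsilon> (x - y) \<partial>lborel) \<partial>lborel)"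
proof -
  have fm[measurable]: "f \<in> borel_measurable borel" using f by (auto dest: borel_measurable_integrable)
  define \<gamma> where "\<gamma> \<xi> = exp (- (\<epsilon> * \<xi>)\<^sup>2 / 2)" for \<xi> :: real
  define c where "c = complex_of_real (1 / sqrt (2 * pi))"
  have \<gamma>0: "0 \<le> \<gamma> \<xi>" for \<xi> by (simp add: \<gamma>_def)
  have [measurable]: "\<gamma> \<in> borel_measurable borel" unfolding \<gamma>_def by measurable
  have \<gamma>i: "integrable lborel \<gamma>" unfolding \<gamma>_def[abs_def] by (rule gaussian_fourier_integral(1)[OF \<epsilon>])
  have [measurable]: "cnj \<in> borel_measurable borel"
    by (intro borel_measurable_continuous_onI continuous_intros)
  \<comment> \<open>The two normalizing factors together cancel the factor \<open>2 * pi\<close>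
    produced by the transform of the Gaussian weight.\<close>
  have cc: "c * c = complex_of_real (1 / (2 * pi))" unfolding c_def by (simp flip: of_real_mult)
  have inner: "(\<integral>\<xi>. complex_of_real (\<gamma> \<xi>) * exp (- (\<i> * complex_of_real (x * \<xi>))) * cnj (fourier_integral f \<xi>) \<partial>lborel)
      = c * complex_of_real (2 * pi * (\<integral>y. f y * normal_density 0 \<epsilon> (x - y) \<partial>lborel))" for x
  proof -
    define k where "k y \<xi> = complex_of_real (\<gamma> \<xi>) * exp (- (\<i> * complex_of_real ((x - y) * \<xi>))) * complex_of_real (f y)" for y \<xi>
    have ki: "integrable (lborel \<Otimes>\<^sub>M lborel) (case_prod k)"
    proof (rule integrable_prod_lborel[OF f \<gamma>i, where C = 1])
      show "case_prod k \<in> borel_measurable (borel \<Otimes>\<^sub>M borel)" unfolding k_def by measurable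
    qed (simp add: k_def norm_mult)
    have "(\<integral>\<xi>. complex_of_real (\<gamma> \<xi>) * exp (- (\<i> * complex_of_real (x * \<xi>))) * cnj (fourier_integral f \<xi>) \<partial>lborel)
       = (\<integral>\<xi>. c * (\<integral>y. k y \<xi> \<partial>lborel) \<partial>lborel)"
    proof (rule Bochner_Integration.integral_cong[OF refl])
      fix \<xi>
      have "complex_of_real (\<gamma> \<xi>) * exp (- (\<i> * complex_of_real (x * \<xi>))) * cnj (fourier_integral f \<xi>) =
          c * (complex_of_real (\<gamma> \<xi>) * exp (- (\<i> * complex_of_real (x * \<xi>))) * (\<integral>y. exp (\<i> * complex_of_real (y * \<xi>)) * complex_of_real (f y) \<partial>lborel))"
        unfolding cnj_fourier_integral c_def by (simp add: mult_ac)
      also have "complex_of_real (\<gamma> \<xi>) * exp (- (\<i> * complex_of_real (x * \<xi>))) * (\<integral>y. exp (\<i> * complex_of_real (y * \<xi>)) * complex_of_real (f y) \<partial>lborel)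
         = (\<integral>y. (complex_of_real (\<gamma> \<xi>) * exp (- (\<i> * complex_of_real (x * \<xi>)))) * (exp (\<i> * complex_of_real (y * \<xi>)) * complex_of_real (f y)) \<partial>lborel)"
        by (rule integral_mult_right_zero[symmetric])
      also have "\<dots> = (\<integral>y. k y \<xi> \<partial>lborel)"
      proof (rule Bochner_Integration.integral_cong[OF refl])
        fix y
        have "- (\<i> * complex_of_real ((x - y) * \<xi>)) = - (\<i> * complex_of_real (x * \<xi>)) + \<i> * complex_of_real (y * \<xi>)"
          by (simp add: algebra_simps)
        then show "(complex_of_real (\<gamma> \<xi>) * exp (- (\<i> * complex_of_real (x * \<xi>)))) * (exp (\<i> * complex_of_real (y * \<xi>)) * complex_of_real (f y)) = k y \<xi>"
          unfolding k_def by (simp only: exp_add mult.assoc)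
      qed
      finally show "complex_of_real (\<gamma> \<xi>) * exp (- (\<i> * complex_of_real (x * \<xi>))) * cnj (fourier_integral f \<xi>) = c * (\<integral>y. k y \<xi> \<partial>lborel)" .
    qed
    also have "\<dots> = c * (\<integral>\<xi>. (\<integral>y. k y \<xi> \<partial>lborel) \<partial>lborel)" by (rule integral_mult_right_zero)
    also have "(\<integral>\<xi>. (\<integral>y. k y \<xi> \<partial>lborel) \<partial>lborel) = (\<integral>y. (\<integral>\<xi>. k y \<xi> \<partial>lborel) \<partial>lborel)"
      by (rule lborel_pair.Fubini_integral[OF ki])
    also have "\<dots> = (\<integral>y. complex_of_real (2 * pi * (f y * normal_density 0 \<epsilon> (x - y))) \<partial>lborel)"
    proof (rule Bochner_Integration.integral_cong[OF refl])
      fix y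
      have "(\<integral>\<xi>. k y \<xi> \<partial>lborel) = (\<integral>\<xi>. complex_of_real (\<gamma> \<xi>) * exp (- (\<i> * complex_of_real ((x - y) * \<xi>))) \<partial>lborel) * complex_of_real (f y)"
        unfolding k_def by (rule integral_mult_left_zero)
      also have "\<dots> = complex_of_real (2 * pi * normal_density 0 \<epsilon> (x - y)) * complex_of_real (f y)"
        unfolding \<gamma>_def gaussian_fourier_integral(2)[OF \<epsilon>] ..
      finally show "(\<integral>\<xi>. k y \<xi> \<partial>lborel) = complex_of_real (2 * pi * (f y * normal_density 0 \<epsilon> (x - y)))" by simp
    qed
    also have "\<dots> = complex_of_real (2 * pi * (\<integral>y. f y * normal_density 0 \<epsilon> (x - y) \<partial>lborel))"
      unfolding integral_complex_of_real by simp
    finally show ?thesis .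
  qed
  define h where "h x \<xi> = complex_of_real (\<gamma> \<xi>) * exp (- (\<i> * complex_of_real (x * \<xi>))) * cnj (fourier_integral f \<xi>) * complex_of_real (f x)" for x \<xi>
  have hi: "integrable (lborel \<Otimes>\<^sub>M lborel) (case_prod h)"
  proof (rule integrable_prod_lborel[OF f \<gamma>i, where C = "1 / sqrt (2 * pi) * (\<integral>x. \<bar>f x\<bar> \<partial>lborel)"])
    show "case_prod h \<in> borel_measurable (borel \<Otimes>\<^sub>M borel)" unfolding h_def by measurable
    fix x \<xi>
    have "norm (h x \<xi>) = norm (fourier_integral f \<xi>) * (\<bar>f x\<bar> * \<bar>\<gamma> \<xi>\<bar>)" by (simp add: h_def norm_mult)
    also have "\<dots> \<le> 1 / sqrt (2 * pi) * (\<integral>x. \<bar>f x\<bar> \<partial>lborel) * (\<bar>f x\<bar> * \<bar>\<gamma> \<xi>\<bar>)"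
      by (intro mult_right_mono norm_fourier_integral_le f) auto
    finally show "norm (h x \<xi>) \<le> 1 / sqrt (2 * pi) * (\<integral>x. \<bar>f x\<bar> \<partial>lborel) * \<bar>f x\<bar> * \<bar>\<gamma> \<xi>\<bar>"
      by (simp add: mult.assoc)
  qed
  have "complex_of_real (\<integral>\<xi>. \<gamma> \<xi> * (cmod (fourier_integral f \<xi>))\<^sup>2 \<partial>lborel) =
      (\<integral>\<xi>. complex_of_real (\<gamma> \<xi> * (cmod (fourier_integral f \<xi>))\<^sup>2) \<partial>lborel)"
    by (rule integral_complex_of_real[symmetric])
  also have "\<dots> = (\<integral>\<xi>. c * (\<integral>x. h x \<xi> \<partial>lborel) \<partial>lborel)"
  proof (rule Bochner_Integration.integral_cong[OF refl])
    fix \<xi>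
    have "complex_of_real (\<gamma> \<xi> * (cmod (fourier_integral f \<xi>))\<^sup>2) =
        complex_of_real (\<gamma> \<xi>) * cnj (fourier_integral f \<xi>) * fourier_integral f \<xi>"
      by (simp add: complex_norm_square mult_ac del: of_real_power)
    also have "\<dots> = c * (complex_of_real (\<gamma> \<xi>) * cnj (fourier_integral f \<xi>) *
        (\<integral>x. exp (- (\<i> * complex_of_real (x * \<xi>))) * complex_of_real (f x) \<partial>lborel))"
      by (subst (2) fourier_integral_def) (simp add: c_def mult_ac)
    also have "complex_of_real (\<gamma> \<xi>) * cnj (fourier_integral f \<xi>) *
        (\<integral>x. exp (- (\<i> * complex_of_real (x * \<xi>))) * complex_of_real (f x) \<partial>lborel) =
        (\<integral>x. complex_of_real (\<gamma> \<xi>) * cnj (fourier_integral f \<xi>) * (exp (- (\<i> * complex_of_real (x * \<xi>))) * complex_of_real (f x)) \<partial>lborel)"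
      by (rule integral_mult_right_zero[symmetric])
    also have "\<dots> = (\<integral>x. h x \<xi> \<partial>lborel)"
      by (intro Bochner_Integration.integral_cong refl) (simp add: h_def mult_ac)
    finally show "complex_of_real (\<gamma> \<xi> * (cmod (fourier_integral f \<xi>))\<^sup>2) = c * (\<integral>x. h x \<xi> \<partial>lborel)" .
  qed
  also have "\<dots> = c * (\<integral>\<xi>. (\<integral>x. h x \<xi> \<partial>lborel) \<partial>lborel)" by (rule integral_mult_right_zero)
  also have "(\<integral>\<xi>. (\<integral>x. h x \<xi> \<partial>lborel) \<partial>lborel) = (\<integral>x. (\<integral>\<xi>. h x \<xi> \<partial>lborel) \<partial>lborel)"
    by (rule lborel_pair.Fubini_integral[OF hi])
  also have "\<dots> = (\<integral>x. c * complex_of_real (2 * pi) * complex_of_real (f x * (\<integral>y. f y * normal_density 0 \<epsilon> (x - y) \<partial>lborel)) \<partial>lborel)"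
  proof (rule Bochner_Integration.integral_cong[OF refl])
    fix x
    have "(\<integral>\<xi>. h x \<xi> \<partial>lborel) =
      (\<integral>\<xi>. complex_of_real (\<gamma> \<xi>) * exp (- (\<i> * complex_of_real (x * \<xi>))) * cnj (fourier_integral f \<xi>) \<partial>lborel) * complex_of_real (f x)"
      unfolding h_def by (rule integral_mult_left_zero)
    also have "\<dots> = c * complex_of_real (2 * pi * (\<integral>y. f y * normal_density 0 \<epsilon> (x - y) \<partial>lborel)) * complex_of_real (f x)"
      unfolding inner ..
    finally show "(\<integral>\<xi>. h x \<xi> \<partial>lborel) = c * complex_of_real (2 * pi) * complex_of_real (f x * (\<integral>y. f y * normal_density 0 \<epsilon> (x - y) \<partial>lborel))"
      by (simp add: mult_ac)
  qed
  also have "\<dots> = c * complex_of_real (2 * pi) * complex_of_real (\<integral>x. f x * (\<integral>y. f y * normal_density 0 \<epsilon> (x - y) \<partial>lborel) \<partial>lborel)"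
    by (simp only: integral_mult_right_zero integral_complex_of_real)
  also have "c * (c * complex_of_real (2 * pi) * complex_of_real (\<integral>x. f x * (\<integral>y. f y * normal_density 0 \<epsilon> (x - y) \<partial>lborel) \<partial>lborel))
      = complex_of_real (\<integral>x. f x * (\<integral>y. f y * normal_density 0 \<epsilon> (x - y) \<partial>lborel) \<partial>lborel)"
    by (simp only: mult.assoc[symmetric] cc) (simp flip: of_real_mult)
  finally show ?thesis unfolding \<gamma>_def of_real_eq_iff .
qed

lemma nn_integral_normal_density:
  assumes "0 < \<epsilon>"
  shows "(\<integral>\<^sup>+y. ennreal (normal_density 0 \<epsilon> (x - y)) \<partial>lborel) = 1"
    and "(\<integral>\<^sup>+x. ennreal (normal_density 0 \<epsilon> (x - z)) \<partial>lborel) = 1"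
proof -
  have n: "(\<integral>\<^sup>+y. ennreal (normal_density m \<epsilon> y) \<partial>lborel) = 1" for m
    using assms by (subst nn_integral_eq_integral) auto
  have "normal_density 0 \<epsilon> (x - y) = normal_density x \<epsilon> y" for x y
    by (simp add: normal_density_def power2_commute)
  then show "(\<integral>\<^sup>+y. ennreal (normal_density 0 \<epsilon> (x - y)) \<partial>lborel) = 1"
    by (simp only: n)
  have "normal_density 0 \<epsilon> (x - y) = normal_density y \<epsilon> x" for x y
    by (simp add: normal_density_def)
  then show "(\<integral>\<^sup>+x. ennreal (normal_density 0 \<epsilon> (x - z)) \<partial>lborel) = 1"
    by (simp only: n)
qed

lemma nn_integral_gaussian_convolution:
  fixes u :: "real \<Rightarrow> ennreal"
  assumes [measurable]: "u \<in> borel_measurable borel" and \<epsilon>: "0 < \<epsilon>"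
  shows "(\<integral>\<^sup>+x. \<integral>\<^sup>+y. u y * ennreal (normal_density 0 \<epsilon> (x - y)) \<partial>lborel \<partial>lborel) = integral\<^sup>N lborel u"
    and "(\<integral>\<^sup>+x. \<integral>\<^sup>+y. u x * ennreal (normal_density 0 \<epsilon> (x - y)) \<partial>lborel \<partial>lborel) = integral\<^sup>N lborel u"
proof -
  have "(\<integral>\<^sup>+x. \<integral>\<^sup>+y. u y * ennreal (normal_density 0 \<epsilon> (x - y)) \<partial>lborel \<partial>lborel) =
      (\<integral>\<^sup>+y. \<integral>\<^sup>+x. u y * ennreal (normal_density 0 \<epsilon> (x - y)) \<partial>lborel \<partial>lborel)"
    by (rule lborel_pair.Fubini'[symmetric]) measurable
  then show "(\<integral>\<^sup>+x. \<integral>\<^sup>+y. u y * ennreal (normal_density 0 \<epsilon> (x - y)) \<partial>lborel \<partial>lborel) = integral\<^sup>N lborel u"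
    using \<epsilon> by (simp add: nn_integral_cmult nn_integral_normal_density)
  show "(\<integral>\<^sup>+x. \<integral>\<^sup>+y. u x * ennreal (normal_density 0 \<epsilon> (x - y)) \<partial>lborel \<partial>lborel) = integral\<^sup>N lborel u"
    using \<epsilon> by (simp add: nn_integral_cmult nn_integral_normal_density)
qed

text \<open>If \<open>f\<close> is not integrable, the left side is 0 by the default value of the
  integral.\<close>

lemma ennreal_norm_integral_le: "ennreal (norm (integral\<^sup>L M f)) \<le> (\<integral>\<^sup>+x. ennreal (norm (f x)) \<partial>M)"
  by (cases "integrable M f") (auto simp: integral_norm_bound_ennreal not_integrable_integral_eq)

lemma ennreal_abs_gaussian_convolution_le:
  assumes "0 < \<epsilon>"
  shows "ennreal \<bar>\<integral>y. u y * normal_density 0 \<epsilon> (x - y) \<partial>lborel\<bar> \<le>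
    (\<integral>\<^sup>+y. ennreal \<bar>u y\<bar> * ennreal (normal_density 0 \<epsilon> (x - y)) \<partial>lborel)"
  using ennreal_norm_integral_le[of lborel "\<lambda>y. u y * normal_density 0 \<epsilon> (x - y)"] assms
  by (simp add: abs_mult ennreal_mult)

text \<open>Schur's test: the product of \<open>\<bar>f x\<bar>\<close> and
  \<open>\<bar>f y\<bar>\<close> is at most half the sum of the squares, and the density has mass 1
  in either variable. The bound is uniform in \<open>\<epsilon>\<close>.\<close>

lemma gaussian_form_le:
  assumes [measurable]: "f \<in> borel_measurable borel" and \<epsilon>: "0 < \<epsilon>"
  shows "ennreal \<bar>\<integral>x. f x * (\<integral>y. f y * normal_density 0 \<epsilon> (x - y) \<partial>lborel) \<partial>lborel\<bar> \<le>
    (\<integral>\<^sup>+x. ennreal ((f x)\<^sup>2) \<partial>lborel)"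
proof -
  define p where "p x y = ennreal (normal_density 0 \<epsilon> (x - y))" for x y
  have [measurable]: "case_prod p \<in> borel_measurable (borel \<Otimes>\<^sub>M borel)" unfolding p_def by measurable
  define u where "u x = ennreal ((f x)\<^sup>2 / 2)" for x
  have [measurable]: "u \<in> borel_measurable borel" unfolding u_def by measurable
  have "ennreal \<bar>\<integral>x. f x * (\<integral>y. f y * normal_density 0 \<epsilon> (x - y) \<partial>lborel) \<partial>lborel\<bar> \<le>
      (\<integral>\<^sup>+x. ennreal \<bar>f x\<bar> * ennreal \<bar>\<integral>y. f y * normal_density 0 \<epsilon> (x - y) \<partial>lborel\<bar> \<partial>lborel)"
    using ennreal_norm_integral_le[of lborel "\<lambda>x. f x * (\<integral>y. f y * normal_density 0 \<epsilon> (x - y) \<partial>lborel)"]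
    by (simp add: abs_mult ennreal_mult)
  also have "\<dots> \<le> (\<integral>\<^sup>+x. ennreal \<bar>f x\<bar> * (\<integral>\<^sup>+y. ennreal \<bar>f y\<bar> * p x y \<partial>lborel) \<partial>lborel)"
    unfolding p_def by (intro nn_integral_mono mult_left_mono ennreal_abs_gaussian_convolution_le \<epsilon>) simp
  also have "\<dots> = (\<integral>\<^sup>+x. (\<integral>\<^sup>+y. ennreal \<bar>f x\<bar> * (ennreal \<bar>f y\<bar> * p x y) \<partial>lborel) \<partial>lborel)"
    by (intro nn_integral_cong nn_integral_cmult[symmetric]) measurable
  also have "\<dots> \<le> (\<integral>\<^sup>+x. (\<integral>\<^sup>+y. u x * p x y + u y * p x y \<partial>lborel) \<partial>lborel)"
  proof (intro nn_integral_mono)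
    fix x y
    have "\<bar>f x\<bar> * \<bar>f y\<bar> \<le> (f x)\<^sup>2 / 2 + (f y)\<^sup>2 / 2"
      using zero_le_power2[of "\<bar>f x\<bar> - \<bar>f y\<bar>"] by (simp add: power2_diff)
    then have "ennreal \<bar>f x\<bar> * ennreal \<bar>f y\<bar> \<le> u x + u y"
      unfolding u_def by (simp add: ennreal_mult[symmetric] ennreal_plus[symmetric] ennreal_leI del: ennreal_plus)
    then have "ennreal \<bar>f x\<bar> * ennreal \<bar>f y\<bar> * p x y \<le> (u x + u y) * p x y" by (rule mult_right_mono) simp
    then show "ennreal \<bar>f x\<bar> * (ennreal \<bar>f y\<bar> * p x y) \<le> u x * p x y + u y * p x y"
      by (simp add: mult.assoc distrib_right)
  qed
  also have "\<dots> = (\<integral>\<^sup>+x. (\<integral>\<^sup>+y. u x * p x y \<partial>lborel) \<partial>lborel) + (\<integral>\<^sup>+x. (\<integral>\<^sup>+y. u y * p x y \<partial>lborel) \<partial>lborel)"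
    by (simp add: nn_integral_add)
  also have "\<dots> = integral\<^sup>N lborel u + integral\<^sup>N lborel u"
    unfolding p_def by (simp only: nn_integral_gaussian_convolution[OF _ \<epsilon>] \<open>u \<in> borel_measurable borel\<close>)
  also have "\<dots> = (\<integral>\<^sup>+x. u x + u x \<partial>lborel)" by (simp add: nn_integral_add)
  also have "\<dots> = (\<integral>\<^sup>+x. ennreal ((f x)\<^sup>2) \<partial>lborel)"
    by (simp add: u_def ennreal_plus[symmetric] del: ennreal_plus)
  finally show ?thesis .
qed

lemma nn_integral_gaussian_weight_fourier:
  assumes f: "integrable lborel f" and \<epsilon>: "0 < \<epsilon>"
  shows "(\<integral>\<^sup>+\<xi>. ennreal (exp (- (\<epsilon> * \<xi>)\<^sup>2 / 2) * (cmod (fourier_integral f \<xi>))\<^sup>2) \<partial>lborel) =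
    ennreal (\<integral>x. f x * (\<integral>y. f y * normal_density 0 \<epsilon> (x - y) \<partial>lborel) \<partial>lborel)"
proof -
  have [measurable]: "f \<in> borel_measurable borel" using f by (auto dest: borel_measurable_integrable)
  define B where "B = (1 / sqrt (2 * pi) * (\<integral>x. \<bar>f x\<bar> \<partial>lborel))\<^sup>2"
  have "integrable lborel (\<lambda>\<xi>. exp (- (\<epsilon> * \<xi>)\<^sup>2 / 2) * (cmod (fourier_integral f \<xi>))\<^sup>2)"
  proof (rule Bochner_Integration.integrable_bound)
    show "integrable lborel (\<lambda>\<xi>. B * exp (- (\<epsilon> * \<xi>)\<^sup>2 / 2))"
      by (intro integrable_mult_right gaussian_fourier_integral(1) \<epsilon>)
    have "exp (- (\<epsilon> * \<xi>)\<^sup>2 / 2) * (cmod (fourier_integral f \<xi>))\<^sup>2 \<le> exp (- (\<epsilon> * \<xi>)\<^sup>2 / 2) * B" for \<xi>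
      unfolding B_def using norm_fourier_integral_le[OF f] by (intro mult_left_mono power_mono) auto
    then show "AE \<xi> in lborel. norm (exp (- (\<epsilon> * \<xi>)\<^sup>2 / 2) * (cmod (fourier_integral f \<xi>))\<^sup>2) \<le> norm (B * exp (- (\<epsilon> * \<xi>)\<^sup>2 / 2))"
      by (intro AE_I2) (simp add: abs_mult B_def mult.commute)
  qed measurable
  then show ?thesis
    by (subst nn_integral_eq_integral) (auto simp: fourier_integral_gaussian_weight[OF f \<epsilon>, simplified])
qed

text \<open>As the parameter of the Gaussian weight tends to 0 the weight tends to 1 pointwise, so
  Fatou's lemma and the uniform bound on the smoothed form give one half of Plancherel's
  identity.\<close>

lemma plancherel_le:
  assumes f: "integrable lborel f"
  shows "(\<integral>\<^sup>+\<xi>. ennreal ((cmod (fourier_integral f \<xi>))\<^sup>2) \<partial>lborel) \<le> (\<integral>\<^sup>+x. ennreal ((f x)\<^sup>2) \<partial>lborel)"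
proof -
  have fm[measurable]: "f \<in> borel_measurable borel" using f by (auto dest: borel_measurable_integrable)
  define e where "e n = 1 / (real n + 1)" for n
  have e: "0 < e n" for n by (simp add: e_def)
  have e0: "e \<longlonglongrightarrow> 0" unfolding e_def by real_asymp
  have "(\<integral>\<^sup>+\<xi>. ennreal ((cmod (fourier_integral f \<xi>))\<^sup>2) \<partial>lborel) =
      (\<integral>\<^sup>+\<xi>. liminf (\<lambda>n. ennreal (exp (- (e n * \<xi>)\<^sup>2 / 2) * (cmod (fourier_integral f \<xi>))\<^sup>2)) \<partial>lborel)"
  proof (intro nn_integral_cong lim_imp_Liminf[symmetric])
    fix \<xi>
    have "(\<lambda>n. exp (- (e n * \<xi>)\<^sup>2 / 2) * (cmod (fourier_integral f \<xi>))\<^sup>2) \<longlonglongrightarrow> exp (- (0 * \<xi>)\<^sup>2 / 2) * (cmod (fourier_integral f \<xi>))\<^sup>2"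
      by (intro tendsto_intros e0) simp
    then show "(\<lambda>n. ennreal (exp (- (e n * \<xi>)\<^sup>2 / 2) * (cmod (fourier_integral f \<xi>))\<^sup>2)) \<longlonglongrightarrow> ennreal ((cmod (fourier_integral f \<xi>))\<^sup>2)"
      by (intro tendsto_ennrealI) simp
  qed simp
  also have "\<dots> \<le> liminf (\<lambda>n. \<integral>\<^sup>+\<xi>. ennreal (exp (- (e n * \<xi>)\<^sup>2 / 2) * (cmod (fourier_integral f \<xi>))\<^sup>2) \<partial>lborel)"
    by (rule nn_integral_liminf) measurable
  also have "\<dots> \<le> liminf (\<lambda>n. (\<integral>\<^sup>+x. ennreal ((f x)\<^sup>2) \<partial>lborel))"
    unfolding nn_integral_gaussian_weight_fourier[OF f e]
    using gaussian_form_le[OF fm e]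
    by (intro Liminf_mono always_eventually allI) (blast intro: order_trans ennreal_leI abs_ge_self)
  also have "\<dots> = (\<integral>\<^sup>+x. ennreal ((f x)\<^sup>2) \<partial>lborel)" by (simp add: Liminf_const)
  finally show ?thesis .
qed

section \<open>Convergence of the smoothed form\<close>

text \<open>The substitution \<open>y = x - e n * u\<close> moves the scale into the argument of
  \<open>h\<close>; dominated convergence then uses continuity at the single point \<open>x\<close>,
  because the functions it is meant for may jump at two points.\<close>

lemma gaussian_convolution_tendsto:
  fixes h :: "real \<Rightarrow> real"
  assumes [measurable]: "h \<in> borel_measurable borel" and B: "\<And>y. \<bar>h y\<bar> \<le> B" and c: "isCont h x"
  shows "(\<lambda>n. \<integral>y. h y * normal_density 0 (1 / (real n + 1)) (x - y) \<partial>lborel) \<longlonglongrightarrow> h x"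
proof -
  define e where "e n = 1 / (real n + 1)" for n
  have e: "0 < e n" for n by (simp add: e_def)
  have e0: "e \<longlonglongrightarrow> 0" unfolding e_def by real_asymp
  have eq: "(\<integral>y. h y * normal_density 0 (e n) (x - y) \<partial>lborel) = (\<integral>u. h (x - e n * u) * std_normal_density u \<partial>lborel)" for n
  proof -
    have "(\<integral>y. h y * normal_density 0 (e n) (x - y) \<partial>lborel) =
        \<bar>- e n\<bar> *\<^sub>R (\<integral>u. h (x + - e n * u) * normal_density 0 (e n) (x - (x + - e n * u)) \<partial>lborel)"
      by (rule lborel_integral_real_affine) (use e[of n] in simp)
    also have "\<dots> = (\<integral>u. e n * (h (x + - e n * u) * normal_density 0 (e n) (x - (x + - e n * u))) \<partial>lborel)"
      using e[of n] by (simp only: integral_mult_right_zero) simp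
    also have "\<dots> = (\<integral>u. h (x - e n * u) * std_normal_density u \<partial>lborel)"
      using e[of n] by (intro Bochner_Integration.integral_cong refl)
        (simp add: normal_density_def std_normal_density_def power_mult_distrib real_sqrt_mult)
    finally show ?thesis .
  qed
  have "(\<lambda>n. \<integral>u. h (x - e n * u) * std_normal_density u \<partial>lborel) \<longlonglongrightarrow> (\<integral>u. h x * std_normal_density u \<partial>lborel)"
  proof (rule integral_dominated_convergence[where w = "\<lambda>u. B * std_normal_density u"])
    show "AE u in lborel. (\<lambda>n. h (x - e n * u) * std_normal_density u) \<longlonglongrightarrow> h x * std_normal_density u"
    proof (intro AE_I2 tendsto_mult tendsto_const)
      fix u
      have "(\<lambda>n. x - e n * u) \<longlonglongrightarrow> x - 0 * u" by (intro tendsto_intros e0)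
      then show "(\<lambda>n. h (x - e n * u)) \<longlonglongrightarrow> h x" using isCont_tendsto_compose[OF c] by simp
    qed
    show "AE u in lborel. norm (h (x - e n * u) * std_normal_density u) \<le> B * std_normal_density u" for n
      by (intro AE_I2) (auto simp: abs_mult intro!: mult_right_mono B)
  qed auto
  then have "(\<lambda>n. \<integral>y. h y * normal_density 0 (e n) (x - y) \<partial>lborel) \<longlonglongrightarrow> h x" by (simp add: eq)
  then show ?thesis unfolding e_def .
qed

lemma integrable_indicator_Icc: "integrable lborel (indicator {a..b::real} :: real \<Rightarrow> real)"
  by (intro integrable_real_indicator) (auto simp: emeasure_lborel_Icc_eq)

text \<open>A measurable function is almost everywhere a limit of continuous ones. Clamping their
  values to \<open>{-B..B}\<close> and cutting them off outside \<open>{-R..R}\<close> keeps the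
  bounds, and dominated convergence gives closeness in mean. The cut-off may create jumps at
  \<open>-R\<close> and \<open>R\<close>, hence the two exceptional points.\<close>

lemma L1_approx_bounded_continuous:
  fixes f :: "real \<Rightarrow> real"
  assumes fm[measurable]: "f \<in> borel_measurable borel" and B: "\<And>x. \<bar>f x\<bar> \<le> B"
    and R: "\<And>x. x \<notin> {-R..R} \<Longrightarrow> f x = 0" and "0 < \<delta>"
  obtains h where "h \<in> borel_measurable borel" "\<And>x. \<bar>h x\<bar> \<le> B" "\<And>x. x \<notin> {-R, R} \<Longrightarrow> isCont h x"
    "(\<integral>\<^sup>+x. ennreal \<bar>f x - h x\<bar> \<partial>lborel) < ennreal \<delta>"
proof -
  have B0: "0 \<le> B" using B[of 0] by simp
  have "f \<in> borel_measurable lebesgue" using fm by (intro measurable_completion) simp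
  then have "f measurable_on UNIV" by (rule lebesgue_measurable_imp_measurable_on) simp
  then obtain N g where N: "negligible N" and g: "\<And>n. continuous_on UNIV (g n)"
    and gf: "\<And>x. x \<notin> N \<Longrightarrow> (\<lambda>n. g n x) \<longlonglongrightarrow> f x"
    unfolding measurable_on_def by auto
  have "AE x in lebesgue. x \<notin> N"
    using N by (intro AE_not_in) (simp add: negligible_iff_null_sets)
  then have AEN: "AE x in lborel. x \<notin> N" by (simp add: AE_completion_iff)
  define h where "h n x = indicator {-R..R} x * max (- B) (min B (g n x))" for n x
  have [measurable]: "g n \<in> borel_measurable borel" for n by (rule borel_measurable_continuous_onI[OF g])
  have hm[measurable]: "h n \<in> borel_measurable borel" for n unfolding h_def by measurable
  have hB: "\<bar>h n x\<bar> \<le> B" for n x using B0 by (auto simp: h_def split: split_indicator)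
  have hc: "isCont (h n) x" if "x \<notin> {-R, R}" for n x
  proof -
    have gc: "isCont (\<lambda>x. max (- B) (min B (g n x))) x"
      using g[of n] by (intro continuous_intros) (auto simp: continuous_on_eq_continuous_at)
    have "isCont (indicator {-R..R} :: real \<Rightarrow> real) x"
      using that by (subst isCont_indicator) (auto simp: frontier_def interior_atLeastAtMost_real)
    then show ?thesis unfolding h_def by (intro continuous_mult gc)
  qed
  have dom: "norm \<bar>f x - h n x\<bar> \<le> 2 * B * indicator {-R..R} x" for n x
  proof (cases "x \<in> {-R..R}")
    case True
    then show ?thesis using B[of x] hB[of n x] by (simp add: abs_le_iff)
  next
    case False
    then show ?thesis using R[of x] by (simp add: h_def)
  qed
  have "(\<lambda>n. \<integral>x. \<bar>f x - h n x\<bar> \<partial>lborel) \<longlonglongrightarrow> (\<integral>x. 0 \<partial>(lborel :: real measure))"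
  proof (rule integral_dominated_convergence[where w = "\<lambda>x. 2 * B * indicator {-R..R} x"])
    show "AE x in lborel. (\<lambda>n. \<bar>f x - h n x\<bar>) \<longlonglongrightarrow> 0"
      using AEN
    proof eventually_elim
      case (elim x)
      have "(\<lambda>n. indicator {-R..R} x * max (- B) (min B (g n x))) \<longlonglongrightarrow> indicator {-R..R} x * max (- B) (min B (f x))"
        by (intro tendsto_intros gf elim)
      also have "indicator {-R..R} x * max (- B) (min B (f x)) = f x"
        using R[of x] B[of x] by (auto simp: abs_le_iff split: split_indicator)
      finally have "(\<lambda>n. h n x) \<longlonglongrightarrow> f x" by (simp add: h_def)
      then have "(\<lambda>n. \<bar>f x - h n x\<bar>) \<longlonglongrightarrow> \<bar>f x - f x\<bar>" by (intro tendsto_intros)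
      then show ?case by simp
    qed
    show "AE x in lborel. norm \<bar>f x - h n x\<bar> \<le> 2 * B * indicator {-R..R} x" for n
      by (intro AE_I2 dom)
  qed (auto simp: integrable_indicator_Icc)
  then have "eventually (\<lambda>n. (\<integral>x. \<bar>f x - h n x\<bar> \<partial>lborel) < \<delta>) sequentially"
    using \<open>0 < \<delta>\<close> by (intro order_tendstoD(2)) auto
  then obtain n where n: "(\<integral>x. \<bar>f x - h n x\<bar> \<partial>lborel) < \<delta>" by (auto simp: eventually_sequentially)
  have "integrable lborel (\<lambda>x. \<bar>f x - h n x\<bar>)"
  proof (rule Bochner_Integration.integrable_bound)
    show "integrable lborel (\<lambda>x. 2 * B * indicator {-R..R} x)" by (simp add: integrable_indicator_Icc)
    show "AE x in lborel. norm \<bar>f x - h n x\<bar> \<le> norm (2 * B * indicator {-R..R} x)"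
      by (intro AE_I2 order_trans[OF dom]) simp
  qed measurable
  then have "(\<integral>\<^sup>+x. ennreal \<bar>f x - h n x\<bar> \<partial>lborel) < ennreal \<delta>"
    using n by (simp add: nn_integral_eq_integral ennreal_less_iff)
  then show ?thesis using that[of "h n"] hm hB hc by blast
qed

lemma integrable_bounded_support:
  fixes f :: "real \<Rightarrow> real"
  assumes [measurable]: "f \<in> borel_measurable borel" and B: "\<And>x. \<bar>f x\<bar> \<le> B"
    and R: "\<And>x. x \<notin> {-R..R} \<Longrightarrow> f x = 0"
  shows "integrable lborel f"
proof (rule Bochner_Integration.integrable_bound)
  show "integrable lborel (\<lambda>x. B * indicator {-R..R} x)" by (simp add: integrable_indicator_Icc)
  have "norm (f x) \<le> norm (B * indicator {-R..R} x)" for x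
    using B[of x] R[of x] by (cases "x \<in> {-R..R}") auto
  then show "AE x in lborel. norm (f x) \<le> norm (B * indicator {-R..R} x)" by simp
qed simp

lemma gaussian_convolution_bounded:
  fixes u :: "real \<Rightarrow> real"
  assumes B: "\<And>y. \<bar>u y\<bar> \<le> B" and \<epsilon>: "0 < \<epsilon>"
  shows "\<bar>\<integral>y. u y * normal_density 0 \<epsilon> (x - y) \<partial>lborel\<bar> \<le> B"
proof -
  have B0: "0 \<le> B" using B[of 0] by simp
  have "ennreal \<bar>\<integral>y. u y * normal_density 0 \<epsilon> (x - y) \<partial>lborel\<bar> \<le>
      (\<integral>\<^sup>+y. ennreal \<bar>u y\<bar> * ennreal (normal_density 0 \<epsilon> (x - y)) \<partial>lborel)"
    by (rule ennreal_abs_gaussian_convolution_le[OF \<epsilon>])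
  also have "\<dots> \<le> (\<integral>\<^sup>+y. ennreal B * ennreal (normal_density 0 \<epsilon> (x - y)) \<partial>lborel)"
    by (intro nn_integral_mono mult_right_mono ennreal_leI B) simp
  also have "\<dots> = ennreal B"
    using \<epsilon> by (simp add: nn_integral_cmult nn_integral_normal_density)
  finally show ?thesis using B0 by simp
qed

lemma integrable_mult_gaussian_convolution:
  fixes f u :: "real \<Rightarrow> real"
  assumes f: "integrable lborel f" and [measurable]: "u \<in> borel_measurable borel"
    and B: "\<And>y. \<bar>u y\<bar> \<le> B" and \<epsilon>: "0 < \<epsilon>"
  shows "integrable lborel (\<lambda>x. f x * (\<integral>y. u y * normal_density 0 \<epsilon> (x - y) \<partial>lborel))"
proof (rule Bochner_Integration.integrable_bound)
  have [measurable]: "f \<in> borel_measurable borel" using f by (auto dest: borel_measurable_integrable)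
  show "(\<lambda>x. f x * (\<integral>y. u y * normal_density 0 \<epsilon> (x - y) \<partial>lborel)) \<in> borel_measurable lborel" by measurable
  show "integrable lborel (\<lambda>x. B * f x)" using f by simp
  have "0 \<le> B" using B[of 0] by simp
  then show "AE x in lborel. norm (f x * (\<integral>y. u y * normal_density 0 \<epsilon> (x - y) \<partial>lborel)) \<le> norm (B * f x)"
    using gaussian_convolution_bounded[OF B \<epsilon>]
    by (intro AE_I2) (auto simp: abs_mult mult.commute[of B] intro!: mult_left_mono)
qed

text \<open>Smoothing does not increase the L1 norm. Hence an L1-small change of the smoothed factor
  costs at most \<open>B * \<delta>\<close>, at every scale alike.\<close>

lemma gaussian_form_small:
  fixes f u :: "real \<Rightarrow> real"
  assumes B: "\<And>x. \<bar>f x\<bar> \<le> B" and [measurable]: "u \<in> borel_measurable borel"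
    and u: "(\<integral>\<^sup>+y. ennreal \<bar>u y\<bar> \<partial>lborel) \<le> ennreal \<delta>" and \<delta>: "0 \<le> \<delta>" and \<epsilon>: "0 < \<epsilon>"
  shows "\<bar>\<integral>x. f x * (\<integral>y. u y * normal_density 0 \<epsilon> (x - y) \<partial>lborel) \<partial>lborel\<bar> \<le> B * \<delta>"
proof -
  have B0: "0 \<le> B" using B[of 0] by simp
  have "ennreal \<bar>\<integral>x. f x * (\<integral>y. u y * normal_density 0 \<epsilon> (x - y) \<partial>lborel) \<partial>lborel\<bar> \<le>
      (\<integral>\<^sup>+x. ennreal \<bar>f x\<bar> * ennreal \<bar>\<integral>y. u y * normal_density 0 \<epsilon> (x - y) \<partial>lborel\<bar> \<partial>lborel)"
    using ennreal_norm_integral_le[of lborel "\<lambda>x. f x * (\<integral>y. u y * normal_density 0 \<epsilon> (x - y) \<partial>lborel)"]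
    by (simp add: abs_mult ennreal_mult)
  also have "\<dots> \<le> (\<integral>\<^sup>+x. ennreal B * (\<integral>\<^sup>+y. ennreal \<bar>u y\<bar> * ennreal (normal_density 0 \<epsilon> (x - y)) \<partial>lborel) \<partial>lborel)"
    by (intro nn_integral_mono mult_mono ennreal_leI B ennreal_abs_gaussian_convolution_le \<epsilon>) auto
  also have "\<dots> = ennreal B * (\<integral>\<^sup>+x. \<integral>\<^sup>+y. ennreal \<bar>u y\<bar> * ennreal (normal_density 0 \<epsilon> (x - y)) \<partial>lborel \<partial>lborel)"
    by (rule nn_integral_cmult) measurable
  also have "(\<integral>\<^sup>+x. \<integral>\<^sup>+y. ennreal \<bar>u y\<bar> * ennreal (normal_density 0 \<epsilon> (x - y)) \<partial>lborel \<partial>lborel) = (\<integral>\<^sup>+y. ennreal \<bar>u y\<bar> \<partial>lborel)"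
    by (rule nn_integral_gaussian_convolution(1)[OF _ \<epsilon>]) measurable
  also have "ennreal B * (\<integral>\<^sup>+y. ennreal \<bar>u y\<bar> \<partial>lborel) \<le> ennreal B * ennreal \<delta>"
    by (intro mult_left_mono u) auto
  also have "\<dots> = ennreal (B * \<delta>)" using B0 \<delta> by (simp add: ennreal_mult)
  finally show ?thesis using B0 \<delta> by simp
qed

text \<open>The smoothed factor is replaced by a function \<open>h\<close> that is continuous off
  two points. The cost is small uniformly in \<open>n\<close>, the form with \<open>h\<close>
  converges, and exchanging \<open>h\<close> for \<open>f\<close> in the limit costs equally
  little.\<close>

lemma gaussian_form_tendsto:
  fixes f :: "real \<Rightarrow> real"
  assumes fm[measurable]: "f \<in> borel_measurable borel" and B: "\<And>x. \<bar>f x\<bar> \<le> B"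
    and R: "\<And>x. x \<notin> {-R..R} \<Longrightarrow> f x = 0"
  shows "(\<lambda>n. \<integral>x. f x * (\<integral>y. f y * normal_density 0 (1 / (real n + 1)) (x - y) \<partial>lborel) \<partial>lborel)
    \<longlonglongrightarrow> (\<integral>x. (f x)\<^sup>2 \<partial>lborel)"
proof (rule tendstoI)
  fix e :: real assume e: "0 < e"
  have B0: "0 \<le> B" using B[of 0] by simp
  \<comment> \<open>The two exchanges cost \<open>B * \<delta>\<close> each and the convergence
    costs \<open>\<delta>\<close>, which adds up to \<open>e\<close>.\<close>
  define \<delta> where "\<delta> = e / (2 * B + 1)"
  have \<delta>: "0 < \<delta>" using e B0 by (simp add: \<delta>_def)
  have fi: "integrable lborel f" by (rule integrable_bounded_support[OF fm B R])
  obtain h where h[measurable]: "h \<in> borel_measurable borel" and hB: "\<And>x. \<bar>h x\<bar> \<le> B"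
    and hc: "\<And>x. x \<notin> {-R, R} \<Longrightarrow> isCont h x" and hd: "(\<integral>\<^sup>+x. ennreal \<bar>f x - h x\<bar> \<partial>lborel) < ennreal \<delta>"
    by (rule L1_approx_bounded_continuous[of f B R \<delta>, OF fm B _ \<delta>]) (rule R, assumption, (rule that; assumption))
  define \<epsilon> where "\<epsilon> n = 1 / (real n + 1)" for n
  have \<epsilon>: "0 < \<epsilon> n" for n by (simp add: \<epsilon>_def)
  define P where "P u n x = (\<integral>y. u y * normal_density 0 (\<epsilon> n) (x - y) \<partial>lborel)" for u n x
  have [measurable]: "P u n \<in> borel_measurable borel" if [measurable]: "u \<in> borel_measurable borel" for u n
    unfolding P_def by measurable
  have nint: "integrable lborel (\<lambda>y. u y * normal_density 0 (\<epsilon> n) (x - y))"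
    if [measurable]: "u \<in> borel_measurable borel" and uB: "\<And>y. \<bar>u y\<bar> \<le> B" for u n x
  proof (rule Bochner_Integration.integrable_bound)
    have "normal_density 0 (\<epsilon> n) (x - y) = normal_density x (\<epsilon> n) y" for y
      by (simp add: normal_density_def power2_commute)
    then show "integrable lborel (\<lambda>y. B * normal_density 0 (\<epsilon> n) (x - y))" using \<epsilon> by simp
    show "AE y in lborel. norm (u y * normal_density 0 (\<epsilon> n) (x - y)) \<le> norm (B * normal_density 0 (\<epsilon> n) (x - y))"
      using B0 uB by (intro AE_I2) (auto simp: abs_mult intro!: mult_right_mono)
  qed measurable
  have Pdiff: "P f n x - P h n x = P (\<lambda>y. f y - h y) n x" for n x
    unfolding P_def left_diff_distrib
    by (rule Bochner_Integration.integral_diff[symmetric]) (auto intro!: nint fm h B hB)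
  have Pi: "integrable lborel (\<lambda>x. f x * P u n x)" if "u \<in> borel_measurable borel" "\<And>y. \<bar>u y\<bar> \<le> B" for u n
    unfolding P_def by (rule integrable_mult_gaussian_convolution[OF fi that \<epsilon>])
  have A1: "\<bar>(\<integral>x. f x * P f n x \<partial>lborel) - (\<integral>x. f x * P h n x \<partial>lborel)\<bar> \<le> B * \<delta>" for n
  proof -
    have "(\<integral>x. f x * P f n x \<partial>lborel) - (\<integral>x. f x * P h n x \<partial>lborel) = (\<integral>x. f x * P f n x - f x * P h n x \<partial>lborel)"
      by (rule Bochner_Integration.integral_diff[symmetric]) (auto intro!: Pi fm h B hB)
    also have "\<dots> = (\<integral>x. f x * P (\<lambda>y. f y - h y) n x \<partial>lborel)"
      by (simp only: right_diff_distrib[symmetric] Pdiff)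
    finally show ?thesis unfolding P_def
      using gaussian_form_small[of f B "\<lambda>y. f y - h y" \<delta> "\<epsilon> n"] B hd \<delta> \<epsilon>[of n] by simp
  qed
  have A2: "(\<lambda>n. \<integral>x. f x * P h n x \<partial>lborel) \<longlonglongrightarrow> (\<integral>x. f x * h x \<partial>lborel)"
  proof (rule integral_dominated_convergence[where w = "\<lambda>x. B * \<bar>f x\<bar>"])
    have "AE x in lborel. x \<notin> {-R, R}"
      by (intro AE_not_in) (auto intro: finite_imp_null_set_lborel)
    then show "AE x in lborel. (\<lambda>n. f x * P h n x) \<longlonglongrightarrow> f x * h x"
    proof eventually_elim
      case (elim x)
      show ?case unfolding P_def \<epsilon>_def
        by (intro tendsto_mult tendsto_const gaussian_convolution_tendsto[OF h hB hc] elim)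
    qed
    show "AE x in lborel. norm (f x * P h n x) \<le> B * \<bar>f x\<bar>" for n
    proof (intro AE_I2)
      fix x
      have "\<bar>f x\<bar> * \<bar>P h n x\<bar> \<le> \<bar>f x\<bar> * B"
        unfolding P_def by (intro mult_left_mono gaussian_convolution_bounded hB \<epsilon>) simp
      then show "norm (f x * P h n x) \<le> B * \<bar>f x\<bar>" by (simp add: abs_mult mult.commute)
    qed
  qed (use fi h in auto)
  have A3: "\<bar>(\<integral>x. f x * h x \<partial>lborel) - (\<integral>x. (f x)\<^sup>2 \<partial>lborel)\<bar> \<le> B * \<delta>"
  proof -
    have i1: "integrable lborel (\<lambda>x. f x * h x)"
      by (rule Bochner_Integration.integrable_bound[OF integrable_mult_right[OF fi, of B]])
        (use hB B0 in \<open>auto simp: abs_mult mult.commute[of B] intro!: mult_left_mono\<close>)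
    have i2: "integrable lborel (\<lambda>x. (f x)\<^sup>2)"
    proof (rule Bochner_Integration.integrable_bound[OF integrable_mult_right[OF fi, of B]])
      have "norm ((f x)\<^sup>2) \<le> norm (B * f x)" for x
        using mult_right_mono[OF B[of x], of "\<bar>f x\<bar>"] B0 by (simp add: power2_eq_square abs_mult)
      then show "AE x in lborel. norm ((f x)\<^sup>2) \<le> norm (B * f x)" by simp
    qed simp
    have "(\<integral>x. f x * h x \<partial>lborel) - (\<integral>x. (f x)\<^sup>2 \<partial>lborel) = (\<integral>x. f x * h x - (f x)\<^sup>2 \<partial>lborel)"
      by (rule Bochner_Integration.integral_diff[symmetric, OF i1 i2])
    also have "\<dots> = (\<integral>x. f x * (h x - f x) \<partial>lborel)" by (simp add: power2_eq_square right_diff_distrib)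
    finally have eq: "(\<integral>x. f x * h x \<partial>lborel) - (\<integral>x. (f x)\<^sup>2 \<partial>lborel) = (\<integral>x. f x * (h x - f x) \<partial>lborel)" .
    have "ennreal \<bar>\<integral>x. f x * (h x - f x) \<partial>lborel\<bar> \<le> (\<integral>\<^sup>+x. ennreal (norm (f x * (h x - f x))) \<partial>lborel)"
      using ennreal_norm_integral_le[of lborel "\<lambda>x. f x * (h x - f x)"] by simp
    also have "\<dots> \<le> (\<integral>\<^sup>+x. ennreal B * ennreal \<bar>f x - h x\<bar> \<partial>lborel)"
      using B B0 by (intro nn_integral_mono)
        (auto simp: abs_mult ennreal_mult[symmetric] abs_minus_commute[of "h _"] intro!: ennreal_leI mult_right_mono)
    also have "\<dots> = ennreal B * (\<integral>\<^sup>+x. ennreal \<bar>f x - h x\<bar> \<partial>lborel)" by (rule nn_integral_cmult) measurable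
    also have "\<dots> \<le> ennreal B * ennreal \<delta>" using hd by (intro mult_left_mono) auto
    also have "\<dots> = ennreal (B * \<delta>)" using B0 \<delta> by (simp add: ennreal_mult)
    finally show ?thesis using B0 \<delta> by (simp add: eq)
  qed
  have "eventually (\<lambda>n. dist (\<integral>x. f x * P h n x \<partial>lborel) (\<integral>x. f x * h x \<partial>lborel) < \<delta>) sequentially"
    using A2 \<delta> by (rule tendstoD)
  then show "eventually (\<lambda>n. dist (\<integral>x. f x * (\<integral>y. f y * normal_density 0 (1 / (real n + 1)) (x - y) \<partial>lborel) \<partial>lborel)
      (\<integral>x. (f x)\<^sup>2 \<partial>lborel) < e) sequentially"
  proof eventually_elim
    case (elim n)
    have "\<bar>(\<integral>x. f x * P f n x \<partial>lborel) - (\<integral>x. (f x)\<^sup>2 \<partial>lborel)\<bar> < B * \<delta> + \<delta> + B * \<delta>"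
      using A1[of n] A3 elim unfolding dist_real_def by linarith
    also have "B * \<delta> + \<delta> + B * \<delta> = (2 * B + 1) * \<delta>" by (simp add: algebra_simps)
    also have "\<dots> = e" using B0 by (simp add: \<delta>_def)
    finally show ?case unfolding P_def \<epsilon>_def dist_real_def .
  qed
qed

text \<open>One inequality is the Fatou bound. For the other, the Gaussian weight is at most 1, so
  the energy of the transform dominates every smoothed form, and these forms tend to the squared
  norm of \<open>f\<close>.\<close>

lemma plancherel_bounded_support:
  fixes f :: "real \<Rightarrow> real"
  assumes fm[measurable]: "f \<in> borel_measurable borel" and B: "\<And>x. \<bar>f x\<bar> \<le> B"
    and R: "\<And>x. x \<notin> {-R..R} \<Longrightarrow> f x = 0"
  shows "(\<integral>\<^sup>+\<xi>. ennreal ((cmod (fourier_integral f \<xi>))\<^sup>2) \<partial>lborel) = (\<integral>\<^sup>+x. ennreal ((f x)\<^sup>2) \<partial>lborel)"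
proof (rule antisym)
  have fi: "integrable lborel f" by (rule integrable_bounded_support[OF fm B R])
  show "(\<integral>\<^sup>+\<xi>. ennreal ((cmod (fourier_integral f \<xi>))\<^sup>2) \<partial>lborel) \<le> (\<integral>\<^sup>+x. ennreal ((f x)\<^sup>2) \<partial>lborel)"
    by (rule plancherel_le[OF fi])
  have "\<bar>(f x)\<^sup>2\<bar> \<le> B\<^sup>2" for x using power_mono[OF B[of x], of 2] by simp
  then have "integrable lborel (\<lambda>x. (f x)\<^sup>2)"
    by (intro integrable_bounded_support[where B = "B\<^sup>2" and R = R]) (auto simp: R)
  then have "(\<integral>\<^sup>+x. ennreal ((f x)\<^sup>2) \<partial>lborel) = ennreal (\<integral>x. (f x)\<^sup>2 \<partial>lborel)"
    by (simp add: nn_integral_eq_integral)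
  also have "\<dots> \<le> (\<integral>\<^sup>+\<xi>. ennreal ((cmod (fourier_integral f \<xi>))\<^sup>2) \<partial>lborel)"
  proof (rule tendsto_upperbound)
    show "(\<lambda>n. ennreal (\<integral>x. f x * (\<integral>y. f y * normal_density 0 (1 / (real n + 1)) (x - y) \<partial>lborel) \<partial>lborel))
      \<longlonglongrightarrow> ennreal (\<integral>x. (f x)\<^sup>2 \<partial>lborel)"
      by (intro tendsto_ennrealI gaussian_form_tendsto[OF fm B R])
    have "ennreal (\<integral>x. f x * (\<integral>y. f y * normal_density 0 (1 / (real n + 1)) (x - y) \<partial>lborel) \<partial>lborel) \<le>
        (\<integral>\<^sup>+\<xi>. ennreal ((cmod (fourier_integral f \<xi>))\<^sup>2) \<partial>lborel)" for n
    proof -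
      have "0 < 1 / (real n + 1)" by simp
      note nn_integral_gaussian_weight_fourier[OF fi this, symmetric]
      also have "(\<integral>\<^sup>+\<xi>. ennreal (exp (- (1 / (real n + 1) * \<xi>)\<^sup>2 / 2) * (cmod (fourier_integral f \<xi>))\<^sup>2) \<partial>lborel) \<le>
          (\<integral>\<^sup>+\<xi>. ennreal ((cmod (fourier_integral f \<xi>))\<^sup>2) \<partial>lborel)"
        by (intro nn_integral_mono ennreal_leI mult_left_le_one_le) auto
      finally show ?thesis .
    qed
    then show "eventually (\<lambda>n. ennreal (\<integral>x. f x * (\<integral>y. f y * normal_density 0 (1 / (real n + 1)) (x - y) \<partial>lborel) \<partial>lborel) \<le>
        (\<integral>\<^sup>+\<xi>. ennreal ((cmod (fourier_integral f \<xi>))\<^sup>2) \<partial>lborel)) sequentially" by simp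
  qed simp
  finally show "(\<integral>\<^sup>+x. ennreal ((f x)\<^sup>2) \<partial>lborel) \<le> (\<integral>\<^sup>+\<xi>. ennreal ((cmod (fourier_integral f \<xi>))\<^sup>2) \<partial>lborel)" .
qed

section \<open>Plancherel's identity for square-integrable functions\<close>

text \<open>Clamping the values at \<open>m\<close> reduces to bounded functions. The clamped
  functions converge in L2, and so do their transforms because \<open>plancherel_le\<close> applies
  to differences; both squared norms then pass to the limit.\<close>

lemma plancherel_support:
  fixes f :: "real \<Rightarrow> real"
  assumes fm[measurable]: "f \<in> borel_measurable borel" and f2: "integrable lborel (\<lambda>x. (f x)\<^sup>2)"
    and R: "\<And>x. x \<notin> {-R..R} \<Longrightarrow> f x = 0"
  shows "integrable lborel f"
    and "(\<integral>\<^sup>+\<xi>. ennreal ((cmod (fourier_integral f \<xi>))\<^sup>2) \<partial>lborel) = (\<integral>\<^sup>+x. ennreal ((f x)\<^sup>2) \<partial>lborel)"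
proof -
  show fi: "integrable lborel f"
  proof (rule Bochner_Integration.integrable_bound)
    show "integrable lborel (\<lambda>x. (f x)\<^sup>2 + indicator {-R..R} x)" using f2 integrable_indicator_Icc by (rule Bochner_Integration.integrable_add)
    have "\<bar>f x\<bar> \<le> (f x)\<^sup>2 + 1" for x
      using zero_le_power2[of "\<bar>f x\<bar> - 1"] by (simp add: power2_diff)
    then show "AE x in lborel. norm (f x) \<le> norm ((f x)\<^sup>2 + indicator {-R..R} x :: real)"
      using R by (intro AE_I2) (auto split: split_indicator)
  qed simp
  define c where "c m x = max (- real m) (min (real m) (f x))" for m x
  have cm[measurable]: "c m \<in> borel_measurable borel" for m unfolding c_def by measurable
  have cB: "\<bar>c m x\<bar> \<le> real m" for m x by (auto simp: c_def)
  have cR: "c m x = 0" if "x \<notin> {-R..R}" for m x using R[OF that] by (simp add: c_def)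
  have ci: "integrable lborel (c m)" for m by (rule integrable_bounded_support[OF cm cB cR])
  have fin: "(\<integral>\<^sup>+x. ennreal ((f x)\<^sup>2) \<partial>lborel) < \<infinity>"
    using f2 by (simp add: nn_integral_eq_integral)
  have dlim: "(\<lambda>m. \<integral>\<^sup>+x. ennreal ((f x - c m x)\<^sup>2) \<partial>lborel) \<longlonglongrightarrow> (\<integral>\<^sup>+x. 0 \<partial>(lborel :: real measure))"
  proof (rule nn_integral_dominated_convergence[where w = "\<lambda>x. ennreal ((f x)\<^sup>2)"])
    show "AE x in lborel. (\<lambda>m. ennreal ((f x - c m x)\<^sup>2)) \<longlonglongrightarrow> 0"
    proof (intro AE_I2 tendsto_eventually)
      fix x
      obtain m0 :: nat where "\<bar>f x\<bar> \<le> real m0" using real_arch_simple by blast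
      then have "\<bar>f x\<bar> \<le> real m" if "m0 \<le> m" for m using that order_trans by fastforce
      then have "c m x = f x" if "m0 \<le> m" for m
        using that by (fastforce simp: c_def abs_le_iff min_def max_def)
      then show "eventually (\<lambda>m. ennreal ((f x - c m x)\<^sup>2) = 0) sequentially"
        unfolding eventually_sequentially by (intro exI[of _ m0]) simp
    qed
    have "\<bar>f x - c m x\<bar> \<le> \<bar>f x\<bar>" for m x by (auto simp: c_def)
    then have "(f x - c m x)\<^sup>2 \<le> (f x)\<^sup>2" for m x by (simp add: abs_le_square_iff)
    then show "AE x in lborel. ennreal ((f x - c m x)\<^sup>2) \<le> ennreal ((f x)\<^sup>2)" for m
      by (intro AE_I2 ennreal_leI)
  qed (use fin in auto)
  then have d0: "(\<lambda>m. \<integral>\<^sup>+x. ennreal ((norm (f x - c m x))\<^sup>2) \<partial>lborel) \<longlonglongrightarrow> 0" by simp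
  have 1: "(\<lambda>m. \<integral>\<^sup>+x. ennreal ((norm (c m x))\<^sup>2) \<partial>lborel) \<longlonglongrightarrow> (\<integral>\<^sup>+x. ennreal ((norm (f x))\<^sup>2) \<partial>lborel)"
    by (rule nn_integral_norm_sq_tendsto[OF _ _ _ d0]) (use fin in auto)
  have 2: "(\<lambda>m. \<integral>\<^sup>+\<xi>. ennreal ((norm (fourier_integral (c m) \<xi>))\<^sup>2) \<partial>lborel) \<longlonglongrightarrow>
      (\<integral>\<^sup>+\<xi>. ennreal ((norm (fourier_integral f \<xi>))\<^sup>2) \<partial>lborel)"
  proof (rule nn_integral_norm_sq_tendsto)
    show "(\<integral>\<^sup>+\<xi>. ennreal ((norm (fourier_integral f \<xi>))\<^sup>2) \<partial>lborel) < \<infinity>"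
      using plancherel_le[OF fi] fin by (rule le_less_trans)
    show "(\<lambda>m. \<integral>\<^sup>+\<xi>. ennreal ((norm (fourier_integral f \<xi> - fourier_integral (c m) \<xi>))\<^sup>2) \<partial>lborel) \<longlonglongrightarrow> 0"
    proof (rule tendsto_sandwich[OF _ _ tendsto_const d0])
      have "(\<integral>\<^sup>+\<xi>. ennreal ((norm (fourier_integral f \<xi> - fourier_integral (c m) \<xi>))\<^sup>2) \<partial>lborel) \<le>
          (\<integral>\<^sup>+x. ennreal ((norm (f x - c m x))\<^sup>2) \<partial>lborel)" for m
        using plancherel_le[OF Bochner_Integration.integrable_diff[OF fi ci[of m]]]
        by (simp add: fourier_integral_diff[OF fi ci])
      then show "eventually (\<lambda>m. (\<integral>\<^sup>+\<xi>. ennreal ((norm (fourier_integral f \<xi> - fourier_integral (c m) \<xi>))\<^sup>2) \<partial>lborel) \<le>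
          (\<integral>\<^sup>+x. ennreal ((norm (f x - c m x))\<^sup>2) \<partial>lborel)) sequentially" by simp
    qed simp
  qed auto
  have "(\<lambda>m. \<integral>\<^sup>+x. ennreal ((norm (c m x))\<^sup>2) \<partial>lborel) \<longlonglongrightarrow>
      (\<integral>\<^sup>+\<xi>. ennreal ((norm (fourier_integral f \<xi>))\<^sup>2) \<partial>lborel)"
    using 2 plancherel_bounded_support[OF cm cB cR] by simp
  with 1 show "(\<integral>\<^sup>+\<xi>. ennreal ((cmod (fourier_integral f \<xi>))\<^sup>2) \<partial>lborel) = (\<integral>\<^sup>+x. ennreal ((f x)\<^sup>2) \<partial>lborel)"
    using LIMSEQ_unique by fastforce
qed

text \<open>Formulated for a difference because the two pairs of transforms are given separately and
  only increments matter. The cut-offs of \<open>f - f'\<close> satisfy Plancherel's identity, and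
  by the definition of the L2 transform their transforms tend to \<open>g - g'\<close> in mean
  square.\<close>

lemma plancherel_diff:
  assumes fg: "L2_fourier_transform f g" and fg': "L2_fourier_transform f' g'"
  shows "(\<integral>\<^sup>+\<xi>. ennreal ((cmod (g \<xi> - g' \<xi>))\<^sup>2) \<partial>lborel) = ennreal (\<integral>x. (f x - f' x)\<^sup>2 \<partial>lborel)"
proof -
  define tr where "tr n u x = indicator {- real n..real n} x * u x" for n and u :: "real \<Rightarrow> real" and x
  have tr_set: "complex_of_real (1 / sqrt (2 * pi)) *
        set_lebesgue_integral lborel {- real n..real n} (\<lambda>x. exp (- (\<i> * complex_of_real (x * \<xi>))) * complex_of_real (u x))
      = fourier_integral (tr n u) \<xi>" for n u \<xi>
    unfolding fourier_integral_def set_lebesgue_integral_def tr_def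
    by (intro arg_cong2[where f = times] Bochner_Integration.integral_cong refl) (auto split: split_indicator)
  from fg have [measurable]: "f \<in> borel_measurable borel" and f2: "integrable lborel (\<lambda>x. (f x)\<^sup>2)"
    and g[measurable]: "g \<in> borel_measurable borel"
    and lim: "(\<lambda>n. \<integral>\<^sup>+\<xi>. ennreal ((cmod (fourier_integral (tr n f) \<xi> - g \<xi>))\<^sup>2) \<partial>lborel) \<longlonglongrightarrow> 0"
    unfolding L2_fourier_transform_def tr_set by auto
  from fg' have [measurable]: "f' \<in> borel_measurable borel" and f2': "integrable lborel (\<lambda>x. (f' x)\<^sup>2)"
    and g'[measurable]: "g' \<in> borel_measurable borel"
    and lim': "(\<lambda>n. \<integral>\<^sup>+\<xi>. ennreal ((cmod (fourier_integral (tr n f') \<xi> - g' \<xi>))\<^sup>2) \<partial>lborel) \<longlonglongrightarrow> 0"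
    unfolding L2_fourier_transform_def tr_set by auto
  define F where "F x = f x - f' x" for x
  define G where "G \<xi> = g \<xi> - g' \<xi>" for \<xi>
  have [measurable]: "F \<in> borel_measurable borel" "G \<in> borel_measurable borel" unfolding F_def G_def by measurable
  have F2: "integrable lborel (\<lambda>x. (F x)\<^sup>2)" unfolding F_def
    by (intro integrable_diff_sq f2 f2') auto
  have trm[measurable]: "tr n u \<in> borel_measurable borel" if [measurable]: "u \<in> borel_measurable borel" for n u
    unfolding tr_def by measurable
  have tr2: "integrable lborel (\<lambda>x. (tr n u x)\<^sup>2)"
    if [measurable]: "u \<in> borel_measurable borel" and "integrable lborel (\<lambda>x. (u x)\<^sup>2)" for n u
    by (rule Bochner_Integration.integrable_bound[OF that(2)]) (auto simp: tr_def power_mult_distrib split: split_indicator)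
  have trR: "tr n u x = 0" if "x \<notin> {- real n..real n}" for n u x using that by (simp add: tr_def)
  have P: "integrable lborel (tr n u)"
      "(\<integral>\<^sup>+\<xi>. ennreal ((cmod (fourier_integral (tr n u) \<xi>))\<^sup>2) \<partial>lborel) = (\<integral>\<^sup>+x. ennreal ((tr n u x)\<^sup>2) \<partial>lborel)"
    if "u \<in> borel_measurable borel" "integrable lborel (\<lambda>x. (u x)\<^sup>2)" for n u
    using plancherel_support[OF trm[OF that(1)] tr2[OF that] trR] by auto
  have trF: "fourier_integral (tr n F) \<xi> = fourier_integral (tr n f) \<xi> - fourier_integral (tr n f') \<xi>" for n \<xi>
    by (subst fourier_integral_diff[symmetric]) (auto simp: tr_def[abs_def] F_def right_diff_distrib P(1)[unfolded tr_def[abs_def]] f2 f2')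
  have limG: "(\<lambda>n. \<integral>\<^sup>+\<xi>. ennreal ((norm (G \<xi> - fourier_integral (tr n F) \<xi>))\<^sup>2) \<partial>lborel) \<longlonglongrightarrow> 0"
  proof (rule tendsto_sandwich[OF _ _ tendsto_const])
    let ?a = "\<lambda>n. \<integral>\<^sup>+\<xi>. ennreal ((cmod (fourier_integral (tr n f) \<xi> - g \<xi>))\<^sup>2) \<partial>lborel"
    let ?b = "\<lambda>n. \<integral>\<^sup>+\<xi>. ennreal ((cmod (fourier_integral (tr n f') \<xi> - g' \<xi>))\<^sup>2) \<partial>lborel"
    have "(\<lambda>n. ennreal (1 + 1) * ?a n + ennreal (1 + 1 / 1) * ?b n) \<longlonglongrightarrow> ennreal (1 + 1) * 0 + ennreal (1 + 1 / 1) * 0"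
      by (intro tendsto_add ennreal_tendsto_cmult lim lim') auto
    then show "(\<lambda>n. ennreal (1 + 1) * ?a n + ennreal (1 + 1 / 1) * ?b n) \<longlonglongrightarrow> 0" by simp
    have "(\<integral>\<^sup>+\<xi>. ennreal ((norm (G \<xi> - fourier_integral (tr n F) \<xi>))\<^sup>2) \<partial>lborel) \<le> ennreal (1 + 1) * ?a n + ennreal (1 + 1 / 1) * ?b n" for n
    proof -
      have "G \<xi> - fourier_integral (tr n F) \<xi> = (g \<xi> - fourier_integral (tr n f) \<xi>) + (fourier_integral (tr n f') \<xi> - g' \<xi>)" for \<xi>
        by (simp add: G_def trF)
      then show ?thesis
        using nn_integral_norm_sq_add_le[of "\<lambda>\<xi>. g \<xi> - fourier_integral (tr n f) \<xi>" lborel "\<lambda>\<xi>. fourier_integral (tr n f') \<xi> - g' \<xi>" 1]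
        by (simp add: norm_minus_commute[of "g _"])
    qed
    then show "eventually (\<lambda>n. (\<integral>\<^sup>+\<xi>. ennreal ((norm (G \<xi> - fourier_integral (tr n F) \<xi>))\<^sup>2) \<partial>lborel)
      \<le> ennreal (1 + 1) * ?a n + ennreal (1 + 1 / 1) * ?b n) sequentially" by simp
  qed simp
  have trle: "(\<integral>\<^sup>+x. ennreal ((tr n F x)\<^sup>2) \<partial>lborel) < \<infinity>" for n
    using tr2[OF _ F2] by (simp add: nn_integral_eq_integral)
  \<comment> \<open>Square integrability of \<open>G\<close> is not part of the definition of the
    transform. It follows because \<open>G\<close> lies at finite distance from the transform of
    some cut-off, which has finite norm.\<close>
  have finG: "(\<integral>\<^sup>+\<xi>. ennreal ((norm (G \<xi>))\<^sup>2) \<partial>lborel) < \<infinity>"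
  proof -
    obtain n where n: "(\<integral>\<^sup>+\<xi>. ennreal ((norm (G \<xi> - fourier_integral (tr n F) \<xi>))\<^sup>2) \<partial>lborel) < 1"
      using order_tendstoD(2)[OF limG, of 1] by (auto simp: eventually_sequentially)
    have "(\<integral>\<^sup>+\<xi>. ennreal ((norm (G \<xi>))\<^sup>2) \<partial>lborel) \<le>
      ennreal (1 + 1) * (\<integral>\<^sup>+\<xi>. ennreal ((norm (G \<xi> - fourier_integral (tr n F) \<xi>))\<^sup>2) \<partial>lborel) +
      ennreal (1 + 1 / 1) * (\<integral>\<^sup>+\<xi>. ennreal ((norm (fourier_integral (tr n F) \<xi>))\<^sup>2) \<partial>lborel)"
      using nn_integral_norm_sq_add_le[of "\<lambda>\<xi>. G \<xi> - fourier_integral (tr n F) \<xi>" lborel "fourier_integral (tr n F)" 1] by simp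
    also have "\<dots> < \<infinity>"
    proof -
      have "(\<integral>\<^sup>+\<xi>. ennreal ((norm (G \<xi> - fourier_integral (tr n F) \<xi>))\<^sup>2) \<partial>lborel) < \<infinity>"
        using n by (rule less_trans) simp
      moreover have "(\<integral>\<^sup>+\<xi>. ennreal ((norm (fourier_integral (tr n F) \<xi>))\<^sup>2) \<partial>lborel) < \<infinity>"
        using trle[of n] P(2)[OF _ F2, of n] by simp
      ultimately show ?thesis by (simp add: ennreal_mult_less_top)
    qed
    finally show ?thesis .
  qed
  have 1: "(\<lambda>n. \<integral>\<^sup>+\<xi>. ennreal ((norm (fourier_integral (tr n F) \<xi>))\<^sup>2) \<partial>lborel) \<longlonglongrightarrow> (\<integral>\<^sup>+\<xi>. ennreal ((norm (G \<xi>))\<^sup>2) \<partial>lborel)"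
    by (rule nn_integral_norm_sq_tendsto[OF _ _ finG limG]) auto
  have 2: "(\<lambda>n. \<integral>\<^sup>+x. ennreal ((tr n F x)\<^sup>2) \<partial>lborel) \<longlonglongrightarrow> (\<integral>\<^sup>+x. ennreal ((F x)\<^sup>2) \<partial>lborel)"
  proof (rule nn_integral_dominated_convergence[where w = "\<lambda>x. ennreal ((F x)\<^sup>2)"])
    show "AE x in lborel. (\<lambda>n. ennreal ((tr n F x)\<^sup>2)) \<longlonglongrightarrow> ennreal ((F x)\<^sup>2)"
    proof (intro AE_I2 tendsto_eventually)
      fix x
      obtain m0 :: nat where "\<bar>x\<bar> \<le> real m0" using real_arch_simple by blast
      then have "tr m F x = F x" if "m0 \<le> m" for m
        using that by (auto simp: tr_def abs_le_iff split: split_indicator)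
      then show "eventually (\<lambda>m. ennreal ((tr m F x)\<^sup>2) = ennreal ((F x)\<^sup>2)) sequentially"
        unfolding eventually_sequentially by (intro exI[of _ m0]) simp
    qed
    show "AE x in lborel. ennreal ((tr n F x)\<^sup>2) \<le> ennreal ((F x)\<^sup>2)" for n
      by (intro AE_I2 ennreal_leI) (auto simp: tr_def split: split_indicator)
    show "(\<integral>\<^sup>+x. ennreal ((F x)\<^sup>2) \<partial>lborel) < \<infinity>" using F2 by (simp add: nn_integral_eq_integral)
  qed auto
  have "(\<lambda>n. \<integral>\<^sup>+x. ennreal ((tr n F x)\<^sup>2) \<partial>lborel) \<longlonglongrightarrow> (\<integral>\<^sup>+\<xi>. ennreal ((norm (G \<xi>))\<^sup>2) \<partial>lborel)"
    using 1 P(2)[OF _ F2] by simp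
  then have "(\<integral>\<^sup>+\<xi>. ennreal ((norm (G \<xi>))\<^sup>2) \<partial>lborel) = (\<integral>\<^sup>+x. ennreal ((F x)\<^sup>2) \<partial>lborel)"
    using 2 by (rule LIMSEQ_unique)
  also have "\<dots> = ennreal (\<integral>x. (F x)\<^sup>2 \<partial>lborel)" using F2 by (simp add: nn_integral_eq_integral)
  finally show ?thesis by (simp add: F_def G_def)
qed

section \<open>The kernel of multifractional Brownian motion\<close>

text \<open>The exponent is a parameter \<open>p\<close> separate from the time \<open>t\<close>: an
  increment of the process changes both, and the two changes are estimated separately.\<close>

definition mbm_kernel :: "real \<Rightarrow> real \<Rightarrow> real \<Rightarrow> complex" where
  "mbm_kernel p t \<xi> = (exp (\<i> * complex_of_real (t * \<xi>)) - 1) / complex_of_real (\<bar>\<xi>\<bar> powr (p + 1 / 2))"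

lemma mbm_kernel_measurable [measurable]: "mbm_kernel p t \<in> borel_measurable borel"
  unfolding mbm_kernel_def by measurable

lemma cmod_exp_diff_sq:
  "(cmod (exp (\<i> * complex_of_real a) - exp (\<i> * complex_of_real b)))\<^sup>2 = 2 - 2 * cos (a - b)"
proof -
  have "(cmod (cis a - cis b))\<^sup>2 = (cos a - cos b)\<^sup>2 + (sin a - sin b)\<^sup>2"
    by (simp add: cmod_power2)
  also have "\<dots> = ((cos a)\<^sup>2 + (sin a)\<^sup>2) + ((cos b)\<^sup>2 + (sin b)\<^sup>2) - 2 * (cos a * cos b + sin a * sin b)"
    by (simp add: power2_diff algebra_simps)
  finally show ?thesis by (simp add: cis_conv_exp cos_diff)
qed

lemma two_minus_two_cos_le: "2 - 2 * cos x \<le> min 4 (x\<^sup>2)" for x :: real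
proof -
  have "cos x = 1 - 2 * (sin (x / 2))\<^sup>2" using cos_double_sin[of "x / 2"] by simp
  moreover have "(sin (x / 2))\<^sup>2 \<le> (x / 2)\<^sup>2"
    using abs_sin_x_le_abs_x[of "x / 2"] by (simp add: abs_le_square_iff[symmetric])
  moreover have "- 1 \<le> cos x" by simp
  ultimately show ?thesis by (simp add: power_divide)
qed

lemma cmod_exp_diff_sq_le:
  "(cmod (exp (\<i> * complex_of_real (a * \<xi>)) - exp (\<i> * complex_of_real (b * \<xi>))))\<^sup>2 \<le> min 4 ((a - b)\<^sup>2 * \<xi>\<^sup>2)"
  using two_minus_two_cos_le[of "a * \<xi> - b * \<xi>"] unfolding cmod_exp_diff_sq
  by (simp add: left_diff_distrib[symmetric] power_mult_distrib)

lemma ennreal_mult_plus_mult: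
  "0 \<le> a \<Longrightarrow> 0 \<le> b \<Longrightarrow> 0 \<le> c \<Longrightarrow> 0 \<le> d \<Longrightarrow>
    ennreal a * ennreal b + ennreal c * ennreal d = ennreal (a * b + c * d)"
  by (simp add: ennreal_mult)

text \<open>The integral is split at frequency \<open>1 / h\<close>. Below it the quadratic bound is
  used, integrable at 0 because \<open>q < 1\<close>; above it the constant 4, integrable at
  infinity because \<open>0 < q\<close>. Both parts scale like
  \<open>h powr (2 * q)\<close>.\<close>

lemma kernel_tail_integral:
  fixes h q :: real
  assumes h: "0 \<le> h" and q: "0 < q" "q < 1"
  shows "(\<integral>\<^sup>+\<xi>. ennreal (min 4 (h\<^sup>2 * \<xi>\<^sup>2) * \<bar>\<xi>\<bar> powr (- 2 * q - 1)) \<partial>lborel) \<le>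
    ennreal ((1 / (1 - q) + 4 / q) * h powr (2 * q))"
proof (cases "h = 0")
  case True
  then show ?thesis by simp
next
  case False
  with h have h: "0 < h" by simp
  define g where "g y = ennreal (h\<^sup>2) * (ennreal (y powr (1 - 2 * q)) * indicator {0..1 / h} y) +
      ennreal 4 * (ennreal (y powr (- 2 * q - 1)) * indicator {1 / h..} y)" for y
  have [measurable]: "g \<in> borel_measurable borel" unfolding g_def by measurable
  have I1: "(\<integral>\<^sup>+y. ennreal (y powr (1 - 2 * q)) * indicator {0..1 / h} y \<partial>lborel) =
      ennreal ((1 / h) powr (2 - 2 * q) / (2 - 2 * q))"
  proof -
    have "((\<lambda>y. y powr (1 - 2 * q)) has_integral ((1 / h) powr (1 - 2 * q + 1) / (1 - 2 * q + 1))) {0..1 / h}"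
      using h q by (intro has_integral_powr_from_0) auto
    from nn_integral_has_integral_lebesgue'[OF _ this] show ?thesis by simp
  qed
  have I2: "(\<integral>\<^sup>+y. ennreal (y powr (- 2 * q - 1)) * indicator {1 / h..} y \<partial>lborel) =
      ennreal ((1 / h) powr (- 2 * q) / (2 * q))"
  proof -
    have "((\<lambda>y. y powr (- 2 * q - 1)) has_integral (- ((1 / h) powr (- 2 * q - 1 + 1)) / (- 2 * q - 1 + 1))) {1 / h..}"
      using h q by (intro has_integral_powr_to_inf) auto
    from nn_integral_has_integral_lebesgue'[OF _ this] show ?thesis by simp
  qed
  have g: "integral\<^sup>N lborel g = ennreal (h powr (2 * q) * (1 / (2 - 2 * q) + 2 / q))"
  proof -
    have "integral\<^sup>N lborel g = ennreal (h\<^sup>2) * (\<integral>\<^sup>+y. ennreal (y powr (1 - 2 * q)) * indicator {0..1 / h} y \<partial>lborel) +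
        ennreal 4 * (\<integral>\<^sup>+y. ennreal (y powr (- 2 * q - 1)) * indicator {1 / h..} y \<partial>lborel)"
      unfolding g_def by (subst nn_integral_add) (auto simp: nn_integral_cmult)
    also have "\<dots> = ennreal (h\<^sup>2) * ennreal ((1 / h) powr (2 - 2 * q) / (2 - 2 * q)) +
        ennreal 4 * ennreal ((1 / h) powr (- 2 * q) / (2 * q))"
      unfolding I1 I2 ..
    also have "\<dots> = ennreal (h\<^sup>2 * ((1 / h) powr (2 - 2 * q) / (2 - 2 * q)) + 4 * ((1 / h) powr (- 2 * q) / (2 * q)))"
      using q by (intro ennreal_mult_plus_mult) auto
    also have "h\<^sup>2 * ((1 / h) powr (2 - 2 * q) / (2 - 2 * q)) + 4 * ((1 / h) powr (- 2 * q) / (2 * q)) =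
        h powr (2 * q) * (1 / (2 - 2 * q) + 2 / q)"
    proof -
      have "(1 / h) powr (- 2 * q) = h powr (2 * q)" using h by (simp add: powr_divide powr_minus)
      moreover have "h\<^sup>2 * (1 / h) powr (2 - 2 * q) = h powr (2 * q)"
      proof -
        have "(1 / h) powr (2 - 2 * q) = h powr (2 * q - 2)"
          using h by (simp add: powr_divide powr_minus_divide[symmetric])
        then have "h\<^sup>2 * (1 / h) powr (2 - 2 * q) = h powr 2 * h powr (2 * q - 2)" using h by simp
        then show ?thesis by (simp only: powr_add[symmetric]) simp
      qed
      ultimately show ?thesis using q by (simp add: distrib_left)
    qed
    finally show ?thesis .
  qed
  have "(\<integral>\<^sup>+\<xi>. ennreal (min 4 (h\<^sup>2 * \<xi>\<^sup>2) * \<bar>\<xi>\<bar> powr (- 2 * q - 1)) \<partial>lborel) \<le> (\<integral>\<^sup>+\<xi>. g \<xi> + g (- \<xi>) \<partial>lborel)"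
  proof (rule nn_integral_mono)
    fix \<xi> :: real
    have pos: "ennreal (min 4 (h\<^sup>2 * y\<^sup>2) * y powr (- 2 * q - 1)) \<le> g y" if y: "0 \<le> y" for y
    proof (cases "y \<le> 1 / h")
      case True
      have "min 4 (h\<^sup>2 * y\<^sup>2) * y powr (- 2 * q - 1) \<le> h\<^sup>2 * y\<^sup>2 * y powr (- 2 * q - 1)"
        by (intro mult_right_mono) auto
      also have "\<dots> = h\<^sup>2 * y powr (1 - 2 * q)"
      proof (cases "y = 0")
        case False
        then have "y\<^sup>2 = y powr 2" using y by simp
        then have "y\<^sup>2 * y powr (- 2 * q - 1) = y powr (1 - 2 * q)" by (simp only: powr_add[symmetric]) simp
        then show ?thesis by (simp add: mult.assoc)
      qed simp
      finally have "ennreal (min 4 (h\<^sup>2 * y\<^sup>2) * y powr (- 2 * q - 1)) \<le> ennreal (h\<^sup>2) * ennreal (y powr (1 - 2 * q))"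
        by (subst ennreal_mult[symmetric]) (auto intro: ennreal_leI)
      then show ?thesis unfolding g_def using True y by (intro add_increasing2) auto
    next
      case False
      have "min 4 (h\<^sup>2 * y\<^sup>2) * y powr (- 2 * q - 1) \<le> 4 * y powr (- 2 * q - 1)"
        by (intro mult_right_mono) auto
      then have "ennreal (min 4 (h\<^sup>2 * y\<^sup>2) * y powr (- 2 * q - 1)) \<le> ennreal 4 * ennreal (y powr (- 2 * q - 1))"
        by (subst ennreal_mult[symmetric]) (auto intro: ennreal_leI)
      then show ?thesis unfolding g_def using False y by (intro add_increasing) auto
    qed
    show "ennreal (min 4 (h\<^sup>2 * \<xi>\<^sup>2) * \<bar>\<xi>\<bar> powr (- 2 * q - 1)) \<le> g \<xi> + g (- \<xi>)"
    proof (cases "0 \<le> \<xi>")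
      case True
      then show ?thesis using pos[of \<xi>] by (simp add: add_increasing2)
    next
      case False
      then show ?thesis using pos[of "- \<xi>"] by (simp add: add_increasing)
    qed
  qed
  also have "\<dots> = integral\<^sup>N lborel g + (\<integral>\<^sup>+\<xi>. g (- \<xi>) \<partial>lborel)"
    by (intro nn_integral_add) auto
  also have "(\<integral>\<^sup>+\<xi>. g (- \<xi>) \<partial>lborel) = integral\<^sup>N lborel g"
    using nn_integral_real_affine[of g "-1" 0] by simp
  also have "integral\<^sup>N lborel g + integral\<^sup>N lborel g =
      ennreal (h powr (2 * q) * (1 / (2 - 2 * q) + 2 / q) + h powr (2 * q) * (1 / (2 - 2 * q) + 2 / q))"
    using q by (simp add: g ennreal_plus[symmetric] del: ennreal_plus)
  also have "h powr (2 * q) * (1 / (2 - 2 * q) + 2 / q) + h powr (2 * q) * (1 / (2 - 2 * q) + 2 / q) =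
      (1 / (1 - q) + 4 / q) * h powr (2 * q)"
  proof -
    define X where "X = 1 / (1 - q)"
    have e: "1 / (2 - 2 * q) = X / 2" using q by (simp add: X_def divide_simps)
    show ?thesis unfolding e X_def[symmetric] by (simp add: algebra_simps)
  qed
  finally show ?thesis .
qed

lemma abs_exp_diff_le: "\<bar>exp a - exp b\<bar> \<le> \<bar>a - b\<bar> * exp (max a b)" for a b :: real
proof -
  have *: "exp a - exp b \<le> (a - b) * exp a" for a b :: real
  proof -
    have "exp a * (1 + (b - a)) \<le> exp a * exp (b - a)"
      by (intro mult_left_mono exp_ge_add_one_self) simp
    also have "\<dots> = exp b" by (simp add: exp_add[symmetric])
    finally show ?thesis by (simp add: algebra_simps)
  qed
  show ?thesis
  proof (cases "b \<le> a")
    case True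
    then show ?thesis using *[of a b] by (simp add: max_def)
  next
    case False
    then show ?thesis using *[of b a] by (simp add: max_def)
  qed
qed

text \<open>Varying the exponent brings out a logarithm of \<open>y\<close>, which is absorbed by a
  power with the small exponent \<open>\<epsilon>\<close>. For \<open>y \<ge> 1\<close> the smallest
  exponent \<open>m\<close> gives the largest power, for \<open>y < 1\<close> the largest exponent
  \<open>M\<close> does; the sum of both powers spares the distinction later.\<close>

lemma powr_exponent_diff_le:
  fixes y :: real
  assumes y: "0 < y" and pr: "p \<in> {m..M}" "r \<in> {m..M}" and \<epsilon>: "0 < \<epsilon>"
  shows "\<bar>y powr (- p) - y powr (- r)\<bar> \<le> \<bar>p - r\<bar> / \<epsilon> * (y powr (- (M + \<epsilon>)) + y powr (- (m - \<epsilon>)))"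
proof -
  have 1: "\<bar>y powr (- p) - y powr (- r)\<bar> \<le> \<bar>p - r\<bar> * \<bar>ln y\<bar> * exp (max (- p * ln y) (- r * ln y))"
    using abs_exp_diff_le[of "- p * ln y" "- r * ln y"] y
    by (simp add: powr_def left_diff_distrib[symmetric] abs_mult abs_minus_commute)
  have lnle: "ln z \<le> z powr \<epsilon> / \<epsilon>" if "0 < z" for z
  proof -
    have "\<epsilon> * ln z \<le> z powr \<epsilon> - 1" using ln_le_minus_one[of "z powr \<epsilon>"] that by (simp add: ln_powr)
    then have "\<epsilon> * ln z \<le> z powr \<epsilon>" by simp
    then show ?thesis using \<epsilon> by (simp add: field_simps)
  qed
  have 2: "\<bar>ln y\<bar> * exp (max (- p * ln y) (- r * ln y)) \<le> (y powr (- (M + \<epsilon>)) + y powr (- (m - \<epsilon>))) / \<epsilon>"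
  proof (cases "1 \<le> y")
    case True
    then have "\<bar>ln y\<bar> \<le> y powr \<epsilon> / \<epsilon>" using lnle[of y] y by simp
    moreover have "max (- p * ln y) (- r * ln y) \<le> - m * ln y"
      using True pr by (auto intro!: mult_right_mono)
    then have "exp (max (- p * ln y) (- r * ln y)) \<le> y powr (- m)" using y by (simp add: powr_def)
    ultimately have "\<bar>ln y\<bar> * exp (max (- p * ln y) (- r * ln y)) \<le> y powr \<epsilon> / \<epsilon> * y powr (- m)"
      by (intro mult_mono) auto
    also have "\<dots> = y powr (- (m - \<epsilon>)) / \<epsilon>" by (simp add: powr_add[symmetric])
    also have "\<dots> \<le> (y powr (- (M + \<epsilon>)) + y powr (- (m - \<epsilon>))) / \<epsilon>"
      using \<epsilon> by (intro divide_right_mono) auto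
    finally show ?thesis .
  next
    case False
    then have "ln y \<le> 0" using y by simp
    then have "\<bar>ln y\<bar> = ln (1 / y)" using y by (simp add: ln_div)
    also have "\<dots> \<le> (1 / y) powr \<epsilon> / \<epsilon>" using lnle[of "1 / y"] y by simp
    also have "(1 / y) powr \<epsilon> = y powr (- \<epsilon>)" using y by (simp add: powr_divide powr_minus_divide)
    finally have "\<bar>ln y\<bar> \<le> y powr (- \<epsilon>) / \<epsilon>" .
    moreover have "max (- p * ln y) (- r * ln y) \<le> - M * ln y"
      using \<open>ln y \<le> 0\<close> pr by (auto intro!: mult_right_mono_neg)
    then have "exp (max (- p * ln y) (- r * ln y)) \<le> y powr (- M)" using y by (simp add: powr_def)
    ultimately have "\<bar>ln y\<bar> * exp (max (- p * ln y) (- r * ln y)) \<le> y powr (- \<epsilon>) / \<epsilon> * y powr (- M)"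
      by (intro mult_mono) auto
    also have "\<dots> = y powr (- \<epsilon> + - M) / \<epsilon>" unfolding powr_add by simp
    also have "- \<epsilon> + - M = - (M + \<epsilon>)" by simp
    also have "y powr (- (M + \<epsilon>)) / \<epsilon> \<le> (y powr (- (M + \<epsilon>)) + y powr (- (m - \<epsilon>))) / \<epsilon>"
      using \<epsilon> by (intro divide_right_mono) auto
    finally show ?thesis .
  qed
  have "\<bar>p - r\<bar> * (\<bar>ln y\<bar> * exp (max (- p * ln y) (- r * ln y))) \<le>
      \<bar>p - r\<bar> * ((y powr (- (M + \<epsilon>)) + y powr (- (m - \<epsilon>))) / \<epsilon>)"
    by (intro mult_left_mono 2) simp
  with 1 show ?thesis by (simp add: mult.assoc)
qed

text \<open>The kernel with exponent \<open>p\<close> at time \<open>s\<close> is inserted, so that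
  the first summand changes the time alone and the second the exponent alone.\<close>

lemma mbm_kernel_diff:
  assumes "\<xi> \<noteq> 0"
  shows "mbm_kernel p t \<xi> - mbm_kernel r s \<xi> =
    (exp (\<i> * complex_of_real (t * \<xi>)) - exp (\<i> * complex_of_real (s * \<xi>))) * complex_of_real (\<bar>\<xi>\<bar> powr (- p - 1 / 2)) +
    (exp (\<i> * complex_of_real (s * \<xi>)) - 1) * complex_of_real (\<bar>\<xi>\<bar> powr (- p - 1 / 2) - \<bar>\<xi>\<bar> powr (- r - 1 / 2))"
proof -
  have K: "mbm_kernel q u \<xi> = (exp (\<i> * complex_of_real (u * \<xi>)) - 1) * complex_of_real (\<bar>\<xi>\<bar> powr (- q - 1 / 2))" for q u
  proof -
    have "- q - 1 / 2 = - (q + 1 / 2)" by simp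
    then have "\<bar>\<xi>\<bar> powr (- q - 1 / 2) = inverse (\<bar>\<xi>\<bar> powr (q + 1 / 2))"
      by (simp only: powr_minus)
    then show ?thesis by (simp only: mbm_kernel_def divide_inverse of_real_inverse)
  qed
  have "(E - 1) * a - (E' - 1) * b = (E - E') * a + (E' - 1) * (a - b)" for E E' a b :: complex
    by (simp add: algebra_simps)
  then show ?thesis unfolding K of_real_diff .
qed

text \<open>The square of a sum is at most twice the sum of the squares. This is used once for the
  two kinds of change and once for the two powers that bound the change of exponent, hence the
  factors 2 and 4. All three terms have the form integrated in
  \<open>kernel_tail_integral\<close>.\<close>

lemma mbm_kernel_diff_le:
  assumes \<xi>: "\<xi> \<noteq> 0" and st: "0 \<le> s" "s \<le> T"
    and pr: "p \<in> {m..M}" "r \<in> {m..M}" and \<epsilon>: "0 < \<epsilon>"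
  shows "(cmod (mbm_kernel p t \<xi> - mbm_kernel r s \<xi>))\<^sup>2 \<le>
    2 * (min 4 ((t - s)\<^sup>2 * \<xi>\<^sup>2) * \<bar>\<xi>\<bar> powr (- 2 * p - 1)) +
    4 * ((p - r)\<^sup>2 / \<epsilon>\<^sup>2) * (min 4 (T\<^sup>2 * \<xi>\<^sup>2) * \<bar>\<xi>\<bar> powr (- 2 * (M + \<epsilon>) - 1) +
      min 4 (T\<^sup>2 * \<xi>\<^sup>2) * \<bar>\<xi>\<bar> powr (- 2 * (m - \<epsilon>) - 1))"
proof -
  define y where "y = \<bar>\<xi>\<bar>"
  have y: "0 < y" using \<xi> by (simp add: y_def)
  define A where "A = exp (\<i> * complex_of_real (t * \<xi>)) - exp (\<i> * complex_of_real (s * \<xi>))"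
  define B where "B = exp (\<i> * complex_of_real (s * \<xi>)) - 1"
  define a where "a = y powr (- p - 1 / 2)"
  define b where "b = y powr (- p - 1 / 2) - y powr (- r - 1 / 2)"
  have sq: "(u + v)\<^sup>2 \<le> 2 * u\<^sup>2 + 2 * v\<^sup>2" for u v :: real
    using zero_le_power2[of "u - v"] by (simp add: power2_sum power2_diff)
  have pw: "(y powr z)\<^sup>2 = y powr (2 * z)" for z
    using y by (simp add: power2_eq_square powr_add[symmetric])
  have A: "(cmod A)\<^sup>2 \<le> min 4 ((t - s)\<^sup>2 * \<xi>\<^sup>2)" unfolding A_def by (rule cmod_exp_diff_sq_le)
  have "B = exp (\<i> * complex_of_real (s * \<xi>)) - exp (\<i> * complex_of_real (0 * \<xi>))" by (simp add: B_def)
  then have "(cmod B)\<^sup>2 \<le> min 4 ((s - 0)\<^sup>2 * \<xi>\<^sup>2)" by (simp only: cmod_exp_diff_sq_le)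
  also have "\<dots> \<le> min 4 (T\<^sup>2 * \<xi>\<^sup>2)"
    using st by (intro min.mono mult_right_mono) (auto intro: power_mono)
  finally have B: "(cmod B)\<^sup>2 \<le> min 4 (T\<^sup>2 * \<xi>\<^sup>2)" .
  have a: "a\<^sup>2 = y powr (- 2 * p - 1)" unfolding a_def pw by simp
  have e: "y powr (- q - 1 / 2) = y powr (- q) * y powr (- 1 / 2)" for q
    by (simp only: powr_add[symmetric]) simp
  have "b = (y powr (- p) - y powr (- r)) * y powr (- 1 / 2)"
    unfolding b_def e left_diff_distrib ..
  then have "\<bar>b\<bar> = \<bar>y powr (- p) - y powr (- r)\<bar> * y powr (- 1 / 2)"
    by (simp only: abs_mult abs_of_nonneg[OF powr_ge_zero])
  also have "\<dots> \<le> \<bar>p - r\<bar> / \<epsilon> * (y powr (- (M + \<epsilon>)) + y powr (- (m - \<epsilon>))) * y powr (- 1 / 2)"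
    by (intro mult_right_mono powr_exponent_diff_le y pr \<epsilon>) auto
  also have "\<dots> = \<bar>p - r\<bar> / \<epsilon> * (y powr (- (M + \<epsilon>) + - 1 / 2) + y powr (- (m - \<epsilon>) + - 1 / 2))"
    unfolding powr_add by (simp add: algebra_simps)
  finally have "b\<^sup>2 \<le> (\<bar>p - r\<bar> / \<epsilon> * (y powr (- (M + \<epsilon>) + - 1 / 2) + y powr (- (m - \<epsilon>) + - 1 / 2)))\<^sup>2"
    by (metis abs_ge_zero power2_abs power_mono)
  also have "\<dots> \<le> (p - r)\<^sup>2 / \<epsilon>\<^sup>2 * (2 * (y powr (- (M + \<epsilon>) + - 1 / 2))\<^sup>2 + 2 * (y powr (- (m - \<epsilon>) + - 1 / 2))\<^sup>2)"
    unfolding power_mult_distrib power_divide power2_abs by (intro mult_left_mono sq) auto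
  also have "\<dots> = 2 * ((p - r)\<^sup>2 / \<epsilon>\<^sup>2) * (y powr (- 2 * (M + \<epsilon>) - 1) + y powr (- 2 * (m - \<epsilon>) - 1))"
  proof -
    have e1: "2 * (- (M + \<epsilon>) + - 1 / 2) = - 2 * (M + \<epsilon>) - 1" by (simp add: algebra_simps)
    have e2: "2 * (- (m - \<epsilon>) + - 1 / 2) = - 2 * (m - \<epsilon>) - 1" by (simp add: algebra_simps)
    have "X * (2 * u + 2 * v) = 2 * X * (u + v)" for X u v :: real by (simp add: algebra_simps)
    then show ?thesis unfolding pw e1 e2 .
  qed
  finally have b: "b\<^sup>2 \<le> 2 * ((p - r)\<^sup>2 / \<epsilon>\<^sup>2) * (y powr (- 2 * (M + \<epsilon>) - 1) + y powr (- 2 * (m - \<epsilon>) - 1))" .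
  have "mbm_kernel p t \<xi> - mbm_kernel r s \<xi> = A * complex_of_real a + B * complex_of_real b"
    unfolding mbm_kernel_diff[OF \<xi>] A_def B_def a_def b_def y_def ..
  then have "cmod (mbm_kernel p t \<xi> - mbm_kernel r s \<xi>) \<le> cmod A * \<bar>a\<bar> + cmod B * \<bar>b\<bar>"
    using norm_triangle_ineq[of "A * complex_of_real a" "B * complex_of_real b"] by (simp add: norm_mult)
  then have "(cmod (mbm_kernel p t \<xi> - mbm_kernel r s \<xi>))\<^sup>2 \<le> (cmod A * \<bar>a\<bar> + cmod B * \<bar>b\<bar>)\<^sup>2"
    by (intro power_mono) auto
  also have "\<dots> \<le> 2 * (cmod A * \<bar>a\<bar>)\<^sup>2 + 2 * (cmod B * \<bar>b\<bar>)\<^sup>2" by (rule sq)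
  also have "\<dots> = 2 * ((cmod A)\<^sup>2 * a\<^sup>2) + 2 * ((cmod B)\<^sup>2 * b\<^sup>2)" by (simp add: power_mult_distrib)
  also have "\<dots> \<le> 2 * (min 4 ((t - s)\<^sup>2 * \<xi>\<^sup>2) * y powr (- 2 * p - 1)) +
      2 * (min 4 (T\<^sup>2 * \<xi>\<^sup>2) * (2 * ((p - r)\<^sup>2 / \<epsilon>\<^sup>2) * (y powr (- 2 * (M + \<epsilon>) - 1) + y powr (- 2 * (m - \<epsilon>) - 1))))"
    using A B a b by (intro add_mono mult_left_mono mult_mono) auto
  also have "\<dots> = 2 * (min 4 ((t - s)\<^sup>2 * \<xi>\<^sup>2) * y powr (- 2 * p - 1)) +
    4 * ((p - r)\<^sup>2 / \<epsilon>\<^sup>2) * (min 4 (T\<^sup>2 * \<xi>\<^sup>2) * y powr (- 2 * (M + \<epsilon>) - 1) +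
      min 4 (T\<^sup>2 * \<xi>\<^sup>2) * y powr (- 2 * (m - \<epsilon>) - 1))"
  proof -
    have "2 * (c * (2 * d * (e + f))) = 4 * d * (c * e + c * f)" for c d e f :: real by (simp add: algebra_simps)
    then show ?thesis by (simp only:)
  qed
  finally show ?thesis unfolding y_def .
qed

lemma mbm_kernel_diff_integral_le:
  assumes m: "0 < m" and M: "M < 1" and T: "0 \<le> T"
  obtains K where "0 \<le> K"
    "\<And>s t p r. 0 \<le> s \<Longrightarrow> s \<le> T \<Longrightarrow> p \<in> {m..M} \<Longrightarrow> r \<in> {m..M} \<Longrightarrow>
      (\<integral>\<^sup>+\<xi>. ennreal ((cmod (mbm_kernel p t \<xi> - mbm_kernel r s \<xi>))\<^sup>2) \<partial>lborel) \<le>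
        ennreal (K * (\<bar>t - s\<bar> powr (2 * p) + (p - r)\<^sup>2))"
proof -
  \<comment> \<open>Half the distance of the exponent range from the ends of the unit interval, so
    that \<open>m - \<epsilon>\<close> and \<open>M + \<epsilon>\<close> stay strictly between 0 and
    1, where the frequency integrals converge.\<close>
  define \<epsilon> where "\<epsilon> = min m (1 - M) / 2"
  have \<epsilon>: "0 < \<epsilon>" "\<epsilon> < m" "M + \<epsilon> < 1" using m M by (auto simp: \<epsilon>_def min_def field_simps)
  define J where "J h q \<xi> = ennreal (min 4 (h\<^sup>2 * \<xi>\<^sup>2) * \<bar>\<xi>\<bar> powr (- 2 * q - 1))" for h q \<xi> :: real
  have [measurable]: "J h q \<in> borel_measurable borel" for h q unfolding J_def by measurable
  define C where "C q = 1 / (1 - q) + 4 / q" for q :: real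
  have JC: "integral\<^sup>N lborel (J h q) \<le> ennreal (C q * h powr (2 * q))" if "0 \<le> h" "0 < q" "q < 1" for h q
    unfolding J_def C_def by (rule kernel_tail_integral[OF that])
  have C0: "0 \<le> C q" if "0 < q" "q < 1" for q using that by (simp add: C_def)
  \<comment> \<open>Bounds \<open>2 * C p\<close> for all \<open>p\<close> in the range:
    \<open>1 / (1 - p)\<close> is largest at \<open>M\<close> and \<open>4 / p\<close> at
    \<open>m\<close>.\<close>
  define K1 where "K1 = 2 * (1 / (1 - M) + 4 / m)"
  define K2 where "K2 = (4 / \<epsilon>\<^sup>2) * (C (M + \<epsilon>) * T powr (2 * (M + \<epsilon>)) + C (m - \<epsilon>) * T powr (2 * (m - \<epsilon>)))"
  show ?thesis
  proof (rule that[of "max K1 K2"])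
    have "0 \<le> K1" using m M by (simp add: K1_def)
    then show "0 \<le> max K1 K2" by simp
    fix s t p r assume s: "0 \<le> s" "s \<le> T" and p: "p \<in> {m..M}" and r: "r \<in> {m..M}"
    have p01: "0 < p" "p < 1" using p m M by auto
    have M01: "0 < M + \<epsilon>" "m - \<epsilon> < 1" "0 < m - \<epsilon>" using \<epsilon> p01 p m by auto
    have K20: "0 \<le> K2" unfolding K2_def using C0[OF M01(1) \<epsilon>(3)] C0[OF M01(3,2)] by auto
    define d where "d = 4 * ((p - r)\<^sup>2 / \<epsilon>\<^sup>2)"
    have d0: "0 \<le> d" by (simp add: d_def)
    have "AE \<xi> in lborel. \<xi> \<noteq> (0::real)" by (rule AE_lborel_singleton)
    then have "AE \<xi> in lborel. ennreal ((cmod (mbm_kernel p t \<xi> - mbm_kernel r s \<xi>))\<^sup>2) \<le>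
        ennreal 2 * J \<bar>t - s\<bar> p \<xi> + ennreal d * (J T (M + \<epsilon>) \<xi> + J T (m - \<epsilon>) \<xi>)"
    proof eventually_elim
      case (elim \<xi>)
      have "ennreal ((cmod (mbm_kernel p t \<xi> - mbm_kernel r s \<xi>))\<^sup>2) \<le> ennreal (2 * (min 4 ((t - s)\<^sup>2 * \<xi>\<^sup>2) * \<bar>\<xi>\<bar> powr (- 2 * p - 1)) +
        d * (min 4 (T\<^sup>2 * \<xi>\<^sup>2) * \<bar>\<xi>\<bar> powr (- 2 * (M + \<epsilon>) - 1) + min 4 (T\<^sup>2 * \<xi>\<^sup>2) * \<bar>\<xi>\<bar> powr (- 2 * (m - \<epsilon>) - 1)))"
        unfolding d_def by (intro ennreal_leI mbm_kernel_diff_le[OF elim s p r \<epsilon>(1)])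
      also have "\<dots> = ennreal 2 * J \<bar>t - s\<bar> p \<xi> + ennreal d * (J T (M + \<epsilon>) \<xi> + J T (m - \<epsilon>) \<xi>)"
        unfolding J_def power2_abs using d0
        by (subst ennreal_plus[symmetric], simp, simp, subst ennreal_mult_plus_mult) auto
      finally show ?case .
    qed
    then have "(\<integral>\<^sup>+\<xi>. ennreal ((cmod (mbm_kernel p t \<xi> - mbm_kernel r s \<xi>))\<^sup>2) \<partial>lborel) \<le>
        (\<integral>\<^sup>+\<xi>. ennreal 2 * J \<bar>t - s\<bar> p \<xi> + ennreal d * (J T (M + \<epsilon>) \<xi> + J T (m - \<epsilon>) \<xi>) \<partial>lborel)"
      by (rule nn_integral_mono_AE)
    also have "\<dots> = ennreal 2 * integral\<^sup>N lborel (J \<bar>t - s\<bar> p) +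
        ennreal d * (integral\<^sup>N lborel (J T (M + \<epsilon>)) + integral\<^sup>N lborel (J T (m - \<epsilon>)))"
      by (simp add: nn_integral_add nn_integral_cmult)
    also have "\<dots> \<le> ennreal 2 * ennreal (C p * \<bar>t - s\<bar> powr (2 * p)) +
        ennreal d * (ennreal (C (M + \<epsilon>) * T powr (2 * (M + \<epsilon>))) + ennreal (C (m - \<epsilon>) * T powr (2 * (m - \<epsilon>))))"
      using T p01 M01 \<epsilon> by (intro add_mono mult_left_mono JC) auto
    also have "\<dots> = ennreal (2 * (C p * \<bar>t - s\<bar> powr (2 * p)) + d * (C (M + \<epsilon>) * T powr (2 * (M + \<epsilon>)) + C (m - \<epsilon>) * T powr (2 * (m - \<epsilon>))))"
      using C0[OF p01] C0[OF M01(1) \<epsilon>(3)] C0[OF M01(3,2)] d0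
      by (subst ennreal_plus[symmetric], simp, simp, subst ennreal_mult_plus_mult) auto
    also have "d * (C (M + \<epsilon>) * T powr (2 * (M + \<epsilon>)) + C (m - \<epsilon>) * T powr (2 * (m - \<epsilon>))) = K2 * (p - r)\<^sup>2"
      by (simp add: d_def K2_def)
    also have "ennreal (2 * (C p * \<bar>t - s\<bar> powr (2 * p)) + K2 * (p - r)\<^sup>2) \<le> ennreal (max K1 K2 * (\<bar>t - s\<bar> powr (2 * p) + (p - r)\<^sup>2))"
    proof (rule ennreal_leI)
      have "1 / (1 - p) \<le> 1 / (1 - M)" using p M p01 by (intro divide_left_mono) auto
      moreover have "4 / p \<le> 4 / m" using p m by (intro divide_left_mono) auto
      ultimately have "2 * C p \<le> max K1 K2" unfolding C_def K1_def by simp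
      then have "2 * C p * \<bar>t - s\<bar> powr (2 * p) \<le> max K1 K2 * \<bar>t - s\<bar> powr (2 * p)" by (intro mult_right_mono) auto
      moreover have "K2 * (p - r)\<^sup>2 \<le> max K1 K2 * (p - r)\<^sup>2" by (intro mult_right_mono) auto
      ultimately show "2 * (C p * \<bar>t - s\<bar> powr (2 * p)) + K2 * (p - r)\<^sup>2 \<le> max K1 K2 * (\<bar>t - s\<bar> powr (2 * p) + (p - r)\<^sup>2)"
        by (simp add: distrib_left)
    qed
    finally show "(\<integral>\<^sup>+\<xi>. ennreal ((cmod (mbm_kernel p t \<xi> - mbm_kernel r s \<xi>))\<^sup>2) \<partial>lborel) \<le>
        ennreal (max K1 K2 * (\<bar>t - s\<bar> powr (2 * p) + (p - r)\<^sup>2))" .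
  qed
qed

text \<open>On frequencies with \<open>\<pi> / 2 \<le> h * \<xi> \<le> \<pi>\<close> the two oscillating factors differ by at least \<open>1\<close> in modulus, whereas
  the two moduli differ by a small relative error.\<close>

lemma mbm_kernel_diff_integral_ge:
  assumes h: "0 < \<bar>t - s\<bar>" "\<bar>t - s\<bar> \<le> 1" and p: "0 < p" "p < 1"
    and small: "\<bar>p - r\<bar> * ln (pi / \<bar>t - s\<bar>) \<le> 1 / 12"
  shows "ennreal (\<bar>t - s\<bar> powr (2 * p) / (8 * pi\<^sup>2)) \<le>
    (\<integral>\<^sup>+\<xi>. ennreal ((cmod (mbm_kernel p t \<xi> - mbm_kernel r s \<xi>))\<^sup>2) \<partial>lborel)"
proof -
  define h where "h = \<bar>t - s\<bar>"
  have h: "0 < h" "h \<le> 1" using h by (auto simp: h_def)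
  define S where "S = {pi / (2 * h) .. pi / h}"
  \<comment> \<open>A quarter of the smallest value of \<open>\<xi> powr (- 2 * p - 1)\<close> on
    the band, attained at its right end.\<close>
  define c where "c = (pi / h) powr (- 2 * p - 1) / 4"
  have pt: "c \<le> (cmod (mbm_kernel p t \<xi> - mbm_kernel r s \<xi>))\<^sup>2" if "\<xi> \<in> S" for \<xi>
  proof -
    have \<xi>: "pi / 2 \<le> h * \<xi>" "h * \<xi> \<le> pi" using that h by (auto simp: S_def field_simps)
    have "1 < pi / 2" using pi_gt3 by simp
    also have "pi / 2 \<le> 1 * \<xi>"
    proof (rule order_trans[OF \<xi>(1)])
      have "0 < h * \<xi>" using \<xi>(1) pi_gt_zero by linarith
      then have "0 < \<xi>" using h by (simp add: zero_less_mult_iff)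
      then show "h * \<xi> \<le> 1 * \<xi>" using h by (intro mult_right_mono) auto
    qed
    finally have \<xi>1: "1 < \<xi>" by simp
    define A where "A = exp (\<i> * complex_of_real (t * \<xi>)) - exp (\<i> * complex_of_real (s * \<xi>))"
    define B where "B = exp (\<i> * complex_of_real (s * \<xi>)) - 1"
    define a where "a = \<xi> powr (- p - 1 / 2)"
    define b where "b = \<xi> powr (- p - 1 / 2) - \<xi> powr (- r - 1 / 2)"
    have eq: "mbm_kernel p t \<xi> - mbm_kernel r s \<xi> = A * complex_of_real a + B * complex_of_real b"
      using mbm_kernel_diff[of \<xi> p t r s] \<xi>1 by (simp add: A_def B_def a_def b_def)
    \<comment> \<open>The angle lies between \<open>pi / 2\<close> and \<open>pi\<close>, so its
      cosine is at most 0 and the squared modulus \<open>2 - 2 * cos (h * \<xi>)\<close> is at least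
      2.\<close>
    have "cos (h * \<xi>) \<le> cos (pi / 2)"
      using \<xi> pi_gt_zero by (intro cos_monotone_0_pi_le) auto
    moreover have "cos (t * \<xi> - s * \<xi>) = cos (h * \<xi>)"
      by (simp add: h_def abs_if left_diff_distrib[symmetric]) (metis cos_minus minus_diff_eq mult_minus_left)
    ultimately have "1 \<le> (cmod A)\<^sup>2" unfolding A_def cmod_exp_diff_sq by simp
    then have A: "1 \<le> cmod A" by (metis norm_ge_zero one_power2 power2_le_imp_le)
    have B: "cmod B \<le> 2" unfolding B_def
      using norm_triangle_ineq4[of "exp (\<i> * complex_of_real (s * \<xi>))" 1] by (simp del: of_real_mult)
    have ln: "0 \<le> ln \<xi>" "ln \<xi> \<le> ln (pi / h)" using \<xi>1 \<xi> h by (auto simp: field_simps)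
    have x: "\<bar>(p - r) * ln \<xi>\<bar> \<le> 1 / 12"
    proof -
      have "\<bar>(p - r) * ln \<xi>\<bar> = \<bar>p - r\<bar> * ln \<xi>" using ln by (simp add: abs_mult)
      also have "\<dots> \<le> \<bar>p - r\<bar> * ln (pi / h)" using ln by (intro mult_left_mono) auto
      finally show ?thesis using small by (simp add: h_def)
    qed
    \<comment> \<open>The smallness hypothesis \<open>1 / 12\<close> and
      \<open>exp 1 \<le> 3\<close> give a relative error of at most \<open>1 / 4\<close>. Since
      \<open>cmod B \<le> 2\<close>, the exponent term then takes away at most half of
      \<open>a\<close>.\<close>
    have bb: "\<bar>b\<bar> \<le> a / 4"
    proof -
      have "b = a * (1 - \<xi> powr (p - r))"
        unfolding a_def b_def right_diff_distrib powr_add[symmetric] by (simp add: algebra_simps)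
      then have "\<bar>b\<bar> = a * \<bar>exp 0 - exp ((p - r) * ln \<xi>)\<bar>"
        using \<xi>1 by (simp add: abs_mult a_def powr_def)
      also have "\<dots> \<le> a * (1 / 4)"
      proof (intro mult_left_mono)
        have "\<bar>exp 0 - exp ((p - r) * ln \<xi>)\<bar> \<le> \<bar>0 - (p - r) * ln \<xi>\<bar> * exp (max 0 ((p - r) * ln \<xi>))"
          by (rule abs_exp_diff_le)
        also have "\<dots> \<le> 1 / 12 * exp 1"
          using x by (intro mult_mono) (auto simp: abs_le_iff)
        also have "\<dots> \<le> 1 / 12 * 3" using exp_le by (intro mult_left_mono) auto
        finally show "\<bar>exp 0 - exp ((p - r) * ln \<xi>)\<bar> \<le> 1 / 4" by simp
      qed (simp add: a_def)
      finally show ?thesis by simp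
    qed
    have a0: "0 \<le> a" by (simp add: a_def)
    have "a / 2 \<le> 1 * a - 2 * (a / 4)" by simp
    also have "\<dots> \<le> cmod A * \<bar>a\<bar> - cmod B * \<bar>b\<bar>"
      using A B bb a0 by (intro diff_mono mult_mono) auto
    also have "\<dots> \<le> cmod (A * complex_of_real a + B * complex_of_real b)"
      using norm_diff_ineq[of "A * complex_of_real a" "B * complex_of_real b"] by (simp add: norm_mult)
    finally have "(a / 2)\<^sup>2 \<le> (cmod (mbm_kernel p t \<xi> - mbm_kernel r s \<xi>))\<^sup>2"
      unfolding eq using a0 by (intro power_mono) auto
    moreover have "c \<le> (a / 2)\<^sup>2"
    proof -
      have "a\<^sup>2 = \<xi> powr (- 2 * p - 1)" using \<xi>1 by (simp add: a_def power2_eq_square powr_add[symmetric])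
      moreover have "(pi / h) powr (- 2 * p - 1) \<le> \<xi> powr (- 2 * p - 1)"
        using \<xi>1 \<xi> h p by (intro powr_mono2') (auto simp: field_simps)
      ultimately show ?thesis by (simp add: c_def power_divide)
    qed
    ultimately show ?thesis by linarith
  qed
  have "ennreal (h powr (2 * p) / (8 * pi\<^sup>2)) \<le> ennreal (c * (pi / (2 * h)))"
  proof (rule ennreal_leI)
    have "c * (pi / (2 * h)) = (pi / h) powr (- 2 * p - 1) * (pi / h) / 8" by (simp add: c_def)
    also have "(pi / h) powr (- 2 * p - 1) * (pi / h) = (pi / h) powr (- 2 * p - 1) * (pi / h) powr 1" using h by simp
    also have "\<dots> = (pi / h) powr (- 2 * p)" by (simp only: powr_add[symmetric]) simp
    also have "\<dots> = h powr (2 * p) / pi powr (2 * p)" using h by (simp add: powr_divide powr_minus field_simps)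
    finally have eq: "c * (pi / (2 * h)) = h powr (2 * p) / pi powr (2 * p) / 8" .
    \<comment> \<open>Since \<open>p < 1\<close>, the power of \<open>pi\<close> can be replaced by
      its square, which frees the constant from \<open>p\<close>.\<close>
    have "pi powr (2 * p) \<le> pi powr 2" using p pi_gt3 by (intro powr_mono) auto
    then have "pi powr (2 * p) \<le> pi\<^sup>2" by simp
    then have "h powr (2 * p) / pi\<^sup>2 \<le> h powr (2 * p) / pi powr (2 * p)"
      by (intro divide_left_mono) auto
    then show "h powr (2 * p) / (8 * pi\<^sup>2) \<le> c * (pi / (2 * h))" unfolding eq by simp
  qed
  also have "\<dots> = (\<integral>\<^sup>+\<xi>. ennreal c * indicator S \<xi> \<partial>lborel)"
  proof -
    have "pi / (2 * h) \<le> pi / h" using h by (simp add: field_simps)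
    moreover have "pi / h - pi / (2 * h) = pi / (2 * h)" using h by (simp add: field_simps)
    ultimately have "emeasure lborel S = ennreal (pi / (2 * h))" unfolding S_def by simp
    moreover have "(\<integral>\<^sup>+\<xi>. ennreal c * indicator S \<xi> \<partial>lborel) = ennreal c * emeasure lborel S"
      by (rule nn_integral_cmult_indicator) (simp add: S_def)
    moreover have "0 \<le> c" "0 \<le> pi / (2 * h)" using h by (auto simp: c_def)
    ultimately show ?thesis by (simp only: ennreal_mult[symmetric])
  qed
  also have "\<dots> \<le> (\<integral>\<^sup>+\<xi>. ennreal ((cmod (mbm_kernel p t \<xi> - mbm_kernel r s \<xi>))\<^sup>2) \<partial>lborel)"
    using pt by (intro nn_integral_mono) (auto split: split_indicator intro: ennreal_leI)
  finally show ?thesis by (simp add: h_def)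
qed

section \<open>Energies and chaining\<close>

text \<open>The time-domain functions are merely known to exist. Plancherel's identity expresses the
  squared norm of their difference by the kernels \<open>g\<close> and \<open>g'\<close>, so a bound
  on the kernels suffices.\<close>

lemma fourier_white_noise_integral_diff_even_moment:
  assumes W: "white_noise M W"
    and Y: "fourier_white_noise_integral M W g Y" "fourier_white_noise_integral M W g' Y'" and k: "0 < k"
    and U: "(\<integral>\<^sup>+\<xi>. ennreal ((cmod (g \<xi> - g' \<xi>))\<^sup>2) \<partial>lborel) \<le> ennreal U" "0 \<le> U"
  shows "(\<integral>\<^sup>+\<omega>. ennreal ((Y \<omega> - Y' \<omega>) ^ (2 * k)) \<partial>M) \<le> ennreal (fact (2 * k) / (2 ^ k * fact k) * U ^ k)"
proof -
  from Y obtain f f' where f: "L2_fourier_transform f g" "white_noise_integral M W f Y"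
    and f': "L2_fourier_transform f' g'" "white_noise_integral M W f' Y'"
    unfolding fourier_white_noise_integral_def by blast
  define V where "V = (\<integral>x. (f x - f' x)\<^sup>2 \<partial>lborel)"
  have V: "0 \<le> V" "V \<le> U" using U plancherel_diff[OF f(1) f'(1)] by (auto simp: V_def)
  have "(\<integral>\<^sup>+\<omega>. ennreal ((Y \<omega> - Y' \<omega>) ^ (2 * k)) \<partial>M) \<le> ennreal (fact (2 * k) / (2 ^ k * fact k) * V ^ k)"
    unfolding V_def by (rule white_noise_integral_diff_even_moment[OF W f(2) f'(2) k])
  also have "\<dots> \<le> ennreal (fact (2 * k) / (2 ^ k * fact k) * U ^ k)"
    using V by (intro ennreal_leI mult_left_mono power_mono) auto
  finally show ?thesis .
qed

lemma fourier_white_noise_integral_diff_negative_moment: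
  assumes W: "white_noise M W"
    and Y: "fourier_white_noise_integral M W g Y" "fourier_white_noise_integral M W g' Y'" and b: "0 < b" "b < 1"
    and L: "ennreal L \<le> (\<integral>\<^sup>+\<xi>. ennreal ((cmod (g \<xi> - g' \<xi>))\<^sup>2) \<partial>lborel)" "0 < L"
  shows "(\<integral>\<^sup>+\<omega>. inverse (ennreal (\<bar>Y \<omega> - Y' \<omega>\<bar> powr b)) \<partial>M) \<le> ennreal ((1 + 2 / (1 - b)) * L powr (- b / 2))"
proof -
  from Y obtain f f' where f: "L2_fourier_transform f g" "white_noise_integral M W f Y"
    and f': "L2_fourier_transform f' g'" "white_noise_integral M W f' Y'"
    unfolding fourier_white_noise_integral_def by blast
  define V where "V = (\<integral>x. (f x - f' x)\<^sup>2 \<partial>lborel)"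
  have V: "0 \<le> V" "L \<le> V" using L plancherel_diff[OF f(1) f'(1)] by (auto simp: V_def ennreal_le_iff)
  have "(\<integral>\<^sup>+\<omega>. inverse (ennreal (\<bar>Y \<omega> - Y' \<omega>\<bar> powr b)) \<partial>M) \<le> ennreal ((1 + 2 / (1 - b)) * V powr (- b / 2))"
    unfolding V_def
    by (rule white_noise_integral_diff_negative_moment[OF W f(2) f'(2) _ b]) (use V L in \<open>auto simp: V_def\<close>)
  also have "\<dots> \<le> ennreal ((1 + 2 / (1 - b)) * L powr (- b / 2))"
    using V L b by (intro ennreal_leI mult_left_mono powr_mono2') auto
  finally show ?thesis .
qed

lemma inverse_ennreal_antimono:
  assumes "0 \<le> x" "x \<le> y"
  shows "inverse (ennreal y) \<le> inverse (ennreal x)"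
proof (cases "x = 0")
  case False
  then have "0 < x" "0 < y" using assms by auto
  then show ?thesis using assms by (simp add: inverse_ennreal le_imp_inverse_le)
qed simp

section \<open>Energy integrals along the paths\<close>

text \<open>Interchanging expectation and time integrals needs joint measurability in time and
  \<open>\<omega>\<close>. A process all of whose paths are continuous has it, being a limit of
  processes that are constant in time on the cells of a grid.\<close>

lemma AE_continuous_measurable_version:
  fixes X :: "real \<Rightarrow> 'w \<Rightarrow> real"
  assumes X: "\<And>t. t \<in> {a..b} \<Longrightarrow> X t \<in> borel_measurable M" and ab: "a \<le> b"
    and cont: "AE \<omega> in M. continuous_on {a..b} (\<lambda>t. X t \<omega>)"
  obtains X' where "case_prod X' \<in> borel_measurable (borel \<Otimes>\<^sub>M M)"
    "AE \<omega> in M. \<forall>t\<in>{a..b}. X' t \<omega> = X t \<omega>"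
proof -
  from cont obtain N where N: "{\<omega> \<in> space M. \<not> continuous_on {a..b} (\<lambda>t. X t \<omega>)} \<subseteq> N" "N \<in> null_sets M"
    by (auto simp: eventually_ae_filter)
  have [measurable]: "N \<in> sets M" using N by auto
  define c where "c t = max a (min b t)" for t
  have c: "c t \<in> {a..b}" for t using ab by (auto simp: c_def)
  \<comment> \<open>Clamping the time extends the paths continuously to the whole line, and the
    indicator replaces the exceptional ones by 0; every path is then continuous.\<close>
  define X' where "X' t \<omega> = X (c t) \<omega> * indicator (space M - N) \<omega>" for t \<omega>
  have Xm: "X' t \<in> borel_measurable M" for t unfolding X'_def using X[OF c] by measurable
  \<comment> \<open>The time rounded down to a multiple of \<open>1 / (n + 1)\<close>. It takes
    countably many values, which makes the composed process jointly measurable.\<close>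
  define A where "A n t = real_of_int \<lfloor>(real n + 1) * t\<rfloor> / (real n + 1)" for n and t :: real
  have A: "(\<lambda>n. A n t) \<longlonglongrightarrow> t" for t
  proof (rule tendsto_sandwich)
    show "(\<lambda>n. t - 1 / (real n + 1)) \<longlonglongrightarrow> t" by real_asymp
    show "(\<lambda>_. t) \<longlonglongrightarrow> t" by simp
    have "t - 1 / (real n + 1) = ((real n + 1) * t - 1) / (real n + 1)" for n by (simp add: diff_divide_distrib)
    then show "eventually (\<lambda>n. t - 1 / (real n + 1) \<le> A n t) sequentially"
      unfolding A_def by (simp only:) (intro always_eventually allI divide_right_mono; linarith)
    have "t = ((real n + 1) * t) / (real n + 1)" for n by simp
    then show "eventually (\<lambda>n. A n t \<le> t) sequentially"
      unfolding A_def by (intro always_eventually allI) (simp add: divide_le_eq mult.commute)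
  qed
  have "case_prod X' \<in> borel_measurable (borel \<Otimes>\<^sub>M M)"
  proof (rule borel_measurable_LIMSEQ_real)
    fix n
    have "(\<lambda>p. (\<lambda>i p. X' (real_of_int i / (real n + 1)) (snd p)) \<lfloor>(real n + 1) * fst p\<rfloor> p) \<in> borel_measurable (borel \<Otimes>\<^sub>M M)"
      by (rule measurable_compose_countable) (use Xm in measurable)
    then show "(\<lambda>p. X' (A n (fst p)) (snd p)) \<in> borel_measurable (borel \<Otimes>\<^sub>M M)" by (simp add: A_def)
  next
    fix p assume "p \<in> space (borel \<Otimes>\<^sub>M M :: (real \<times> 'w) measure)"
    then obtain t \<omega> where p: "p = (t, \<omega>)" "\<omega> \<in> space M" by (auto simp: space_pair_measure)
    show "(\<lambda>n. X' (A n (fst p)) (snd p)) \<longlonglongrightarrow> case_prod X' p"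
    proof (cases "\<omega> \<in> N")
      case True
      then show ?thesis by (simp add: p X'_def)
    next
      case False
      then have co: "continuous_on {a..b} (\<lambda>t. X t \<omega>)" using N p by auto
      have "(\<lambda>n. c (A n t)) \<longlonglongrightarrow> c t" unfolding c_def by (intro tendsto_intros A)
      then have "(\<lambda>n. X (c (A n t)) \<omega>) \<longlonglongrightarrow> X (c t) \<omega>"
        by (rule continuous_on_tendsto_compose[OF co _ c always_eventually[OF allI, OF c]])
      then show ?thesis using False p by (simp add: X'_def)
    qed
  qed
  moreover have "AE \<omega> in M. \<forall>t\<in>{a..b}. X' t \<omega> = X t \<omega>"
    using AE_not_in[OF N(2)] AE_space by eventually_elim (auto simp: X'_def c_def)
  ultimately show ?thesis by (rule that)
qed

text \<open>By Tonelli the mean energy is at most \<open>C\<close> times the double integral of the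
  inverse power \<open>\<alpha> + \<kappa>\<close> of the time distance, which is finite because
  this exponent is below 1. A variable with finite mean is finite almost surely.\<close>

lemma AE_energy_finite:
  fixes X :: "real \<Rightarrow> 'w \<Rightarrow> real"
  assumes M: "sigma_finite_measure M" and Xm[measurable]: "case_prod X \<in> borel_measurable (borel \<Otimes>\<^sub>M M)" and ab: "a < b"
    and mom: "\<And>s t. s \<in> {a..b} \<Longrightarrow> t \<in> {a..b} \<Longrightarrow> s \<noteq> t \<Longrightarrow>
      (\<integral>\<^sup>+\<omega>. inverse (ennreal (\<bar>X t \<omega> - X s \<omega>\<bar> powr \<beta>)) \<partial>M) \<le> ennreal (C * \<bar>t - s\<bar> powr (- \<kappa>))"
    and C: "0 \<le> C" and exps: "0 \<le> \<alpha> + \<kappa>" "\<alpha> + \<kappa> < 1"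
  shows "AE \<omega> in M. (\<integral>\<^sup>+t. (\<integral>\<^sup>+u. inverse (ennreal (\<bar>t - u\<bar> powr \<alpha> * \<bar>X t \<omega> - X u \<omega>\<bar> powr \<beta>)) * indicator {a..b} u \<partial>lborel)
      * indicator {a..b} t \<partial>lborel) < \<infinity>"
proof -
  interpret M: sigma_finite_measure M by (rule M)
  interpret P: pair_sigma_finite "lborel :: real measure" M ..
  define k where "k t u \<omega> = inverse (ennreal (\<bar>t - u\<bar> powr \<alpha> * \<bar>X t \<omega> - X u \<omega>\<bar> powr \<beta>))" for t u \<omega>
  define I where "I = {a..b}"
  have [measurable]: "I \<in> sets borel" by (simp add: I_def)
  have km[measurable]: "(\<lambda>p. k (fst p) (fst (snd p)) (snd (snd p))) \<in> borel_measurable (borel \<Otimes>\<^sub>M (borel \<Otimes>\<^sub>M M))"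
    unfolding k_def by measurable
  define E where "E \<omega> = (\<integral>\<^sup>+t. (\<integral>\<^sup>+u. k t u \<omega> * indicator I u \<partial>lborel) * indicator I t \<partial>lborel)" for \<omega>
  have [measurable]: "E \<in> borel_measurable M" unfolding E_def k_def by measurable
  define R where "R = 2 * ((b - a) powr (1 - (\<alpha> + \<kappa>)) / (1 - (\<alpha> + \<kappa>)))"
  have inner: "(\<integral>\<^sup>+\<omega>. (\<integral>\<^sup>+u. k t u \<omega> * indicator I u \<partial>lborel) \<partial>M) \<le> ennreal C * ennreal R" if t: "t \<in> I" for t
  proof -
    have "(\<integral>\<^sup>+\<omega>. (\<integral>\<^sup>+u. k t u \<omega> * indicator I u \<partial>lborel) \<partial>M) = (\<integral>\<^sup>+u. (\<integral>\<^sup>+\<omega>. k t u \<omega> * indicator I u \<partial>M) \<partial>lborel)"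
      by (rule P.Fubini') (unfold k_def, measurable)
    also have "\<dots> \<le> (\<integral>\<^sup>+u. ennreal C * (inverse (ennreal (\<bar>u - t\<bar> powr (\<alpha> + \<kappa>))) * indicator {- (b - a)..b - a} (u - t)) \<partial>lborel)"
    proof (rule nn_integral_mono_AE)
      \<comment> \<open>The moment hypothesis says nothing about equal times, which form a null
        set.\<close>
      have "AE u in lborel. u \<noteq> t" by (rule AE_lborel_singleton)
      then show "AE u in lborel. (\<integral>\<^sup>+\<omega>. k t u \<omega> * indicator I u \<partial>M) \<le>
          ennreal C * (inverse (ennreal (\<bar>u - t\<bar> powr (\<alpha> + \<kappa>))) * indicator {- (b - a)..b - a} (u - t))"
      proof eventually_elim
        case (elim u)
        show ?case
        proof (cases "u \<in> I")
          case True
          define d where "d = \<bar>u - t\<bar>"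
          have d: "0 < d" using elim by (simp add: d_def)
          have "(\<integral>\<^sup>+\<omega>. k t u \<omega> * indicator I u \<partial>M) = (\<integral>\<^sup>+\<omega>. ennreal (d powr (- \<alpha>)) * inverse (ennreal (\<bar>X t \<omega> - X u \<omega>\<bar> powr \<beta>)) \<partial>M)"
          proof (rule nn_integral_cong)
            fix \<omega>
            \<comment> \<open>At \<open>x = 0\<close>, where the path takes equal values at the two
              times, both sides are infinite.\<close>
            have "inverse (ennreal (d powr \<alpha> * x)) = ennreal (d powr (- \<alpha>)) * inverse (ennreal x)" if "0 \<le> x" for x
            proof (cases "x = 0")
              case True
              then show ?thesis using d by (simp add: ennreal_mult_top)
            next
              case False
              then have "0 < x" using that by simp
              then show ?thesis using d by (simp add: inverse_ennreal ennreal_mult[symmetric] powr_minus)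
            qed
            then show "k t u \<omega> * indicator I u = ennreal (d powr (- \<alpha>)) * inverse (ennreal (\<bar>X t \<omega> - X u \<omega>\<bar> powr \<beta>))"
              using True by (simp add: k_def d_def abs_minus_commute)
          qed
          also have "\<dots> = ennreal (d powr (- \<alpha>)) * (\<integral>\<^sup>+\<omega>. inverse (ennreal (\<bar>X t \<omega> - X u \<omega>\<bar> powr \<beta>)) \<partial>M)"
            by (rule nn_integral_cmult) measurable
          also have "\<dots> \<le> ennreal (d powr (- \<alpha>)) * ennreal (C * d powr (- \<kappa>))"
            using mom[of u t] t True elim unfolding I_def d_def
            by (intro mult_left_mono) (auto simp: abs_minus_commute)
          also have "\<dots> = ennreal (C * (d powr (- \<alpha>) * d powr (- \<kappa>)))"
            using C by (simp add: ennreal_mult[symmetric] mult_ac)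
          also have "d powr (- \<alpha>) * d powr (- \<kappa>) = inverse (d powr (\<alpha> + \<kappa>))"
            by (simp add: powr_add[symmetric] powr_minus[symmetric])
          also have "ennreal (C * inverse (d powr (\<alpha> + \<kappa>))) = ennreal C * inverse (ennreal (d powr (\<alpha> + \<kappa>)))"
            using d C by (simp add: ennreal_mult inverse_ennreal)
          also have "\<dots> = ennreal C * (inverse (ennreal (\<bar>u - t\<bar> powr (\<alpha> + \<kappa>))) * indicator {- (b - a)..b - a} (u - t))"
            using t True by (simp add: I_def d_def indicator_def)
          finally show ?thesis .
        qed simp
      qed
    qed
    also have "\<dots> = ennreal C * (\<integral>\<^sup>+u. inverse (ennreal (\<bar>u - t\<bar> powr (\<alpha> + \<kappa>))) * indicator {- (b - a)..b - a} (u - t) \<partial>lborel)"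
      by (rule nn_integral_cmult) measurable
    also have "(\<integral>\<^sup>+u. inverse (ennreal (\<bar>u - t\<bar> powr (\<alpha> + \<kappa>))) * indicator {- (b - a)..b - a} (u - t) \<partial>lborel) =
        (\<integral>\<^sup>+u. inverse (ennreal (\<bar>u\<bar> powr (\<alpha> + \<kappa>))) * indicator {- (b - a)..b - a} u \<partial>lborel)"
      using nn_integral_real_affine[of "\<lambda>u. inverse (ennreal (\<bar>u - t\<bar> powr (\<alpha> + \<kappa>))) * indicator {- (b - a)..b - a} (u - t)" 1 t]
      by simp
    also have "ennreal C * \<dots> \<le> ennreal C * ennreal R"
      unfolding R_def using ab exps by (intro mult_left_mono nn_integral_abs_powr_neg) auto
    finally show ?thesis .
  qed
  have "(\<integral>\<^sup>+\<omega>. E \<omega> \<partial>M) = (\<integral>\<^sup>+t. (\<integral>\<^sup>+\<omega>. (\<integral>\<^sup>+u. k t u \<omega> * indicator I u \<partial>lborel) * indicator I t \<partial>M) \<partial>lborel)"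
    unfolding E_def by (rule P.Fubini') (unfold k_def, measurable)
  also have "\<dots> \<le> (\<integral>\<^sup>+t. ennreal C * ennreal R * indicator I t \<partial>lborel)"
  proof (rule nn_integral_mono)
    fix t
    show "(\<integral>\<^sup>+\<omega>. (\<integral>\<^sup>+u. k t u \<omega> * indicator I u \<partial>lborel) * indicator I t \<partial>M) \<le> ennreal C * ennreal R * indicator I t"
      using inner[of t] by (cases "t \<in> I") auto
  qed
  also have "\<dots> = ennreal C * ennreal R * emeasure lborel I" by (rule nn_integral_cmult_indicator) simp
  also have "\<dots> < \<infinity>" using ab by (simp add: I_def ennreal_mult_less_top)
  finally have "(\<integral>\<^sup>+\<omega>. E \<omega> \<partial>M) \<noteq> \<infinity>" by simp
  then have "AE \<omega> in M. E \<omega> \<noteq> \<infinity>" by (intro nn_integral_PInf_AE) auto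
  then show ?thesis unfolding E_def k_def I_def by eventually_elim (simp add: less_top)
qed

text \<open>\<open>z\<close> stands for the path or for its graph. The last condition lets the
  kernel with exponent \<open>\<alpha>\<close> in time and \<open>\<beta>\<close> in space dominate
  the inverse power \<open>s\<close> of the distance between points of the image. The jointly
  measurable version serves for the energy alone; the dimension concerns the given paths.\<close>

lemma AE_dim_ge_of_energy:
  fixes X :: "real \<Rightarrow> 'w \<Rightarrow> real" and z :: "'w \<Rightarrow> real \<Rightarrow> 'b::metric_space"
  assumes M: "sigma_finite_measure M" and Xm: "\<And>t. t \<in> {a..b} \<Longrightarrow> X t \<in> borel_measurable M" and ab: "a < b"
    and cont: "AE \<omega> in M. continuous_on {a..b} (\<lambda>t. X t \<omega>)"
    and mom: "\<And>s t. s \<in> {a..b} \<Longrightarrow> t \<in> {a..b} \<Longrightarrow> s \<noteq> t \<Longrightarrow>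
      (\<integral>\<^sup>+\<omega>. inverse (ennreal (\<bar>X t \<omega> - X s \<omega>\<bar> powr \<beta>)) \<partial>M) \<le> ennreal (C * \<bar>t - s\<bar> powr (- \<kappa>))"
    and C: "0 \<le> C" and exps: "0 \<le> \<alpha> + \<kappa>" "\<alpha> + \<kappa> < 1"
    and zc: "\<And>\<omega>. continuous_on {a..b} (\<lambda>t. X t \<omega>) \<Longrightarrow> continuous_on {a..b} (z \<omega>)"
    and zd: "\<And>\<omega> t u d. t \<in> {a..b} \<Longrightarrow> u \<in> {a..b} \<Longrightarrow> dist (z \<omega> t) (z \<omega> u) \<le> d \<Longrightarrow>
      \<bar>t - u\<bar> powr \<alpha> * \<bar>X t \<omega> - X u \<omega>\<bar> powr \<beta> \<le> d powr s"
  shows "AE \<omega> in M. ereal s \<le> hausdorff_dim (z \<omega> ` {a..b})"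
proof -
  obtain X' where X'm: "case_prod X' \<in> borel_measurable (borel \<Otimes>\<^sub>M M)"
    and X': "AE \<omega> in M. \<forall>t\<in>{a..b}. X' t \<omega> = X t \<omega>"
    by (rule AE_continuous_measurable_version[OF Xm less_imp_le[OF ab] cont]) (assumption, (rule that; assumption))
  have "AE \<omega> in M. (\<integral>\<^sup>+t. (\<integral>\<^sup>+u. inverse (ennreal (\<bar>t - u\<bar> powr \<alpha> * \<bar>X' t \<omega> - X' u \<omega>\<bar> powr \<beta>)) * indicator {a..b} u \<partial>lborel)
      * indicator {a..b} t \<partial>lborel) < \<infinity>"
  proof (rule AE_energy_finite[OF M X'm ab _ C exps])
    fix s t assume st: "s \<in> {a..b}" "t \<in> {a..b}" "s \<noteq> t"
    have "(\<integral>\<^sup>+\<omega>. inverse (ennreal (\<bar>X' t \<omega> - X' s \<omega>\<bar> powr \<beta>)) \<partial>M) = (\<integral>\<^sup>+\<omega>. inverse (ennreal (\<bar>X t \<omega> - X s \<omega>\<bar> powr \<beta>)) \<partial>M)"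
      by (rule nn_integral_cong_AE) (use X' in eventually_elim, use st in simp)
    also have "\<dots> \<le> ennreal (C * \<bar>t - s\<bar> powr (- \<kappa>))" by (rule mom[OF st])
    finally show "(\<integral>\<^sup>+\<omega>. inverse (ennreal (\<bar>X' t \<omega> - X' s \<omega>\<bar> powr \<beta>)) \<partial>M) \<le> ennreal (C * \<bar>t - s\<bar> powr (- \<kappa>))" .
  qed
  with X' cont AE_space show ?thesis
  proof eventually_elim
    case (elim \<omega>)
    have [measurable]: "(\<lambda>t. X' t \<omega>) \<in> borel_measurable borel"
      using measurable_Pair1[OF X'm \<open>\<omega> \<in> space M\<close>] by simp
    have "hausdorff_outer_measure s (z \<omega> ` {a..b}) \<noteq> 0"
    proof (rule hausdorff_outer_measure_nonzero_energy[OF ab zc[OF elim(2)]])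
      show "(\<lambda>(t, u). inverse (ennreal (\<bar>t - u\<bar> powr \<alpha> * \<bar>X' t \<omega> - X' u \<omega>\<bar> powr \<beta>))) \<in> borel_measurable (borel \<Otimes>\<^sub>M borel)"
        by measurable
      fix t u d assume tu: "t \<in> {a..b}" "u \<in> {a..b}" "dist (z \<omega> t) (z \<omega> u) \<le> d"
      show "inverse (ennreal (d powr s)) \<le> inverse (ennreal (\<bar>t - u\<bar> powr \<alpha> * \<bar>X' t \<omega> - X' u \<omega>\<bar> powr \<beta>))"
        using zd[OF tu] elim(1) tu by (intro inverse_ennreal_antimono) auto
    qed (rule elim(4))
    then show ?case by (rule hausdorff_dim_ge_of_nonzero)
  qed
qed

section \<open>Chaining along dyadic points\<close>

text \<open>A point is reached from the left end of its dyadic interval through points of finer and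
  finer levels, with at most one step per level. The costs form a geometric series of ratio
  \<open>(1 / 2) powr \<alpha>\<close>, and continuity carries the bound to the limit.\<close>

lemma dyadic_chaining:
  fixes f :: "real \<Rightarrow> real"
  assumes ab: "a < b" and cont: "continuous_on {a..b} f" and \<alpha>: "0 < \<alpha>" and C: "0 \<le> C"
    and step: "\<And>n i. i < 2 ^ n \<Longrightarrow>
      \<bar>f (a + real (Suc i) * (b - a) / 2 ^ n) - f (a + real i * (b - a) / 2 ^ n)\<bar> \<le> C * (1 / 2 ^ n) powr \<alpha>"
    and i: "i < 2 ^ n" and t: "t \<in> {a + real i * (b - a) / 2 ^ n .. a + (real i + 1) * (b - a) / 2 ^ n}"
  shows "\<bar>f t - f (a + real i * (b - a) / 2 ^ n)\<bar> \<le> C / (1 - (1 / 2) powr \<alpha>) * (1 / 2 ^ n) powr \<alpha>"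
proof -
  define q where "q n i = a + real i * (b - a) / 2 ^ n" for n i
  define r where "r = (1 / 2 :: real) powr \<alpha>"
  have "1 < (2::real) powr \<alpha>" using \<alpha> by (intro gr_one_powr) auto
  then have r: "0 < r" "r < 1" by (auto simp: r_def powr_divide)
  have pr: "(1 / 2 ^ k) powr \<alpha> = r ^ k" for k :: nat
    by (simp add: r_def powr_realpow[symmetric] powr_powr powr_divide mult.commute)
  have qS: "q (Suc n) (2 * i) = q n i" for n i by (simp add: q_def)
  \<comment> \<open>\<open>j\<close> numbers the points of level \<open>n + m\<close> in the
    interval. For positive \<open>m\<close>, an even \<open>j\<close> is already a point of the
    preceding level, and an odd one is a single step away from its left neighbour.\<close>
  have chain: "j \<le> 2 ^ m \<Longrightarrow> \<bar>f (q (n + m) (i * 2 ^ m + j)) - f (q n i)\<bar> \<le> C * (\<Sum>l\<le>m. r ^ (n + l))" for m j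
  proof (induction m arbitrary: j)
    case 0
    then consider "j = 0" | "j = 1" by fastforce
    then show ?case
    proof cases
      case 1
      then show ?thesis using C r by simp
    next
      case 2
      then show ?thesis using step[OF i] by (simp add: q_def pr)
    qed
  next
    case (Suc m)
    define j' where "j' = j div 2"
    have base: "\<bar>f (q (n + Suc m) (i * 2 ^ Suc m + 2 * j')) - f (q n i)\<bar> \<le> C * (\<Sum>l\<le>m. r ^ (n + l))"
    proof -
      have "j' \<le> 2 ^ m" using Suc.prems by (simp add: j'_def)
      moreover have "q (n + Suc m) (i * 2 ^ Suc m + 2 * j') = q (n + m) (i * 2 ^ m + j')"
        using qS[of "n + m" "i * 2 ^ m + j'"] by (simp add: algebra_simps)
      ultimately show ?thesis using Suc.IH by simp
    qed
    have "\<bar>f (q (n + Suc m) (i * 2 ^ Suc m + j)) - f (q (n + Suc m) (i * 2 ^ Suc m + 2 * j'))\<bar> \<le> C * r ^ (n + Suc m)"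
    proof (cases "even j")
      case True
      then have "2 * j' = j" by (simp add: j'_def)
      then show ?thesis using C r by simp
    next
      case False
      then have j: "j = Suc (2 * j')" by (simp add: j'_def)
      have "i * 2 ^ Suc m + 2 * j' < 2 ^ (n + Suc m)"
      proof -
        have "2 * j' < 2 ^ Suc m" using Suc.prems j by simp
        moreover have "(i + 1) * 2 ^ Suc m \<le> 2 ^ n * 2 ^ Suc m" using i by (intro mult_right_mono) auto
        ultimately show ?thesis by (simp add: power_add algebra_simps)
      qed
      from step[OF this] show ?thesis unfolding j q_def pr by (simp add: add.assoc)
    qed
    with base have "\<bar>f (q (n + Suc m) (i * 2 ^ Suc m + j)) - f (q n i)\<bar> \<le> C * (\<Sum>l\<le>m. r ^ (n + l)) + C * r ^ (n + Suc m)"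
      by linarith
    then show ?case by (simp add: distrib_left)
  qed
  have geo: "C * (\<Sum>l\<le>m. r ^ (n + l)) \<le> C / (1 - r) * r ^ n" for m
  proof -
    have "(\<Sum>l\<le>m. r ^ (n + l)) = r ^ n * (\<Sum>l\<le>m. r ^ l)" by (simp add: power_add sum_distrib_left)
    also have "(\<Sum>l\<le>m. r ^ l) = (1 - r ^ Suc m) / (1 - r)"
      using r sum_gp_basic[of r m] by (simp add: field_simps)
    also have "\<dots> \<le> 1 / (1 - r)" using r by (intro divide_right_mono) auto
    finally have "(\<Sum>l\<le>m. r ^ (n + l)) \<le> r ^ n * (1 / (1 - r))" using r by (simp add: mult_left_mono)
    then have "C * (\<Sum>l\<le>m. r ^ (n + l)) \<le> C * (r ^ n * (1 / (1 - r)))" using C by (rule mult_left_mono)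
    then show ?thesis by (simp add: mult_ac)
  qed
  define h where "h m = (b - a) / 2 ^ (n + m)" for m
  have h: "0 < h m" for m using ab by (simp add: h_def)
  \<comment> \<open>Rounding down makes \<open>u m\<close> a point of level \<open>n + m\<close>
    that is at most \<open>t\<close> and within one mesh width \<open>h m\<close> of it.\<close>
  define j where "j m = nat \<lfloor>(t - q n i) / h m\<rfloor>" for m
  define u where "u m = q (n + m) (i * 2 ^ m + j m)" for m
  have q1: "a + (real i + 1) * (b - a) / 2 ^ n = q n i + (b - a) / 2 ^ n"
    by (simp add: q_def field_simps)
  have tq: "0 \<le> t - q n i" "t - q n i \<le> (b - a) / 2 ^ n"
    using t unfolding q1 q_def[symmetric] by auto
  have jr: "real (j m) \<le> (t - q n i) / h m" "(t - q n i) / h m \<le> real (j m) + 1" for m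
  proof -
    have "0 \<le> (t - q n i) / h m" using tq h[of m] by simp
    then show "real (j m) \<le> (t - q n i) / h m" "(t - q n i) / h m \<le> real (j m) + 1" unfolding j_def by linarith+
  qed
  have jle: "j m \<le> 2 ^ m" for m
  proof -
    have "(t - q n i) / h m \<le> ((b - a) / 2 ^ n) / h m" using tq h[of m] by (intro divide_right_mono) auto
    also have "\<dots> = 2 ^ m" using ab by (simp add: h_def power_add)
    finally have "real (j m) \<le> 2 ^ m" using jr(1)[of m] by linarith
    then show ?thesis by (metis of_nat_le_iff of_nat_numeral of_nat_power)
  qed
  have u: "u m = q n i + real (j m) * h m" for m
    by (simp add: u_def q_def h_def power_add field_simps)
  have ut: "u m \<le> t" "t - h m \<le> u m" for m
    using jr[of m] h[of m] by (auto simp: u field_simps)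
  have h0: "h \<longlonglongrightarrow> 0" unfolding h_def power_add by real_asymp
  have ulim: "u \<longlonglongrightarrow> t"
  proof (rule tendsto_sandwich[OF _ _ _ tendsto_const])
    show "(\<lambda>m. t - h m) \<longlonglongrightarrow> t" using tendsto_diff[OF tendsto_const h0] by simp
  qed (use ut in auto)
  have i1: "(real i + 1) / 2 ^ n \<le> 1"
  proof -
    have "real (Suc i) \<le> real (2 ^ n)" using i by (intro of_nat_mono) simp
    then show ?thesis by (simp add: add.commute)
  qed
  have "(real i + 1) * (b - a) / 2 ^ n = (real i + 1) / 2 ^ n * (b - a)" by simp
  also have "\<dots> \<le> 1 * (b - a)" using i1 ab by (intro mult_right_mono) auto
  finally have "t \<le> b" using t by auto
  moreover have aq: "a \<le> q n i" using ab by (simp add: q_def)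
  ultimately have t_ab: "t \<in> {a..b}" using tq by auto
  have u_ab: "u m \<in> {a..b}" for m
  proof -
    have "q n i \<le> u m" using h[of m] by (simp add: u)
    then show ?thesis using aq ut(1)[of m] t_ab by auto
  qed
  have "(\<lambda>m. \<bar>f (u m) - f (q n i)\<bar>) \<longlonglongrightarrow> \<bar>f t - f (q n i)\<bar>"
    by (intro tendsto_intros continuous_on_tendsto_compose[OF cont ulim t_ab always_eventually[OF allI, OF u_ab]])
  moreover have "\<bar>f (u m) - f (q n i)\<bar> \<le> C / (1 - r) * r ^ n" for m
    using chain[OF jle, of m] geo[of m] unfolding u_def by linarith
  ultimately have "\<bar>f t - f (q n i)\<bar> \<le> C / (1 - r) * r ^ n"
    by (intro tendsto_upperbound[where F = sequentially]) auto
  then show ?thesis by (simp add: q_def r_def[symmetric] pr)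
qed

text \<open>All dyadic increments, rescaled by \<open>w n\<close>, are raised to the power
  \<open>2 * k\<close> and added up; level \<open>n\<close> contributes at most
  \<open>K' * \<rho> ^ n\<close> to the mean, with \<open>\<rho> < 1\<close>. A sum with finite mean
  is finite almost surely and bounds each of its terms, which yields one constant for all levels at
  once.\<close>

lemma AE_dyadic_increments:
  fixes X :: "real \<Rightarrow> 'w \<Rightarrow> real"
  assumes Xm: "\<And>t. t \<in> {a..b} \<Longrightarrow> X t \<in> borel_measurable M" and ab: "a < b" and K: "0 \<le> K"
    and mom: "\<And>s t. s \<in> {a..b} \<Longrightarrow> t \<in> {a..b} \<Longrightarrow>
      (\<integral>\<^sup>+\<omega>. ennreal ((X t \<omega> - X s \<omega>) ^ (2 * k)) \<partial>M) \<le> ennreal (K * \<bar>t - s\<bar> powr (2 * real k * \<alpha>))"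
    and k: "1 < 2 * real k * (\<alpha> - \<alpha>')" and \<alpha>': "0 < \<alpha>'"
  shows "AE \<omega> in M. \<exists>C\<ge>0. \<forall>n i. i < 2 ^ n \<longrightarrow>
      \<bar>X (a + real (Suc i) * (b - a) / 2 ^ n) \<omega> - X (a + real i * (b - a) / 2 ^ n) \<omega>\<bar> \<le> C * (1 / 2 ^ n) powr \<alpha>'"
proof -
  define q where "q n i = a + real i * (b - a) / 2 ^ n" for n i
  have qab: "q n i \<in> {a..b}" if "i \<le> 2 ^ n" for n i
  proof -
    have "real i \<le> real (2 ^ n)" using that by (rule of_nat_mono)
    then have "real i / 2 ^ n * (b - a) \<le> 1 * (b - a)" using ab by (intro mult_right_mono) auto
    then show ?thesis using ab by (simp add: q_def)
  qed
  have qd: "\<bar>q n (Suc i) - q n i\<bar> = (b - a) / 2 ^ n" for n i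
    using ab by (simp add: q_def field_simps)
  have k0: "0 < k" using k by (cases "k = 0") auto
  define w where "w n = (2 ^ n :: real) powr \<alpha>'" for n :: nat
  have w: "0 < w n" for n by (simp add: w_def)
  define D where "D n i \<omega> = ennreal ((w n * (X (q n (Suc i)) \<omega> - X (q n i) \<omega>)) ^ (2 * k))" for n i \<omega>
  define S where "S \<omega> = (\<Sum>n. \<Sum>i<2 ^ n. D n i \<omega>)" for \<omega>
  have dm: "(\<lambda>\<omega>. X (q n (Suc i)) \<omega> - X (q n i) \<omega>) \<in> borel_measurable M" if "i < 2 ^ n" for n i
    by (intro borel_measurable_diff Xm qab) (use that in auto)
  have Dm: "D n i \<in> borel_measurable M" if "i < 2 ^ n" for n i
    using dm[OF that] unfolding D_def by measurable
  have Sm: "S \<in> borel_measurable M"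
    unfolding S_def by (intro borel_measurable_suminf_order borel_measurable_sum Dm) auto
  \<comment> \<open>In the exponent, 1 stands for the \<open>2 ^ n\<close> increments of a level,
    and \<open>2 * k * (\<alpha> - \<alpha>')\<close> is what the moment bound gains over the
    rescaling.\<close>
  define \<rho> where "\<rho> = (2 :: real) powr (1 - 2 * real k * (\<alpha> - \<alpha>'))"
  have \<rho>: "0 < \<rho>" "\<rho> < 1" using k by (auto simp: \<rho>_def powr_less_one)
  define K' where "K' = K * (b - a) powr (2 * real k * \<alpha>)"
  have K': "0 \<le> K'" using K by (simp add: K'_def)
  have ED: "(\<integral>\<^sup>+\<omega>. D n i \<omega> \<partial>M) \<le> ennreal (K' * \<rho> ^ n / 2 ^ n)" if i: "i < 2 ^ n" for n i
  proof -
    have m: "(\<lambda>\<omega>. ennreal ((X (q n (Suc i)) \<omega> - X (q n i) \<omega>) ^ (2 * k))) \<in> borel_measurable M"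
      using dm[OF i] by measurable
    have "(\<integral>\<^sup>+\<omega>. D n i \<omega> \<partial>M) = (\<integral>\<^sup>+\<omega>. ennreal (w n ^ (2 * k)) * ennreal ((X (q n (Suc i)) \<omega> - X (q n i) \<omega>) ^ (2 * k)) \<partial>M)"
      unfolding D_def by (intro nn_integral_cong) (simp add: power_mult_distrib ennreal_mult w less_imp_le zero_le_even_power)
    also have "\<dots> = ennreal (w n ^ (2 * k)) * (\<integral>\<^sup>+\<omega>. ennreal ((X (q n (Suc i)) \<omega> - X (q n i) \<omega>) ^ (2 * k)) \<partial>M)"
      by (rule nn_integral_cmult[OF m])
    also have "\<dots> \<le> ennreal (w n ^ (2 * k)) * ennreal (K * ((b - a) / 2 ^ n) powr (2 * real k * \<alpha>))"
      using mom[OF qab qab, of i n "Suc i" n] i unfolding qd by (intro mult_left_mono) auto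
    also have "\<dots> = ennreal (w n ^ (2 * k) * (K * ((b - a) / 2 ^ n) powr (2 * real k * \<alpha>)))"
      using K w[of n] by (simp add: ennreal_mult less_imp_le)
    also have "w n ^ (2 * k) * (K * ((b - a) / 2 ^ n) powr (2 * real k * \<alpha>)) = K' * \<rho> ^ n / 2 ^ n"
    proof -
      have two: "(2::real) ^ n = 2 powr real n" by (simp add: powr_realpow)
      have 1: "w n ^ (2 * k) = 2 powr (real n * (2 * real k * \<alpha>'))"
        unfolding w_def two by (simp add: powr_realpow[symmetric] powr_powr mult_ac)
      have 2: "((b - a) / 2 ^ n) powr (2 * real k * \<alpha>) = (b - a) powr (2 * real k * \<alpha>) * 2 powr (- (real n * (2 * real k * \<alpha>)))"
        unfolding two using ab by (simp add: powr_divide powr_powr powr_minus_divide)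
      have 3: "\<rho> ^ n / 2 ^ n = 2 powr (real n * (1 - 2 * real k * (\<alpha> - \<alpha>')) - real n)"
      proof -
        have "\<rho> ^ n = 2 powr (real n * (1 - 2 * real k * (\<alpha> - \<alpha>')))"
          unfolding \<rho>_def by (subst powr_power) auto
        then show ?thesis unfolding two by (simp only: powr_diff)
      qed
      have "real n * (1 - 2 * real k * (\<alpha> - \<alpha>')) - real n = real n * (2 * real k * \<alpha>') + - (real n * (2 * real k * \<alpha>))"
        by (simp add: algebra_simps)
      then have 4: "\<rho> ^ n / 2 ^ n = 2 powr (real n * (2 * real k * \<alpha>')) * 2 powr (- (real n * (2 * real k * \<alpha>)))"
        unfolding 3 by (simp only: powr_add)
      have "K' * \<rho> ^ n / 2 ^ n = K' * (\<rho> ^ n / 2 ^ n)" by simp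
      then show ?thesis unfolding 1 2 4 K'_def by (simp only: mult_ac)
    qed
    finally show ?thesis .
  qed
  have "(\<integral>\<^sup>+\<omega>. S \<omega> \<partial>M) = (\<Sum>n. \<integral>\<^sup>+\<omega>. (\<Sum>i<2 ^ n. D n i \<omega>) \<partial>M)"
    unfolding S_def by (intro nn_integral_suminf borel_measurable_sum Dm) auto
  also have "\<dots> \<le> (\<Sum>n. ennreal (K' * \<rho> ^ n))"
  proof (intro suminf_le)
    fix n
    have "(\<integral>\<^sup>+\<omega>. (\<Sum>i<2 ^ n. D n i \<omega>) \<partial>M) = (\<Sum>i<2 ^ n. \<integral>\<^sup>+\<omega>. D n i \<omega> \<partial>M)"
      by (intro nn_integral_sum Dm) auto
    also have "\<dots> \<le> (\<Sum>i<(2::nat) ^ n. ennreal (K' * \<rho> ^ n / 2 ^ n))"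
      by (intro sum_mono ED) auto
    also have "\<dots> = ennreal (\<Sum>i<(2::nat) ^ n. K' * \<rho> ^ n / 2 ^ n)"
      using K' \<rho> by (subst sum_ennreal) auto
    also have "(\<Sum>i<(2::nat) ^ n. K' * \<rho> ^ n / 2 ^ n) = K' * \<rho> ^ n" by simp
    finally show "(\<integral>\<^sup>+\<omega>. (\<Sum>i<2 ^ n. D n i \<omega>) \<partial>M) \<le> ennreal (K' * \<rho> ^ n)" .
  qed auto
  also have "\<dots> < \<infinity>"
  proof -
    have "summable (\<lambda>n. K' * \<rho> ^ n)" using \<rho> by (intro summable_mult summable_geometric) simp
    then have "(\<Sum>n. ennreal (K' * \<rho> ^ n)) = ennreal (\<Sum>n. K' * \<rho> ^ n)"
      using K' \<rho> by (intro suminf_ennreal2) auto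
    then show ?thesis by simp
  qed
  finally have "(\<integral>\<^sup>+\<omega>. S \<omega> \<partial>M) \<noteq> \<infinity>" by simp
  then have "AE \<omega> in M. S \<omega> \<noteq> \<infinity>" using Sm by (intro nn_integral_PInf_AE) auto
  then show ?thesis
  proof eventually_elim
    case (elim \<omega>)
    then obtain c where c: "S \<omega> = ennreal c" "0 \<le> c" by (cases "S \<omega>") auto
    have "\<bar>X (q n (Suc i)) \<omega> - X (q n i) \<omega>\<bar> \<le> max 1 c * (1 / 2 ^ n) powr \<alpha>'" if i: "i < 2 ^ n" for n i
    proof -
      define x where "x = w n * \<bar>X (q n (Suc i)) \<omega> - X (q n i) \<omega>\<bar>"
      have x0: "0 \<le> x" using w[of n] by (simp add: x_def)
      have "ennreal (x ^ (2 * k)) = D n i \<omega>"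
        by (simp add: D_def x_def power_mult_distrib power_even_abs)
      also have "\<dots> \<le> (\<Sum>i<2 ^ n. D n i \<omega>)" using i by (intro member_le_sum) auto
      also have "\<dots> \<le> S \<omega>" unfolding S_def
        using sum_le_suminf[of "\<lambda>n. \<Sum>i<2 ^ n. D n i \<omega>" "{n}"] by simp
      finally have xc: "x ^ (2 * k) \<le> c" using c by simp
      \<comment> \<open>Spares the root of order \<open>2 * k\<close>: a number above 1 is at most
        its power.\<close>
      have "x \<le> max 1 c"
      proof (rule ccontr)
        assume "\<not> x \<le> max 1 c"
        then have x: "1 < x" "c < x" by auto
        have "x ^ 1 \<le> x ^ (2 * k)" using x k0 by (intro power_increasing) auto
        then show False using x xc by simp
      qed
      then have "\<bar>X (q n (Suc i)) \<omega> - X (q n i) \<omega>\<bar> \<le> max 1 c / w n"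
        using w[of n] by (simp add: x_def field_simps)
      also have "\<dots> = max 1 c * (1 / 2 ^ n) powr \<alpha>'" by (simp add: w_def powr_divide)
      finally show ?thesis .
    qed
    then show ?case unfolding q_def by (intro exI[of _ "max 1 c"]) auto
  qed
qed

section \<open>Local exponents\<close>

text \<open>Supplies the existence of limits for \<open>sup_quotient\<close> and for the dimensions
  over balls, both of which are monotone in the radius.\<close>

lemma mono_tendsto_INF_at_right:
  fixes F :: "real \<Rightarrow> ereal"
  assumes mono: "\<And>r r'. 0 < r \<Longrightarrow> r \<le> r' \<Longrightarrow> F r \<le> F r'"
  shows "(F \<longlongrightarrow> (INF r\<in>{0<..}. F r)) (at_right 0)"
proof (rule order_tendstoI)
  fix y assume "y < (INF r\<in>{0<..}. F r)"
  then show "eventually (\<lambda>r. y < F r) (at_right 0)"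
    by (intro eventually_mono[OF eventually_at_right_less[of 0]])
      (auto intro: less_le_trans INF_lower)
next
  fix y assume "(INF r\<in>{0<..}. F r) < y"
  then obtain r where r: "0 < r" "F r < y" by (auto simp: INF_less_iff)
  show "eventually (\<lambda>r. F r < y) (at_right 0)"
    unfolding eventually_at_right_field
  proof (intro exI[of _ r] conjI allI impI r(1))
    fix x assume "0 < x" "x < r"
    then show "F x < y" by (intro le_less_trans[OF mono r(2)]) auto
  qed
qed

lemma half_line_ball_mono: "r \<le> r' \<Longrightarrow> half_line_ball t r \<subseteq> half_line_ball t r'"
  by (auto simp: half_line_ball_def)

lemma sup_quotient_mono: "r \<le> r' \<Longrightarrow> sup_quotient h t \<alpha> r \<le> sup_quotient h t \<alpha> r'"
  unfolding sup_quotient_def using half_line_ball_mono[of r r' t] by (intro Sup_subset_mono) blast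

lemma local_hoelder_bound:
  assumes q: "ereal q < local_hoelder_exponent h t\<^sub>0" "0 < q"
  obtains \<delta> L where "0 < \<delta>" "0 \<le> L"
    "\<And>s t. s \<in> half_line_ball t\<^sub>0 \<delta> \<Longrightarrow> t \<in> half_line_ball t\<^sub>0 \<delta> \<Longrightarrow> \<bar>h t - h s\<bar> \<le> L * \<bar>t - s\<bar> powr q"
proof -
  obtain \<alpha> l where \<alpha>: "q < \<alpha>" and l: "l < \<infinity>" and lim: "(sup_quotient h t\<^sub>0 \<alpha> \<longlongrightarrow> l) (at_right 0)"
    using q unfolding local_hoelder_exponent_def less_Sup_iff by auto
  obtain n :: nat where n: "l < ereal (real n)" using l less_PInf_Ex_of_nat by auto
  have "eventually (\<lambda>\<rho>. sup_quotient h t\<^sub>0 \<alpha> \<rho> < ereal (real n)) (at_right 0)"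
    by (rule order_tendstoD(2)[OF lim n])
  then obtain b where b: "0 < b" "\<And>\<rho>. 0 < \<rho> \<Longrightarrow> \<rho> < b \<Longrightarrow> sup_quotient h t\<^sub>0 \<alpha> \<rho> < ereal (real n)"
    unfolding eventually_at_right_field by auto
  \<comment> \<open>The bound \<open>1 / 2\<close> keeps distances within the ball at most 1, so
    that the smaller exponent \<open>q\<close> gives the larger power.\<close>
  define \<delta> where "\<delta> = min (b / 2) (1 / 2)"
  have \<delta>: "0 < \<delta>" "\<delta> < b" "\<delta> \<le> 1 / 2" using b by (auto simp: \<delta>_def)
  show ?thesis
  proof (rule that[OF \<delta>(1), of "real n"])
    fix s t assume st: "s \<in> half_line_ball t\<^sub>0 \<delta>" "t \<in> half_line_ball t\<^sub>0 \<delta>"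
    show "\<bar>h t - h s\<bar> \<le> real n * \<bar>t - s\<bar> powr q"
    proof (cases "s = t")
      case False
      have "ereal (\<bar>h t - h s\<bar> / \<bar>t - s\<bar> powr \<alpha>) \<le> sup_quotient h t\<^sub>0 \<alpha> \<delta>"
        unfolding sup_quotient_def using st False by (intro Sup_upper) auto
      also have "\<dots> < ereal (real n)" by (rule b(2)[OF \<delta>(1,2)])
      finally have "\<bar>h t - h s\<bar> \<le> real n * \<bar>t - s\<bar> powr \<alpha>" using False by (simp add: divide_less_eq)
      also have "\<dots> \<le> real n * \<bar>t - s\<bar> powr q"
      proof (intro mult_left_mono powr_mono')
        have "dist t\<^sub>0 s < \<delta>" "dist t\<^sub>0 t < \<delta>" using st by (auto simp: half_line_ball_def)
        then show "\<bar>t - s\<bar> \<le> 1" using \<delta>(3) unfolding dist_real_def by linarith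
      qed (use \<alpha> in auto)
      finally show ?thesis .
    qed simp
  qed simp
qed

text \<open>The global Hoelder constant bounds the quotient at radius 1, and monotonicity in the
  radius turns this into a finite limit at 0.\<close>

lemma hoelder_le_local_exponent:
  assumes "hoelder_continuous_on \<beta> {0..} h" "0 < \<beta>"
  shows "ereal \<beta> \<le> local_hoelder_exponent h t\<^sub>0"
proof -
  obtain C where C: "\<And>s t. s \<in> {0..} \<Longrightarrow> t \<in> {0..} \<Longrightarrow> \<bar>h t - h s\<bar> \<le> C * \<bar>t - s\<bar> powr \<beta>"
    using assms unfolding hoelder_continuous_on_def by blast
  have "sup_quotient h t\<^sub>0 \<beta> 1 \<le> ereal C"
    unfolding sup_quotient_def
  proof (rule Sup_least)
    fix x assume "x \<in> {ereal (\<bar>h t - h s\<bar> / \<bar>t - s\<bar> powr \<beta>) | s t.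
            s \<in> half_line_ball t\<^sub>0 1 \<and> t \<in> half_line_ball t\<^sub>0 1 \<and> s \<noteq> t}"
    then obtain s t where x: "x = ereal (\<bar>h t - h s\<bar> / \<bar>t - s\<bar> powr \<beta>)" and st: "0 \<le> s" "0 \<le> t" "s \<noteq> t"
      by (auto simp: half_line_ball_def)
    then show "x \<le> ereal C" using C[of s t] by (simp add: divide_le_eq)
  qed
  then have "(INF r\<in>{0<..}. sup_quotient h t\<^sub>0 \<beta> r) < \<infinity>"
    by (intro le_less_trans[OF INF_lower[of 1]]) (auto intro: le_less_trans)
  moreover have "(sup_quotient h t\<^sub>0 \<beta> \<longlongrightarrow> (INF r\<in>{0<..}. sup_quotient h t\<^sub>0 \<beta> r)) (at_right 0)"
    by (intro mono_tendsto_INF_at_right sup_quotient_mono)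
  ultimately show ?thesis
    unfolding local_hoelder_exponent_def using assms(2) by (intro Sup_upper imageI) blast
qed

text \<open>A lower Hoelder bound forces injectivity, hence monotonicity; the \<open>n\<close> increments over a subdivision then add up to at
  least \<open>n * (d / n) powr \<alpha>\<close>, which is unbounded for \<open>\<alpha> < 1\<close>.\<close>

lemma no_lower_hoelder_bound:
  fixes h :: "real \<Rightarrow> real"
  assumes ab: "a < b" and cont: "continuous_on {a..b} h" and \<alpha>: "\<alpha> < 1"
    and lower: "\<And>s t. s \<in> {a..b} \<Longrightarrow> t \<in> {a..b} \<Longrightarrow> s \<noteq> t \<Longrightarrow> \<bar>t - s\<bar> powr \<alpha> \<le> \<bar>h t - h s\<bar>"
  shows False
proof -
  have inj: "inj_on h {a..b}"
  proof (rule inj_onI, rule ccontr)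
    fix s t assume st: "s \<in> {a..b}" "t \<in> {a..b}" "h s = h t" "s \<noteq> t"
    then have "\<bar>t - s\<bar> powr \<alpha> \<le> 0" using lower[of s t] by simp
    then show False using st by simp
  qed
  have between: "(h x < h y \<and> h y < h z) \<or> (h z < h y \<and> h y < h x)" if "a \<le> x" "x < y" "y < z" "z \<le> b" for x y z
    using that by (intro continuous_inj_imp_mono continuous_on_subset[OF cont] inj_on_subset[OF inj]) auto
  define \<sigma> where "\<sigma> = (if h a < h b then 1 else - 1 :: real)"
  have hab: "h a \<noteq> h b" using inj_onD[OF inj, of a b] ab by auto
  \<comment> \<open>By \<open>between\<close>, comparison with both end points gives every increment
    the sign of \<open>h b - h a\<close>.\<close>
  have incr: "0 < \<sigma> * (h y - h x)" if "a \<le> x" "x < y" "y \<le> b" for x y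
  proof -
    have "x = a \<or> a < x" "y = b \<or> y < b" using that by auto
    then show ?thesis
      using between[of a x b] between[of a y b] between[of a x y] between[of x y b] that hab
      by (auto simp: \<sigma>_def split: if_splits)
  qed
  define d where "d = b - a"
  have d: "0 < d" using ab by (simp add: d_def)
  have bound: "real n * (d / real n) powr \<alpha> \<le> \<bar>h b - h a\<bar>" if n: "0 < n" for n :: nat
  proof -
    define x where "x i = a + real i * d / real n" for i
    have xn: "x n = b" "x 0 = a" using n by (auto simp: x_def d_def)
    have step: "(d / real n) powr \<alpha> \<le> \<sigma> * (h (x (Suc i)) - h (x i))" if "i < n" for i
    proof -
      have xi: "x (Suc i) - x i = d / real n" by (simp add: x_def add_divide_distrib distrib_right)
      have "0 < d / real n" using d n by simp
      then have lt: "x i < x (Suc i)" using xi by linarith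
      have "real (Suc i) * d / real n \<le> real n * d / real n"
        using that d by (intro divide_right_mono mult_right_mono of_nat_mono) auto
      then have ub: "x (Suc i) \<le> b" using n by (simp add: x_def d_def)
      have lb: "a \<le> x i" using d by (simp add: x_def)
      have "(d / real n) powr \<alpha> = \<bar>x (Suc i) - x i\<bar> powr \<alpha>" using xi d by simp
      also have "\<dots> \<le> \<bar>h (x (Suc i)) - h (x i)\<bar>" using lt ub lb by (intro lower) auto
      also have "\<dots> = \<bar>\<sigma> * (h (x (Suc i)) - h (x i))\<bar>" by (simp add: \<sigma>_def abs_minus_commute)
      also have "\<dots> = \<sigma> * (h (x (Suc i)) - h (x i))" using incr[OF lb lt ub] by simp
      finally show ?thesis .
    qed
    have "real n * (d / real n) powr \<alpha> = (\<Sum>i<n. (d / real n) powr \<alpha>)" by simp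
    also have "\<dots> \<le> (\<Sum>i<n. \<sigma> * (h (x (Suc i)) - h (x i)))" by (intro sum_mono step) auto
    also have "\<dots> = \<sigma> * (h b - h a)"
      by (simp add: sum_distrib_left[symmetric] sum_lessThan_telescope[of "\<lambda>i. h (x i)"] xn)
    also have "\<dots> \<le> \<bar>h b - h a\<bar>" by (auto simp: \<sigma>_def)
    finally show ?thesis .
  qed
  have "filterlim (\<lambda>n. real n * (d / real n) powr \<alpha>) at_top sequentially"
    using d \<alpha> by real_asymp
  then have "eventually (\<lambda>n. \<bar>h b - h a\<bar> < real n * (d / real n) powr \<alpha> \<and> 0 < n) sequentially"
    by (intro eventually_conj eventually_gt_at_top) (auto simp: filterlim_at_top_dense)
  then obtain n where "\<bar>h b - h a\<bar> < real n * (d / real n) powr \<alpha>" "0 < n"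
    by (auto simp: eventually_sequentially)
  then show False using bound[of n] by simp
qed

lemma local_sub_exponent_ge_1:
  assumes cont: "continuous_on {0..} h" and t0: "0 \<le> t\<^sub>0"
  shows "1 \<le> local_sub_exponent h t\<^sub>0"
proof (rule ccontr)
  assume "\<not> ?thesis"
  then have "local_sub_exponent h t\<^sub>0 < ereal 1" by (simp add: one_ereal_def)
  then obtain \<alpha> where \<alpha>: "\<alpha> < 1" and lim: "(inf_quotient h t\<^sub>0 \<alpha> \<longlongrightarrow> \<infinity>) (at_right 0)"
    unfolding local_sub_exponent_def Inf_less_iff by auto
  have "eventually (\<lambda>\<rho>. ereal 1 < inf_quotient h t\<^sub>0 \<alpha> \<rho>) (at_right 0)"
    using lim by (rule order_tendstoD(1)) simp
  then obtain b where b: "0 < b" "\<And>\<rho>. 0 < \<rho> \<Longrightarrow> \<rho> < b \<Longrightarrow> ereal 1 < inf_quotient h t\<^sub>0 \<alpha> \<rho>"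
    unfolding eventually_at_right_field by auto
  define \<rho> where "\<rho> = b / 2"
  have \<rho>: "0 < \<rho>" "\<rho> < b" using b by (auto simp: \<rho>_def)
  show False
  \<comment> \<open>An interval to the right of \<open>t\<^sub>0\<close> stays in the half-line even
    for \<open>t\<^sub>0 = 0\<close>, and half the radius keeps it inside the open ball.\<close>
  proof (rule no_lower_hoelder_bound[of t\<^sub>0 "t\<^sub>0 + \<rho> / 2" h \<alpha>])
    show "t\<^sub>0 < t\<^sub>0 + \<rho> / 2" using \<rho> by simp
    show "continuous_on {t\<^sub>0..t\<^sub>0 + \<rho> / 2} h" by (rule continuous_on_subset[OF cont]) (use t0 in auto)
    fix s t assume st: "s \<in> {t\<^sub>0..t\<^sub>0 + \<rho> / 2}" "t \<in> {t\<^sub>0..t\<^sub>0 + \<rho> / 2}" "s \<noteq> t"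
    then have "s \<in> half_line_ball t\<^sub>0 \<rho>" "t \<in> half_line_ball t\<^sub>0 \<rho>"
      using \<rho> t0 by (auto simp: half_line_ball_def dist_real_def)
    then have "inf_quotient h t\<^sub>0 \<alpha> \<rho> \<le> ereal (\<bar>h t - h s\<bar> / \<bar>t - s\<bar> powr \<alpha>)"
      unfolding inf_quotient_def using st by (intro Inf_lower) auto
    with b(2)[OF \<rho>] have "ereal 1 < ereal (\<bar>h t - h s\<bar> / \<bar>t - s\<bar> powr \<alpha>)" by (rule less_le_trans)
    then show "\<bar>t - s\<bar> powr \<alpha> \<le> \<bar>h t - h s\<bar>" using st by (simp add: less_divide_eq split: if_splits)
  qed (rule \<alpha>)
qed

section \<open>Sample paths of multifractional Brownian motion\<close>

lemma ereal_le_of_seq: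
  fixes d :: ereal
  assumes "\<And>n. ereal (u n) \<le> d" "u \<longlonglongrightarrow> l"
  shows "ereal l \<le> d"
proof (rule LIMSEQ_le_const2)
  show "(\<lambda>n. ereal (u n)) \<longlonglongrightarrow> ereal l" using assms(2) by simp
qed (use assms(1) in auto)

lemma ereal_ge_of_seq:
  fixes d :: ereal
  assumes "\<And>n. d \<le> ereal (u n)" "u \<longlonglongrightarrow> l"
  shows "d \<le> ereal l"
proof (rule LIMSEQ_le_const)
  show "(\<lambda>n. ereal (u n)) \<longlonglongrightarrow> ereal l" using assms(2) by simp
qed (use assms(1) in auto)

locale multifractional_setting =
  fixes M :: "'w measure" and W :: "real set \<Rightarrow> 'w \<Rightarrow> real" and H :: "real \<Rightarrow> real"
    and X :: "real \<Rightarrow> 'w \<Rightarrow> real" and \<beta> :: real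
  assumes H01: "\<And>t. 0 \<le> t \<Longrightarrow> 0 < H t \<and> H t < 1"
    and \<beta>: "0 < \<beta>" and hoelder: "hoelder_continuous_on \<beta> {0..} H"
    and W: "white_noise M W" and mbm: "multifractional_brownian_motion M W H X"
begin

sublocale prob_space M using W by (simp add: white_noise_def)

lemma wni: "0 \<le> t \<Longrightarrow> fourier_white_noise_integral M W (mbm_kernel (H t) t) (X t)"
  using mbm unfolding multifractional_brownian_motion_def mbm_kernel_def[abs_def] by blast

lemma X_measurable: "0 \<le> t \<Longrightarrow> X t \<in> borel_measurable M"
  using wni[of t] by (auto simp: fourier_white_noise_integral_def white_noise_integral_def)

lemma X_continuous: "0 \<le> a \<Longrightarrow> AE \<omega> in M. continuous_on {a..b} (\<lambda>t. X t \<omega>)"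
  using mbm unfolding multifractional_brownian_motion_def
  by (auto elim!: eventually_mono intro: continuous_on_subset)

lemma hoelder_const:
  obtains C where "0 \<le> C" "\<And>s t. 0 \<le> s \<Longrightarrow> 0 \<le> t \<Longrightarrow> \<bar>H t - H s\<bar> \<le> C * \<bar>t - s\<bar> powr \<beta>"
proof -
  obtain C where C: "\<And>s t. s \<in> {0..} \<Longrightarrow> t \<in> {0..} \<Longrightarrow> \<bar>H t - H s\<bar> \<le> C * \<bar>t - s\<bar> powr \<beta>"
    using hoelder unfolding hoelder_continuous_on_def by blast
  show ?thesis
  proof (rule that[of "max C 0"])
    fix s t :: real assume "0 \<le> s" "0 \<le> t"
    then have "\<bar>H t - H s\<bar> \<le> C * \<bar>t - s\<bar> powr \<beta>" by (intro C) auto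
    also have "\<dots> \<le> max C 0 * \<bar>t - s\<bar> powr \<beta>" by (intro mult_right_mono) auto
    finally show "\<bar>H t - H s\<bar> \<le> max C 0 * \<bar>t - s\<bar> powr \<beta>" .
  qed simp
qed

lemma H_continuous: "continuous_on {0..} H"
proof -
  obtain C where C: "0 \<le> C" "\<And>s t. 0 \<le> s \<Longrightarrow> 0 \<le> t \<Longrightarrow> \<bar>H t - H s\<bar> \<le> C * \<bar>t - s\<bar> powr \<beta>"
    by (rule hoelder_const) (rule that; assumption)
  show ?thesis
  proof (unfold continuous_on_def, intro ballI)
    fix x :: real assume x: "x \<in> {0..}"
    have "((\<lambda>t. C * \<bar>t - x\<bar> powr \<beta>) \<longlongrightarrow> C * \<bar>x - x\<bar> powr \<beta>) (at x within {0..})"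
      using \<beta> by (intro tendsto_intros tendsto_powr') auto
    then have lim: "((\<lambda>t. C * \<bar>t - x\<bar> powr \<beta>) \<longlongrightarrow> 0) (at x within {0..})" by simp
    have "((\<lambda>t. H t - H x) \<longlongrightarrow> 0) (at x within {0..})"
      by (rule Lim_null_comparison[OF _ lim]) (use C(2) x in \<open>auto simp: eventually_at_filter\<close>)
    then show "(H \<longlongrightarrow> H x) (at x within {0..})" by (simp add: LIM_zero_iff)
  qed
qed

section \<open>Moments of increments and dimensions over a fixed interval\<close>

text \<open>The lower bound for the kernels asks that
  \<open>\<bar>H t - H s\<bar> * ln (pi / \<bar>t - s\<bar>)\<close> be small. Any positive Hoelder
  exponent beats the logarithm, so this holds up to some distance \<open>h\<^sub>0\<close>, which
  depends neither on \<open>b\<close> nor on \<open>\<eta>\<close>.\<close>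

lemma increment_negative_moment:
  obtains h\<^sub>0 where "0 < h\<^sub>0" "h\<^sub>0 \<le> 1"
    "\<And>b \<eta>. 0 < b \<Longrightarrow> b < 1 \<Longrightarrow> \<exists>C\<ge>0. \<forall>s t. 0 \<le> s \<longrightarrow> 0 \<le> t \<longrightarrow> s \<noteq> t \<longrightarrow> \<bar>t - s\<bar> \<le> h\<^sub>0 \<longrightarrow> H t \<le> \<eta> \<longrightarrow>
      (\<integral>\<^sup>+\<omega>. inverse (ennreal (\<bar>X t \<omega> - X s \<omega>\<bar> powr b)) \<partial>M) \<le> ennreal (C * \<bar>t - s\<bar> powr (- (b * \<eta>)))"
proof -
  obtain C where C: "0 \<le> C" "\<And>s t. 0 \<le> s \<Longrightarrow> 0 \<le> t \<Longrightarrow> \<bar>H t - H s\<bar> \<le> C * \<bar>t - s\<bar> powr \<beta>"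
    by (rule hoelder_const) (rule that; assumption)
  have "((\<lambda>h. C * (h powr \<beta> * ln (pi / h))) \<longlongrightarrow> C * 0) (at_right 0)"
    using \<beta> by (intro tendsto_mult tendsto_const) real_asymp
  then have "eventually (\<lambda>h. C * (h powr \<beta> * ln (pi / h)) < 1 / 12) (at_right 0)"
    by (intro order_tendstoD(2)) auto
  then obtain h1 where h1: "0 < h1" "\<And>h. 0 < h \<Longrightarrow> h < h1 \<Longrightarrow> C * (h powr \<beta> * ln (pi / h)) < 1 / 12"
    unfolding eventually_at_right_field by auto
  define h0 where "h0 = min (h1 / 2) 1"
  show ?thesis
  proof (rule that[of h0])
    show "0 < h0" "h0 \<le> 1" using h1 by (auto simp: h0_def)
    fix b \<eta> :: real assume b: "0 < b" "b < 1"
    define D where "D = (1 + 2 / (1 - b)) * (8 * pi\<^sup>2) powr (b / 2)"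
    have "(\<integral>\<^sup>+\<omega>. inverse (ennreal (\<bar>X t \<omega> - X s \<omega>\<bar> powr b)) \<partial>M) \<le> ennreal (D * \<bar>t - s\<bar> powr (- (b * \<eta>)))"
      if st: "0 \<le> s" "0 \<le> t" "s \<noteq> t" "\<bar>t - s\<bar> \<le> h0" "H t \<le> \<eta>" for s t
    proof -
      define h where "h = \<bar>t - s\<bar>"
      have h: "0 < h" "h \<le> 1" "h < h1" using st h1 by (auto simp: h_def h0_def)
      have "1 \<le> pi / h" using h pi_gt3 by simp
      then have "\<bar>H t - H s\<bar> * ln (pi / h) \<le> C * h powr \<beta> * ln (pi / h)"
        using C(2)[OF st(1,2)] by (intro mult_right_mono) (auto simp: h_def)
      also have "\<dots> \<le> 1 / 12" using h1(2)[OF h(1,3)] by (simp add: mult.assoc)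
      finally have small: "\<bar>H t - H s\<bar> * ln (pi / \<bar>t - s\<bar>) \<le> 1 / 12" by (simp add: h_def)
      define L where "L = h powr (2 * \<eta>) / (8 * pi\<^sup>2)"
      \<comment> \<open>As \<open>h \<le> 1\<close>, the larger exponent \<open>\<eta>\<close> gives
        the smaller power; this makes the bound uniform in \<open>t\<close>.\<close>
      have "L \<le> h powr (2 * H t) / (8 * pi\<^sup>2)"
        unfolding L_def using h st by (intro divide_right_mono powr_mono') auto
      then have "ennreal L \<le> ennreal (\<bar>t - s\<bar> powr (2 * H t) / (8 * pi\<^sup>2))"
        unfolding h_def by (rule ennreal_leI)
      also have "\<dots> \<le> (\<integral>\<^sup>+\<xi>. ennreal ((cmod (mbm_kernel (H t) t \<xi> - mbm_kernel (H s) s \<xi>))\<^sup>2) \<partial>lborel)"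
        using H01[OF st(2)] h by (intro mbm_kernel_diff_integral_ge small) (auto simp: h_def)
      finally have L: "ennreal L \<le> \<dots>" .
      have L0: "0 < L" using h by (simp add: L_def)
      have "(\<integral>\<^sup>+\<omega>. inverse (ennreal (\<bar>X t \<omega> - X s \<omega>\<bar> powr b)) \<partial>M) \<le> ennreal ((1 + 2 / (1 - b)) * L powr (- b / 2))"
        by (rule fourier_white_noise_integral_diff_negative_moment[OF W wni[OF st(2)] wni[OF st(1)] b L L0])
      also have "L powr (- b / 2) = (8 * pi\<^sup>2) powr (b / 2) * h powr (- (b * \<eta>))"
      proof -
        have "L powr (- b / 2) = (h powr (2 * \<eta>)) powr (- b / 2) / (8 * pi\<^sup>2) powr (- b / 2)"
          unfolding L_def by (rule powr_divide)
        also have "(h powr (2 * \<eta>)) powr (- b / 2) = h powr (- (b * \<eta>))"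
          unfolding powr_powr by (simp add: mult.commute)
        also have "(8 * pi\<^sup>2) powr (- b / 2) = inverse ((8 * pi\<^sup>2) powr (b / 2))"
          unfolding powr_minus[symmetric] by simp
        finally have "L powr (- b / 2) = h powr (- (b * \<eta>)) / inverse ((8 * pi\<^sup>2) powr (b / 2))" .
        also have "x / inverse y = y * x" for x y :: real by (simp add: divide_inverse)
        finally show ?thesis .
      qed
      finally show ?thesis by (simp only: D_def h_def mult.assoc)
    qed
    moreover have "0 \<le> D" using b by (simp add: D_def)
    ultimately show "\<exists>C\<ge>0. \<forall>s t. 0 \<le> s \<longrightarrow> 0 \<le> t \<longrightarrow> s \<noteq> t \<longrightarrow> \<bar>t - s\<bar> \<le> h0 \<longrightarrow> H t \<le> \<eta> \<longrightarrow>
      (\<integral>\<^sup>+\<omega>. inverse (ennreal (\<bar>X t \<omega> - X s \<omega>\<bar> powr b)) \<partial>M) \<le> ennreal (C * \<bar>t - s\<bar> powr (- (b * \<eta>)))" by blast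
  qed
qed

text \<open>For the graph the exponent \<open>\<gamma>\<close> is split into
  \<open>\<gamma> - p\<close> for time and \<open>p\<close> for space. The negative moment of order
  \<open>p\<close> costs \<open>p * \<eta>\<close>, so the energy is finite if
  \<open>\<gamma> - p + p * \<eta> < 1\<close>. For the range all of \<open>\<gamma>\<close> is
  spent on space, and \<open>\<gamma> * \<eta> < 1\<close> suffices.\<close>

lemma AE_dim_ge:
  assumes ab: "0 \<le> a" "a < b" and \<eta>: "\<And>t. t \<in> {a..b} \<Longrightarrow> H t \<le> \<eta>" "\<eta> < 1"
  shows "AE \<omega> in M. ereal (2 - \<eta>) \<le> hausdorff_dim (path_graph X \<omega> {a..b})"
    and "AE \<omega> in M. 1 \<le> hausdorff_dim (path_range X \<omega> {a..b})"
proof -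
  obtain h0 where h0: "0 < h0" "h0 \<le> 1"
    and mom: "\<And>p \<eta>. 0 < p \<Longrightarrow> p < 1 \<Longrightarrow> \<exists>C\<ge>0. \<forall>s t. 0 \<le> s \<longrightarrow> 0 \<le> t \<longrightarrow> s \<noteq> t \<longrightarrow> \<bar>t - s\<bar> \<le> h0 \<longrightarrow> H t \<le> \<eta> \<longrightarrow>
      (\<integral>\<^sup>+\<omega>. inverse (ennreal (\<bar>X t \<omega> - X s \<omega>\<bar> powr p)) \<partial>M) \<le> ennreal (C * \<bar>t - s\<bar> powr (- (p * \<eta>)))"
    by (rule increment_negative_moment) (rule that; assumption)
  \<comment> \<open>The moment bound holds only up to distance \<open>h0\<close>. The interval may
    be shortened because dimension is monotone.\<close>
  define b' where "b' = min b (a + h0)"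
  have b': "a < b'" "b' \<le> b" "b' - a \<le> h0" using ab h0 by (auto simp: b'_def)
  have \<eta>0: "0 < \<eta>" using H01[OF ab(1)] \<eta>(1)[of a] ab by auto
  have Xm: "X t \<in> borel_measurable M" if "t \<in> {a..b'}" for t using that ab by (intro X_measurable) auto
  have cont: "AE \<omega> in M. continuous_on {a..b'} (\<lambda>t. X t \<omega>)" by (rule X_continuous[OF ab(1)])
  have moment: "\<exists>C\<ge>0. \<forall>s t. s \<in> {a..b'} \<longrightarrow> t \<in> {a..b'} \<longrightarrow> s \<noteq> t \<longrightarrow>
      (\<integral>\<^sup>+\<omega>. inverse (ennreal (\<bar>X t \<omega> - X s \<omega>\<bar> powr p)) \<partial>M) \<le> ennreal (C * \<bar>t - s\<bar> powr (- (p * \<eta>)))"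
    if p: "0 < p" "p < 1" for p
  proof -
    obtain C where C: "C \<ge> 0" "\<And>s t. 0 \<le> s \<Longrightarrow> 0 \<le> t \<Longrightarrow> s \<noteq> t \<Longrightarrow> \<bar>t - s\<bar> \<le> h0 \<Longrightarrow> H t \<le> \<eta> \<Longrightarrow>
      (\<integral>\<^sup>+\<omega>. inverse (ennreal (\<bar>X t \<omega> - X s \<omega>\<bar> powr p)) \<partial>M) \<le> ennreal (C * \<bar>t - s\<bar> powr (- (p * \<eta>)))"
      using mom[OF p, of \<eta>] by blast
    show ?thesis
      by (rule exI[of _ C], intro conjI C(1) allI impI, rule C(2)) (use b' ab \<eta>(1) in auto)
  qed
  have graph: "AE \<omega> in M. ereal \<gamma> \<le> hausdorff_dim (path_graph X \<omega> {a..b'})" if \<gamma>: "1 < \<gamma>" "\<gamma> < 2 - \<eta>" for \<gamma>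
  proof -
    \<comment> \<open>Solved for \<open>p\<close>, the energy condition reads \<open>x < p\<close>.
      The midpoint between \<open>x\<close> and 1 satisfies it and keeps the negative moment
      finite.\<close>
    define x where "x = (\<gamma> - 1) / (1 - \<eta>)"
    define p where "p = (x + 1) / 2"
    have "0 < x" "x < 1" using \<gamma> \<eta> by (auto simp: x_def field_simps)
    then have p: "0 < p" "p < 1" "x < p" by (auto simp: p_def)
    have "\<gamma> - 1 < p * (1 - \<eta>)" using p(3) \<eta> by (simp add: x_def field_simps)
    then have ex: "\<gamma> - p + p * \<eta> < 1" by (simp add: algebra_simps)
    have ex0: "0 \<le> \<gamma> - p" using \<gamma> p by simp
    obtain C where C: "C \<ge> 0" "\<And>s t. s \<in> {a..b'} \<Longrightarrow> t \<in> {a..b'} \<Longrightarrow> s \<noteq> t \<Longrightarrow>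
      (\<integral>\<^sup>+\<omega>. inverse (ennreal (\<bar>X t \<omega> - X s \<omega>\<bar> powr p)) \<partial>M) \<le> ennreal (C * \<bar>t - s\<bar> powr (- (p * \<eta>)))"
      using moment[OF p(1,2)] by blast
    show ?thesis unfolding path_graph_def
    proof (rule AE_dim_ge_of_energy[OF sigma_finite_measure_axioms Xm b'(1) cont C(2,1)])
      show "0 \<le> \<gamma> - p + p * \<eta>" using ex0 p \<eta>0 by simp
      show "continuous_on {a..b'} (\<lambda>t. (t, X t \<omega>))" if "continuous_on {a..b'} (\<lambda>t. X t \<omega>)" for \<omega>
        using that by (intro continuous_intros)
      fix \<omega> t u d assume "dist (t, X t \<omega>) (u, X u \<omega>) \<le> d"
      then have d: "\<bar>t - u\<bar> \<le> d" "\<bar>X t \<omega> - X u \<omega>\<bar> \<le> d"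
        using dist_fst_le[of "(t, X t \<omega>)" "(u, X u \<omega>)"] dist_snd_le[of "(t, X t \<omega>)" "(u, X u \<omega>)"]
        by (auto simp: dist_real_def)
      have "\<bar>t - u\<bar> powr (\<gamma> - p) * \<bar>X t \<omega> - X u \<omega>\<bar> powr p \<le> d powr (\<gamma> - p) * d powr p"
        using d ex0 p by (intro mult_mono powr_mono2) auto
      then show "\<bar>t - u\<bar> powr (\<gamma> - p) * \<bar>X t \<omega> - X u \<omega>\<bar> powr p \<le> d powr \<gamma>"
        by (simp add: powr_add[symmetric])
    qed (use ex in auto)
  qed
  have range: "AE \<omega> in M. ereal \<gamma> \<le> hausdorff_dim (path_range X \<omega> {a..b'})" if \<gamma>: "0 < \<gamma>" "\<gamma> < 1" for \<gamma>
  proof -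
    obtain C where C: "C \<ge> 0" "\<And>s t. s \<in> {a..b'} \<Longrightarrow> t \<in> {a..b'} \<Longrightarrow> s \<noteq> t \<Longrightarrow>
      (\<integral>\<^sup>+\<omega>. inverse (ennreal (\<bar>X t \<omega> - X s \<omega>\<bar> powr \<gamma>)) \<partial>M) \<le> ennreal (C * \<bar>t - s\<bar> powr (- (\<gamma> * \<eta>)))"
      using moment[OF \<gamma>] by blast
    have ex: "\<gamma> * \<eta> < 1" using \<gamma> \<eta> \<eta>0 mult_strict_mono[of \<gamma> 1 \<eta> 1] by simp
    show ?thesis unfolding path_range_def
    proof (rule AE_dim_ge_of_energy[OF sigma_finite_measure_axioms Xm b'(1) cont C(2,1), where \<alpha> = 0])
      fix \<omega> t u d assume "dist (X t \<omega>) (X u \<omega>) \<le> d"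
      then have "\<bar>X t \<omega> - X u \<omega>\<bar> powr \<gamma> \<le> d powr \<gamma>"
        using \<gamma> by (intro powr_mono2) (auto simp: dist_real_def)
      \<comment> \<open>Only an inequality, since \<open>0 powr 0 = 0\<close> when the two times
        coincide.\<close>
      moreover have "\<bar>t - u\<bar> powr 0 \<le> 1" by simp
      ultimately have "\<bar>t - u\<bar> powr 0 * \<bar>X t \<omega> - X u \<omega>\<bar> powr \<gamma> \<le> 1 * d powr \<gamma>"
        by (intro mult_mono) auto
      then show "\<bar>t - u\<bar> powr 0 * \<bar>X t \<omega> - X u \<omega>\<bar> powr \<gamma> \<le> d powr \<gamma>" by simp
    qed (use ex \<gamma> \<eta>0 in auto)
  qed
  have sub: "path_graph X \<omega> {a..b'} \<subseteq> path_graph X \<omega> {a..b}" "path_range X \<omega> {a..b'} \<subseteq> path_range X \<omega> {a..b}" for \<omega>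
    using b' unfolding path_graph_def path_range_def by (auto intro!: image_mono)
  \<comment> \<open>Only countably many almost sure statements can be combined; these exponents tend
    to \<open>2 - \<eta>\<close> and stay above 1.\<close>
  have "AE \<omega> in M. \<forall>n::nat. ereal (2 - \<eta> - (1 - \<eta>) / (real n + 2)) \<le> hausdorff_dim (path_graph X \<omega> {a..b'})"
    unfolding AE_all_countable
  proof
    fix n :: nat
    have "(1 - \<eta>) / (real n + 2) < (1 - \<eta>) / 1" using \<eta> by (intro divide_strict_left_mono) auto
    then have "(1 - \<eta>) / (real n + 2) < 1 - \<eta>" by simp
    moreover have "0 < (1 - \<eta>) / (real n + 2)" using \<eta> by simp
    ultimately show "AE \<omega> in M. ereal (2 - \<eta> - (1 - \<eta>) / (real n + 2)) \<le> hausdorff_dim (path_graph X \<omega> {a..b'})"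
      by (intro graph) linarith+
  qed
  then show "AE \<omega> in M. ereal (2 - \<eta>) \<le> hausdorff_dim (path_graph X \<omega> {a..b})"
  proof eventually_elim
    case (elim \<omega>)
    have "(\<lambda>n. 2 - \<eta> - (1 - \<eta>) / (real n + 2)) \<longlonglongrightarrow> 2 - \<eta>" by real_asymp
    then have "ereal (2 - \<eta>) \<le> hausdorff_dim (path_graph X \<omega> {a..b'})"
      by (rule ereal_le_of_seq[OF spec[OF elim]])
    also have "\<dots> \<le> hausdorff_dim (path_graph X \<omega> {a..b})" by (rule hausdorff_dim_mono[OF sub(1)])
    finally show ?case .
  qed
  have "AE \<omega> in M. \<forall>n::nat. ereal (1 - 1 / (real n + 2)) \<le> hausdorff_dim (path_range X \<omega> {a..b'})"
    unfolding AE_all_countable by (intro allI range) auto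
  then show "AE \<omega> in M. 1 \<le> hausdorff_dim (path_range X \<omega> {a..b})"
  proof eventually_elim
    case (elim \<omega>)
    have "(\<lambda>n. 1 - 1 / (real n + 2)) \<longlonglongrightarrow> 1" by real_asymp
    then have "ereal 1 \<le> hausdorff_dim (path_range X \<omega> {a..b'})"
      by (rule ereal_le_of_seq[OF spec[OF elim]])
    also have "\<dots> \<le> hausdorff_dim (path_range X \<omega> {a..b})" by (rule hausdorff_dim_mono[OF sub(2)])
    finally show ?case by (simp add: one_ereal_def)
  qed
qed

text \<open>In the variance bound the terms \<open>\<bar>t - s\<bar> powr (2 * H t)\<close> and
  \<open>(H t - H s)\<^sup>2\<close> compete. Since \<open>\<alpha> \<le> H t\<close> and
  \<open>H\<close> is Hoelder of order \<open>\<alpha>\<close> on the interval, both are at most of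
  order \<open>\<bar>t - s\<bar> powr (2 * \<alpha>)\<close>.\<close>

lemma increment_even_moment:
  assumes ab: "0 \<le> a" "a < b" and L: "0 \<le> L" and HL: "\<And>s t. s \<in> {a..b} \<Longrightarrow> t \<in> {a..b} \<Longrightarrow> \<bar>H t - H s\<bar> \<le> L * \<bar>t - s\<bar> powr \<alpha>"
    and \<alpha>: "\<And>t. t \<in> {a..b} \<Longrightarrow> \<alpha> \<le> H t" "0 < \<alpha>" and k: "0 < k"
  obtains K where "0 \<le> K" "\<And>s t. s \<in> {a..b} \<Longrightarrow> t \<in> {a..b} \<Longrightarrow>
      (\<integral>\<^sup>+\<omega>. ennreal ((X t \<omega> - X s \<omega>) ^ (2 * k)) \<partial>M) \<le> ennreal (K * \<bar>t - s\<bar> powr (2 * real k * \<alpha>))"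
proof -
  have "continuous_on {a..b} H" by (rule continuous_on_subset[OF H_continuous]) (use ab in auto)
  then obtain x where x: "x \<in> {a..b}" "\<And>t. t \<in> {a..b} \<Longrightarrow> H t \<le> H x"
    using continuous_attains_sup[of "{a..b}" H] ab by auto
  define \<eta> where "\<eta> = H x"
  have \<eta>: "\<eta> < 1" using H01[of x] x ab by (auto simp: \<eta>_def)
  obtain K where K: "0 \<le> K"
    "\<And>s t p r. 0 \<le> s \<Longrightarrow> s \<le> b \<Longrightarrow> p \<in> {\<alpha>..\<eta>} \<Longrightarrow> r \<in> {\<alpha>..\<eta>} \<Longrightarrow>
      (\<integral>\<^sup>+\<xi>. ennreal ((cmod (mbm_kernel p t \<xi> - mbm_kernel r s \<xi>))\<^sup>2) \<partial>lborel) \<le>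
        ennreal (K * (\<bar>t - s\<bar> powr (2 * p) + (p - r)\<^sup>2))"
    by (rule mbm_kernel_diff_integral_le[OF \<alpha>(2) \<eta>, of b]) (use ab in simp, (rule that; assumption))
  \<comment> \<open>On intervals longer than 1 the larger exponent \<open>2 * H t\<close> gives the
    larger power. The exponents differ by at most 2, so this constant covers the excess.\<close>
  define D where "D = (max 1 (b - a))\<^sup>2"
  define c where "c = (fact (2 * k) / (2 ^ k * fact k) :: real)"
  have c0: "0 \<le> c" by (simp add: c_def)
  define K2 where "K2 = K * (D + L\<^sup>2)"
  have K2: "0 \<le> K2" using K by (simp add: K2_def D_def)
  show ?thesis
  proof (rule that[of "c * K2 ^ k"])
    show "0 \<le> c * K2 ^ k" using c0 K2 by simp
    fix s t assume st: "s \<in> {a..b}" "t \<in> {a..b}"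
    define y where "y = \<bar>t - s\<bar>"
    have y: "0 \<le> y" "y \<le> b - a" using st by (auto simp: y_def)
    have pr: "H t \<in> {\<alpha>..\<eta>}" "H s \<in> {\<alpha>..\<eta>}" using st \<alpha> x by (auto simp: \<eta>_def)
    have "y powr (2 * H t) \<le> D * y powr (2 * \<alpha>)"
    proof -
      have "y powr (2 * H t) = y powr (2 * (H t - \<alpha>)) * y powr (2 * \<alpha>)"
        by (simp add: powr_add[symmetric] algebra_simps)
      also have "y powr (2 * (H t - \<alpha>)) \<le> max 1 (b - a) powr (2 * (H t - \<alpha>))"
        using y pr by (intro powr_mono2) auto
      also have "\<dots> \<le> max 1 (b - a) powr 2"
        using pr \<eta> \<alpha> by (intro powr_mono) auto
      also have "\<dots> = D" by (simp add: D_def)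
      finally show ?thesis by (simp add: mult_right_mono)
    qed
    moreover have "(H t - H s)\<^sup>2 \<le> L\<^sup>2 * y powr (2 * \<alpha>)"
    proof -
      have "\<bar>H t - H s\<bar>\<^sup>2 \<le> (L * y powr \<alpha>)\<^sup>2"
        unfolding y_def by (intro power_mono HL st) auto
      also have "\<dots> = L\<^sup>2 * y powr (2 * \<alpha>)" by (simp add: power_mult_distrib power2_eq_square[of "_ powr _"] powr_add[symmetric])
      finally show ?thesis by simp
    qed
    ultimately have "K * (y powr (2 * H t) + (H t - H s)\<^sup>2) \<le> K * (D * y powr (2 * \<alpha>) + L\<^sup>2 * y powr (2 * \<alpha>))"
      using K by (intro mult_left_mono add_mono) auto
    also have "\<dots> = K2 * y powr (2 * \<alpha>)" by (simp add: K2_def algebra_simps)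
    finally have U: "K * (y powr (2 * H t) + (H t - H s)\<^sup>2) \<le> K2 * y powr (2 * \<alpha>)" .
    have "(\<integral>\<^sup>+\<xi>. ennreal ((cmod (mbm_kernel (H t) t \<xi> - mbm_kernel (H s) s \<xi>))\<^sup>2) \<partial>lborel) \<le>
        ennreal (K * (y powr (2 * H t) + (H t - H s)\<^sup>2))"
      unfolding y_def using st ab by (intro K(2) pr) auto
    also have "\<dots> \<le> ennreal (K2 * y powr (2 * \<alpha>))" by (rule ennreal_leI[OF U])
    finally have "(\<integral>\<^sup>+\<omega>. ennreal ((X t \<omega> - X s \<omega>) ^ (2 * k)) \<partial>M) \<le> ennreal (c * (K2 * y powr (2 * \<alpha>)) ^ k)"
      unfolding c_def using st ab K2
      by (intro fourier_white_noise_integral_diff_even_moment[OF W wni wni k]) auto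
    also have "c * (K2 * y powr (2 * \<alpha>)) ^ k = c * K2 ^ k * y powr (2 * real k * \<alpha>)"
    proof -
      have "(y powr (2 * \<alpha>)) ^ k = y powr (real k * (2 * \<alpha>))"
        using k by (cases "y = 0") (auto intro: powr_power)
      also have "real k * (2 * \<alpha>) = 2 * real k * \<alpha>" by simp
      finally show ?thesis by (simp only: power_mult_distrib mult.assoc)
    qed
    finally show "(\<integral>\<^sup>+\<omega>. ennreal ((X t \<omega> - X s \<omega>) ^ (2 * k)) \<partial>M) \<le> ennreal (c * K2 ^ k * \<bar>t - s\<bar> powr (2 * real k * \<alpha>))"
      unfolding y_def .
  qed
qed

text \<open>Chaining gives dyadic oscillations of order \<open>\<alpha>'\<close> for every
  \<open>\<alpha>' < \<alpha>\<close>, provided the moment order is high enough; letting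
  \<open>\<alpha>'\<close> increase to \<open>\<alpha>\<close> along a sequence removes the
  loss.\<close>

lemma AE_graph_dim_le:
  assumes ab: "0 \<le> a" "a < b" and L: "0 \<le> L" and HL: "\<And>s t. s \<in> {a..b} \<Longrightarrow> t \<in> {a..b} \<Longrightarrow> \<bar>H t - H s\<bar> \<le> L * \<bar>t - s\<bar> powr \<alpha>"
    and \<alpha>: "\<And>t. t \<in> {a..b} \<Longrightarrow> \<alpha> \<le> H t" "0 < \<alpha>"
  shows "AE \<omega> in M. hausdorff_dim (path_graph X \<omega> {a..b}) \<le> ereal (2 - \<alpha>)"
proof -
  have \<alpha>1: "\<alpha> < 1" using \<alpha>(1)[of a] H01[OF ab(1)] ab by auto
  have one: "AE \<omega> in M. hausdorff_dim (path_graph X \<omega> {a..b}) \<le> ereal (2 - \<alpha>')" if \<alpha>': "0 < \<alpha>'" "\<alpha>' < \<alpha>" for \<alpha>'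
  proof -
    \<comment> \<open>The sum over dyadic increments converges once
      \<open>2 * k * (\<alpha> - \<alpha>') > 1\<close>.\<close>
    obtain k :: nat where k: "1 / (2 * (\<alpha> - \<alpha>')) < real k" using reals_Archimedean2 by blast
    then have k1: "1 < 2 * real k * (\<alpha> - \<alpha>')" using \<alpha>' by (simp add: field_simps)
    then have k0: "0 < k" by (cases "k = 0") auto
    obtain K where K: "0 \<le> K" "\<And>s t. s \<in> {a..b} \<Longrightarrow> t \<in> {a..b} \<Longrightarrow>
      (\<integral>\<^sup>+\<omega>. ennreal ((X t \<omega> - X s \<omega>) ^ (2 * k)) \<partial>M) \<le> ennreal (K * \<bar>t - s\<bar> powr (2 * real k * \<alpha>))"
      by (rule increment_even_moment[OF ab L _ _ \<alpha>(2) k0]) (erule (1) HL, erule \<alpha>(1), (rule that; assumption))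
    have Xm: "X t \<in> borel_measurable M" if "t \<in> {a..b}" for t using that ab by (intro X_measurable) auto
    have "AE \<omega> in M. \<exists>C\<ge>0. \<forall>n i. i < 2 ^ n \<longrightarrow>
      \<bar>X (a + real (Suc i) * (b - a) / 2 ^ n) \<omega> - X (a + real i * (b - a) / 2 ^ n) \<omega>\<bar> \<le> C * (1 / 2 ^ n) powr \<alpha>'"
      by (rule AE_dyadic_increments[OF _ ab(2) K(1) _ k1 \<alpha>'(1)]) (erule Xm, erule (1) K(2))
    then show ?thesis using X_continuous[OF ab(1), of b]
    proof eventually_elim
      case (elim \<omega>)
      then obtain C where C: "0 \<le> C" "\<And>n i. i < 2 ^ n \<Longrightarrow>
        \<bar>X (a + real (Suc i) * (b - a) / 2 ^ n) \<omega> - X (a + real i * (b - a) / 2 ^ n) \<omega>\<bar> \<le> C * (1 / 2 ^ n) powr \<alpha>'"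
        by blast
      have "0 \<le> C / (1 - (1 / 2) powr \<alpha>')"
      proof -
        have "1 < (2::real) powr \<alpha>'" using \<alpha>' by (intro gr_one_powr) auto
        then show ?thesis using C(1) by (simp add: powr_divide)
      qed
      then show ?case unfolding path_graph_def
      proof (rule hausdorff_dim_graph_le[OF ab(2) \<alpha>'(1), rotated])
        show "\<alpha>' \<le> 1" using \<alpha>' \<alpha>1 by simp
        fix n i t assume it: "i < 2 ^ n" "t \<in> {a + real i * (b - a) / 2 ^ n..a + (real i + 1) * (b - a) / 2 ^ n}"
        show "\<bar>X t \<omega> - X (a + real i * (b - a) / 2 ^ n) \<omega>\<bar> \<le> C / (1 - (1 / 2) powr \<alpha>') * (1 / 2 ^ n) powr \<alpha>'"
          by (rule dyadic_chaining[OF ab(2) elim(2) \<alpha>'(1) C(1) _ it]) (erule C(2))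
      qed
    qed
  qed
  have "AE \<omega> in M. \<forall>n::nat. hausdorff_dim (path_graph X \<omega> {a..b}) \<le> ereal (2 - (\<alpha> - \<alpha> / (real n + 2)))"
    unfolding AE_all_countable
  proof
    fix n :: nat
    have "\<alpha> / (real n + 2) < \<alpha> / 1" using \<alpha>(2) by (intro divide_strict_left_mono) auto
    moreover have "0 < \<alpha> / (real n + 2)" using \<alpha>(2) by simp
    ultimately show "AE \<omega> in M. hausdorff_dim (path_graph X \<omega> {a..b}) \<le> ereal (2 - (\<alpha> - \<alpha> / (real n + 2)))"
      by (intro one) linarith+
  qed
  then show ?thesis
  proof eventually_elim
    case (elim \<omega>)
    have "(\<lambda>n. 2 - (\<alpha> - \<alpha> / (real n + 2))) \<longlonglongrightarrow> 2 - \<alpha>" by real_asymp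
    then show ?case by (rule ereal_ge_of_seq[OF spec[OF elim]])
  qed
qed

section \<open>One event for all points\<close>

text \<open>The conditions inside concern \<open>H\<close> and not \<open>\<omega>\<close>, and the
  quantifiers run over countably many rationals. So one almost sure event serves all intervals and
  exponents, and no point \<open>t\<^sub>0\<close> occurs in it.\<close>

definition rational_bounds :: "'w \<Rightarrow> bool" where
  "rational_bounds \<omega> \<longleftrightarrow>
    (\<forall>a b q :: rat. 0 \<le> a \<longrightarrow> a < b \<longrightarrow>
      ((\<forall>t\<in>{real_of_rat a..real_of_rat b}. H t \<le> real_of_rat q) \<longrightarrow> q < 1 \<longrightarrow>
        ereal (2 - real_of_rat q) \<le> hausdorff_dim (path_graph X \<omega> {real_of_rat a..real_of_rat b}) \<and>
        1 \<le> hausdorff_dim (path_range X \<omega> {real_of_rat a..real_of_rat b})) \<and>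
      ((\<forall>t\<in>{real_of_rat a..real_of_rat b}. real_of_rat q \<le> H t) \<longrightarrow> 0 < q \<longrightarrow>
        (\<exists>L\<ge>0. \<forall>s\<in>{real_of_rat a..real_of_rat b}. \<forall>t\<in>{real_of_rat a..real_of_rat b}.
          \<bar>H t - H s\<bar> \<le> L * \<bar>t - s\<bar> powr real_of_rat q) \<longrightarrow>
        hausdorff_dim (path_graph X \<omega> {real_of_rat a..real_of_rat b}) \<le> ereal (2 - real_of_rat q)))"

lemma AE_rational_bounds: "AE \<omega> in M. rational_bounds \<omega>"
  unfolding rational_bounds_def AE_all_countable
proof (intro allI)
  fix a b q :: rat
  let ?a = "real_of_rat a" and ?b = "real_of_rat b" and ?q = "real_of_rat q"
  show "AE \<omega> in M. 0 \<le> a \<longrightarrow> a < b \<longrightarrow>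
      ((\<forall>t\<in>{?a..?b}. H t \<le> ?q) \<longrightarrow> q < 1 \<longrightarrow>
        ereal (2 - ?q) \<le> hausdorff_dim (path_graph X \<omega> {?a..?b}) \<and>
        1 \<le> hausdorff_dim (path_range X \<omega> {?a..?b})) \<and>
      ((\<forall>t\<in>{?a..?b}. ?q \<le> H t) \<longrightarrow> 0 < q \<longrightarrow>
        (\<exists>L\<ge>0. \<forall>s\<in>{?a..?b}. \<forall>t\<in>{?a..?b}. \<bar>H t - H s\<bar> \<le> L * \<bar>t - s\<bar> powr ?q) \<longrightarrow>
        hausdorff_dim (path_graph X \<omega> {?a..?b}) \<le> ereal (2 - ?q))"
  proof (cases "0 \<le> a \<and> a < b")
    case True
    then have ab: "0 \<le> ?a" "?a < ?b" by (auto simp: of_rat_less)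
    have 1: "AE \<omega> in M. (\<forall>t\<in>{?a..?b}. H t \<le> ?q) \<longrightarrow> q < 1 \<longrightarrow>
        ereal (2 - ?q) \<le> hausdorff_dim (path_graph X \<omega> {?a..?b}) \<and>
        1 \<le> hausdorff_dim (path_range X \<omega> {?a..?b})"
    \<comment> \<open>The condition is deterministic: either it holds and the almost sure bound
      applies, or the implication is vacuous for every \<open>\<omega>\<close>.\<close>
    proof (cases "(\<forall>t\<in>{?a..?b}. H t \<le> ?q) \<and> q < 1")
      case True
      then have q: "\<And>t. t \<in> {?a..?b} \<Longrightarrow> H t \<le> ?q" "?q < 1" by auto
      have "AE \<omega> in M. ereal (2 - ?q) \<le> hausdorff_dim (path_graph X \<omega> {?a..?b})"
        by (rule AE_dim_ge(1)[OF ab _ q(2)]) (rule q(1))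
      moreover have "AE \<omega> in M. 1 \<le> hausdorff_dim (path_range X \<omega> {?a..?b})"
        by (rule AE_dim_ge(2)[OF ab _ q(2)]) (rule q(1))
      ultimately show ?thesis by eventually_elim simp
    qed auto
    have 2: "AE \<omega> in M. (\<forall>t\<in>{?a..?b}. ?q \<le> H t) \<longrightarrow> 0 < q \<longrightarrow>
        (\<exists>L\<ge>0. \<forall>s\<in>{?a..?b}. \<forall>t\<in>{?a..?b}. \<bar>H t - H s\<bar> \<le> L * \<bar>t - s\<bar> powr ?q) \<longrightarrow>
        hausdorff_dim (path_graph X \<omega> {?a..?b}) \<le> ereal (2 - ?q)"
    proof (cases "(\<forall>t\<in>{?a..?b}. ?q \<le> H t) \<and> 0 < q \<and>
        (\<exists>L\<ge>0. \<forall>s\<in>{?a..?b}. \<forall>t\<in>{?a..?b}. \<bar>H t - H s\<bar> \<le> L * \<bar>t - s\<bar> powr ?q)")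
      case True
      then obtain L where L: "0 \<le> L" "\<And>s t. s \<in> {?a..?b} \<Longrightarrow> t \<in> {?a..?b} \<Longrightarrow> \<bar>H t - H s\<bar> \<le> L * \<bar>t - s\<bar> powr ?q" by blast
      have q: "\<And>t. t \<in> {?a..?b} \<Longrightarrow> ?q \<le> H t" "0 < ?q" using True by auto
      have "AE \<omega> in M. hausdorff_dim (path_graph X \<omega> {?a..?b}) \<le> ereal (2 - ?q)"
        by (rule AE_graph_dim_le[OF ab L(1) _ _ q(2)]) (erule (1) L(2), erule q(1))
      then show ?thesis by eventually_elim simp
    qed auto
    from 1 2 show ?thesis by eventually_elim blast
  qed auto
qed

lemma H_near:
  assumes t0: "0 \<le> t\<^sub>0" and "0 < e"
  obtains \<delta> where "0 < \<delta>" "\<And>t. 0 \<le> t \<Longrightarrow> \<bar>t - t\<^sub>0\<bar> < \<delta> \<Longrightarrow> \<bar>H t - H t\<^sub>0\<bar> < e"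
proof -
  have "\<forall>e>0. \<exists>d>0. \<forall>x'\<in>{0..}. dist x' t\<^sub>0 < d \<longrightarrow> dist (H x') (H t\<^sub>0) < e"
    using H_continuous t0 unfolding continuous_on_iff by auto
  then obtain d where "0 < d" "\<forall>x'\<in>{0..}. dist x' t\<^sub>0 < d \<longrightarrow> dist (H x') (H t\<^sub>0) < e"
    using \<open>0 < e\<close> by blast
  then show ?thesis using that[of d] by (auto simp: dist_real_def)
qed

text \<open>A lower bound needs just some rational interval inside the ball, so close to
  \<open>t\<^sub>0\<close> that \<open>H\<close> stays below a rational number slightly above
  \<open>H t\<^sub>0\<close>.\<close>

lemma rational_lower:
  assumes \<omega>: "rational_bounds \<omega>" and t0: "0 \<le> t\<^sub>0" and \<rho>: "0 < \<rho>"
  shows "ereal (2 - H t\<^sub>0) \<le> hausdorff_dim (path_graph X \<omega> (half_line_ball t\<^sub>0 \<rho>))"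
    and "1 \<le> hausdorff_dim (path_range X \<omega> (half_line_ball t\<^sub>0 \<rho>))"
proof -
  have main: "ereal (2 - H t\<^sub>0) \<le> hausdorff_dim (path_graph X \<omega> (half_line_ball t\<^sub>0 \<rho>)) + ereal e \<and>
    1 \<le> hausdorff_dim (path_range X \<omega> (half_line_ball t\<^sub>0 \<rho>))" if e: "0 < e" for e
  proof -
    have "H t\<^sub>0 < min 1 (H t\<^sub>0 + e)" using H01[OF t0] e by simp
    then obtain q :: rat where q: "H t\<^sub>0 < real_of_rat q" "real_of_rat q < min 1 (H t\<^sub>0 + e)"
      using of_rat_dense by blast
    have "0 < real_of_rat q - H t\<^sub>0" using q by simp
    then obtain \<delta> where \<delta>: "0 < \<delta>" "\<And>t. 0 \<le> t \<Longrightarrow> \<bar>t - t\<^sub>0\<bar> < \<delta> \<Longrightarrow> \<bar>H t - H t\<^sub>0\<bar> < real_of_rat q - H t\<^sub>0"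
      by (rule H_near[OF t0]) (rule that; assumption)
    have "t\<^sub>0 < t\<^sub>0 + min \<delta> \<rho>" using \<delta> \<rho> by simp
    \<comment> \<open>The interval is placed to the right of \<open>t\<^sub>0\<close>, which keeps
      it in the half-line even for \<open>t\<^sub>0 = 0\<close>.\<close>
    then obtain a :: rat where a: "t\<^sub>0 < real_of_rat a" "real_of_rat a < t\<^sub>0 + min \<delta> \<rho>" using of_rat_dense by blast
    obtain b :: rat where b: "real_of_rat a < real_of_rat b" "real_of_rat b < t\<^sub>0 + min \<delta> \<rho>" using of_rat_dense[OF a(2)] by blast
    let ?I = "{real_of_rat a..real_of_rat b}"
    have ab: "0 \<le> a" "a < b"
    proof -
      have "0 < real_of_rat a" by (rule le_less_trans[OF t0 a(1)])
      then show "0 \<le> a" by simp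
      show "a < b" using b by (simp add: of_rat_less)
    qed
    have "\<forall>t\<in>?I. H t \<le> real_of_rat q"
    proof
      fix t assume "t \<in> ?I"
      then have "0 \<le> t" "\<bar>t - t\<^sub>0\<bar> < \<delta>" using a b t0 by auto
      then show "H t \<le> real_of_rat q" using \<delta>(2)[of t] by linarith
    qed
    moreover have "q < 1" using q by simp
    ultimately have "ereal (2 - real_of_rat q) \<le> hausdorff_dim (path_graph X \<omega> ?I)"
      and r: "1 \<le> hausdorff_dim (path_range X \<omega> ?I)"
      using \<omega> ab unfolding rational_bounds_def by blast+
    moreover have sub: "?I \<subseteq> half_line_ball t\<^sub>0 \<rho>"
    proof
      fix t assume "t \<in> ?I"
      then have "t\<^sub>0 < t" "t < t\<^sub>0 + \<rho>" using a b by auto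
      then show "t \<in> half_line_ball t\<^sub>0 \<rho>" using t0 by (auto simp: half_line_ball_def dist_real_def)
    qed
    moreover have "hausdorff_dim (path_graph X \<omega> ?I) \<le> hausdorff_dim (path_graph X \<omega> (half_line_ball t\<^sub>0 \<rho>))"
      unfolding path_graph_def by (intro hausdorff_dim_mono image_mono sub)
    moreover have "hausdorff_dim (path_range X \<omega> ?I) \<le> hausdorff_dim (path_range X \<omega> (half_line_ball t\<^sub>0 \<rho>))"
      unfolding path_range_def by (intro hausdorff_dim_mono image_mono sub)
    ultimately have g: "ereal (2 - real_of_rat q) \<le> hausdorff_dim (path_graph X \<omega> (half_line_ball t\<^sub>0 \<rho>))"
      and "1 \<le> hausdorff_dim (path_range X \<omega> (half_line_ball t\<^sub>0 \<rho>))" by (blast intro: order_trans)+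
    have "ereal (2 - H t\<^sub>0) \<le> ereal (2 - real_of_rat q) + ereal e" using q by simp
    also have "\<dots> \<le> hausdorff_dim (path_graph X \<omega> (half_line_ball t\<^sub>0 \<rho>)) + ereal e" by (intro add_right_mono g)
    finally show ?thesis using \<open>1 \<le> hausdorff_dim (path_range X \<omega> (half_line_ball t\<^sub>0 \<rho>))\<close> by blast
  qed
  show "ereal (2 - H t\<^sub>0) \<le> hausdorff_dim (path_graph X \<omega> (half_line_ball t\<^sub>0 \<rho>))"
    by (rule ereal_le_epsilon2) (use main in blast)
  show "1 \<le> hausdorff_dim (path_range X \<omega> (half_line_ball t\<^sub>0 \<rho>))" using main[of 1] by simp
qed

text \<open>An upper bound needs a rational interval that contains a whole ball around
  \<open>t\<^sub>0\<close>, yet is short enough for the Hoelder bound to hold and for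
  \<open>H\<close> to stay above \<open>q\<close> on it.\<close>

lemma rational_upper:
  assumes \<omega>: "rational_bounds \<omega>" and t0: "0 \<le> t\<^sub>0" and q: "0 < real_of_rat q" "real_of_rat q < H t\<^sub>0"
    and \<delta>: "0 < \<delta>" and L: "0 \<le> L"
      "\<And>s t. s \<in> half_line_ball t\<^sub>0 \<delta> \<Longrightarrow> t \<in> half_line_ball t\<^sub>0 \<delta> \<Longrightarrow> \<bar>H t - H s\<bar> \<le> L * \<bar>t - s\<bar> powr real_of_rat q"
  obtains \<rho> where "0 < \<rho>" "hausdorff_dim (path_graph X \<omega> (half_line_ball t\<^sub>0 \<rho>)) \<le> ereal (2 - real_of_rat q)"
proof -
  have "0 < H t\<^sub>0 - real_of_rat q" using q by simp
  then obtain \<delta>' where \<delta>': "0 < \<delta>'" "\<And>t. 0 \<le> t \<Longrightarrow> \<bar>t - t\<^sub>0\<bar> < \<delta>' \<Longrightarrow> \<bar>H t - H t\<^sub>0\<bar> < H t\<^sub>0 - real_of_rat q"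
    by (rule H_near[OF t0]) (rule that; assumption)
  define e where "e = min \<delta> \<delta>'"
  have e: "0 < e" using \<delta> \<delta>' by (simp add: e_def)
  obtain b :: rat where b: "t\<^sub>0 < real_of_rat b" "real_of_rat b < t\<^sub>0 + e" using of_rat_dense[of "t\<^sub>0" "t\<^sub>0 + e"] e by auto
  obtain a :: rat and \<rho> where a: "0 \<le> a" "real_of_rat a \<le> t\<^sub>0" "t\<^sub>0 - e < real_of_rat a" "0 < \<rho>"
    "half_line_ball t\<^sub>0 \<rho> \<subseteq> {real_of_rat a..real_of_rat b}"
  \<comment> \<open>At the boundary the ball is one-sided and the interval can start at
    \<open>t\<^sub>0\<close> itself; elsewhere a rational left end strictly below
    \<open>t\<^sub>0\<close> is chosen.\<close>
  proof (cases "t\<^sub>0 = 0")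
    case True
    show ?thesis
    proof (rule that[of 0 "real_of_rat b"])
      show "0 < real_of_rat b" using b(1) unfolding True .
      show "t\<^sub>0 - e < real_of_rat 0" using True e by simp
      show "half_line_ball t\<^sub>0 (real_of_rat b) \<subseteq> {real_of_rat 0..real_of_rat b}"
        using True by (auto simp: half_line_ball_def dist_real_def)
    qed (use True in auto)
  next
    case False
    then have "max 0 (t\<^sub>0 - e) < t\<^sub>0" using t0 e by auto
    then obtain a :: rat where a: "max 0 (t\<^sub>0 - e) < real_of_rat a" "real_of_rat a < t\<^sub>0" using of_rat_dense by blast
    show ?thesis
    proof (rule that[of a "min (t\<^sub>0 - real_of_rat a) (real_of_rat b - t\<^sub>0)"])
      have "0 < real_of_rat a" using a by simp
      then show "0 \<le> a" by simp
      show "half_line_ball t\<^sub>0 (min (t\<^sub>0 - real_of_rat a) (real_of_rat b - t\<^sub>0)) \<subseteq> {real_of_rat a..real_of_rat b}"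
        by (auto simp: half_line_ball_def dist_real_def abs_le_iff)
    qed (use a b in auto)
  qed
  let ?I = "{real_of_rat a..real_of_rat b}"
  have "real_of_rat a < real_of_rat b" using a b by simp
  then have ab: "a < b" by (simp add: of_rat_less)
  have a0: "0 \<le> real_of_rat a" using a(1) by simp
  have I: "0 \<le> t \<and> \<bar>t - t\<^sub>0\<bar> < e" if "t \<in> ?I" for t
  proof
    have t: "real_of_rat a \<le> t" "t \<le> real_of_rat b" using that by auto
    show "0 \<le> t" by (rule order_trans[OF a0 t(1)])
    show "\<bar>t - t\<^sub>0\<bar> < e" using t a(2,3) b by linarith
  qed
  have 1: "\<forall>t\<in>?I. real_of_rat q \<le> H t"
  proof
    fix t assume "t \<in> ?I"
    then show "real_of_rat q \<le> H t" using I[of t] \<delta>'(2)[of t] unfolding e_def by linarith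
  qed
  have Ib: "t \<in> half_line_ball t\<^sub>0 \<delta>" if "t \<in> ?I" for t
    using I[OF that] by (auto simp: half_line_ball_def dist_real_def e_def)
  have 2: "\<exists>L\<ge>0. \<forall>s\<in>?I. \<forall>t\<in>?I. \<bar>H t - H s\<bar> \<le> L * \<bar>t - s\<bar> powr real_of_rat q"
    using L Ib by blast
  have q0: "0 < q" using q by simp
  have "hausdorff_dim (path_graph X \<omega> ?I) \<le> ereal (2 - real_of_rat q)"
    using \<omega> a(1) ab q0 1 2 unfolding rational_bounds_def by blast
  moreover have "hausdorff_dim (path_graph X \<omega> (half_line_ball t\<^sub>0 \<rho>)) \<le> hausdorff_dim (path_graph X \<omega> ?I)"
    unfolding path_graph_def by (intro hausdorff_dim_mono image_mono a(5))
  ultimately show ?thesis using that[OF a(4)] by (blast intro: order_trans)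
qed

text \<open>Common to the first two cases: \<open>m\<close> is \<open>H t\<^sub>0\<close> if the
  local Hoelder exponent exceeds it, and the local exponent if that is smaller. Monotonicity in the
  radius gives the limit, and a rational \<open>q\<close> slightly below \<open>m\<close> gives its
  upper bound.\<close>

lemma graph_limit_bounds:
  assumes \<omega>: "rational_bounds \<omega>" and t0: "0 \<le> t\<^sub>0" and m: "0 < m" "m \<le> H t\<^sub>0"
    and hold: "\<And>q. 0 < q \<Longrightarrow> q < m \<Longrightarrow> \<exists>\<delta> L. 0 < \<delta> \<and> 0 \<le> L \<and>
      (\<forall>s\<in>half_line_ball t\<^sub>0 \<delta>. \<forall>t\<in>half_line_ball t\<^sub>0 \<delta>. \<bar>H t - H s\<bar> \<le> L * \<bar>t - s\<bar> powr q)"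
  shows "\<exists>l. ((\<lambda>\<rho>. hausdorff_dim (path_graph X \<omega> (half_line_ball t\<^sub>0 \<rho>))) \<longlongrightarrow> l) (at_right 0) \<and>
    ereal (2 - H t\<^sub>0) \<le> l \<and> l \<le> ereal (2 - m)"
proof -
  define F where "F \<rho> = hausdorff_dim (path_graph X \<omega> (half_line_ball t\<^sub>0 \<rho>))" for \<rho>
  define l where "l = (INF r\<in>{0<..}. F r)"
  have "(F \<longlongrightarrow> l) (at_right 0)"
    unfolding l_def F_def path_graph_def
    by (intro mono_tendsto_INF_at_right hausdorff_dim_mono image_mono half_line_ball_mono)
  moreover have "ereal (2 - H t\<^sub>0) \<le> l"
    unfolding l_def F_def by (intro INF_greatest rational_lower(1)[OF \<omega> t0]) simp
  moreover have "l \<le> ereal (2 - m)"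
  proof (rule ereal_le_epsilon2)
    fix e :: real assume e: "0 < e"
    have "max 0 (m - e) < m" using m e by simp
    then obtain q :: rat where q: "max 0 (m - e) < real_of_rat q" "real_of_rat q < m" using of_rat_dense by blast
    then have q': "0 < real_of_rat q" "real_of_rat q < H t\<^sub>0" using m by auto
    obtain \<delta> L where \<delta>: "0 < \<delta>" "0 \<le> L"
      "\<And>s t. s \<in> half_line_ball t\<^sub>0 \<delta> \<Longrightarrow> t \<in> half_line_ball t\<^sub>0 \<delta> \<Longrightarrow> \<bar>H t - H s\<bar> \<le> L * \<bar>t - s\<bar> powr real_of_rat q"
      using hold[OF q'(1) q(2)] by blast
    obtain \<rho> where \<rho>0: "0 < \<rho>" "hausdorff_dim (path_graph X \<omega> (half_line_ball t\<^sub>0 \<rho>)) \<le> ereal (2 - real_of_rat q)"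
      by (rule rational_upper[OF \<omega> t0 q' \<delta>(1,2)]) (erule (1) \<delta>(3), (rule that; assumption))
    have \<rho>: "0 < \<rho>" "F \<rho> \<le> ereal (2 - real_of_rat q)" using \<rho>0 by (auto simp: F_def)
    have "l \<le> F \<rho>" unfolding l_def using \<rho>(1) by (intro INF_lower) simp
    also note \<rho>(2)
    also have "ereal (2 - real_of_rat q) \<le> ereal (2 - m) + ereal e" using q by simp
    finally show "l \<le> ereal (2 - m) + ereal e" .
  qed
  ultimately show ?thesis unfolding F_def by blast
qed

text \<open>The dimension is 1 at every radius: a continuous path is bounded on the ball, so its
  range there has dimension at most 1, and the rational intervals supply the lower bound.\<close>

lemma range_limit:
  assumes \<omega>: "rational_bounds \<omega>" and cont: "continuous_on {0..} (\<lambda>t. X t \<omega>)" and t0: "0 \<le> t\<^sub>0"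
  shows "((\<lambda>\<rho>. hausdorff_dim (path_range X \<omega> (half_line_ball t\<^sub>0 \<rho>))) \<longlongrightarrow> 1) (at_right 0)"
proof -
  have eq: "hausdorff_dim (path_range X \<omega> (half_line_ball t\<^sub>0 \<rho>)) = 1" if \<rho>: "0 < \<rho>" for \<rho>
  proof (rule antisym)
    have "compact ((\<lambda>t. X t \<omega>) ` {0..t\<^sub>0 + \<rho>})"
      by (intro compact_continuous_image continuous_on_subset[OF cont]) auto
    from compact_imp_bounded[OF this]
    obtain c where "\<forall>x\<in>(\<lambda>t. X t \<omega>) ` {0..t\<^sub>0 + \<rho>}. \<bar>x\<bar> \<le> c"
      unfolding bounded_real ..
    note c = this[rule_format]
    have sub: "half_line_ball t\<^sub>0 \<rho> \<subseteq> {0..t\<^sub>0 + \<rho>}" by (auto simp: half_line_ball_def dist_real_def)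
    have "path_range X \<omega> (half_line_ball t\<^sub>0 \<rho>) \<subseteq> {-c..c}"
    proof
      fix x assume "x \<in> path_range X \<omega> (half_line_ball t\<^sub>0 \<rho>)"
      then have "x \<in> (\<lambda>t. X t \<omega>) ` {0..t\<^sub>0 + \<rho>}" unfolding path_range_def using sub by blast
      from c[OF this] show "x \<in> {-c..c}" by (auto simp: abs_le_iff)
    qed
    then show "hausdorff_dim (path_range X \<omega> (half_line_ball t\<^sub>0 \<rho>)) \<le> 1" by (rule hausdorff_dim_real_bounded_le_1)
    show "1 \<le> hausdorff_dim (path_range X \<omega> (half_line_ball t\<^sub>0 \<rho>))" by (rule rational_lower(2)[OF \<omega> t0 \<rho>])
  qed
  show ?thesis
    by (rule tendsto_eventually) (rule eventually_mono[OF eventually_at_right_less[of 0]], rule eq)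
qed

end

lemma two_minus_ereal: "2 - ereal x = ereal (2 - x)"
  by (metis ereal_minus(1) numeral_eq_ereal)

theorem proposition3p6:
  fixes M :: "'w measure"
    and W :: "real set \<Rightarrow> 'w \<Rightarrow> real"
    and H :: "real \<Rightarrow> real"
    and X :: "real \<Rightarrow> 'w \<Rightarrow> real"
    and \<beta> :: real
  assumes "\<And>t. 0 \<le> t \<Longrightarrow> 0 < H t \<and> H t < 1"
    and "0 < \<beta>"
    and "hoelder_continuous_on \<beta> {0..} H"
    and "white_noise M W"
    and "multifractional_brownian_motion M W H X"
  shows "(\<forall>t\<^sub>0\<ge>0.
            ereal (H t\<^sub>0) < local_hoelder_exponent H t\<^sub>0 \<and>
            local_hoelder_exponent H t\<^sub>0 \<le> local_sub_exponent H t\<^sub>0 \<longrightarrow>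
            (AE \<omega> in M. ((\<lambda>\<rho>. hausdorff_dim (path_graph X \<omega> (half_line_ball t\<^sub>0 \<rho>)))
               \<longlongrightarrow> 2 - ereal (H t\<^sub>0)) (at_right 0)))
       \<and> (\<forall>t\<^sub>0\<ge>0.
            local_hoelder_exponent H t\<^sub>0 < ereal (H t\<^sub>0) \<and>
            ereal (H t\<^sub>0) \<le> local_sub_exponent H t\<^sub>0 \<longrightarrow>
            (AE \<omega> in M. \<exists>L. ((\<lambda>\<rho>. hausdorff_dim (path_graph X \<omega> (half_line_ball t\<^sub>0 \<rho>)))
                 \<longlongrightarrow> L) (at_right 0) \<and>
               2 - ereal (H t\<^sub>0) \<le> L \<and> L \<le> 2 - local_hoelder_exponent H t\<^sub>0))
       \<and> (\<forall>t\<^sub>0\<ge>0.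
            local_hoelder_exponent H t\<^sub>0 \<le> local_sub_exponent H t\<^sub>0 \<and>
            local_sub_exponent H t\<^sub>0 < ereal (H t\<^sub>0) \<longrightarrow>
            (AE \<omega> in M. \<exists>L. ((\<lambda>\<rho>. hausdorff_dim (path_graph X \<omega> (half_line_ball t\<^sub>0 \<rho>)))
                 \<longlongrightarrow> L) (at_right 0) \<and>
               2 - local_sub_exponent H t\<^sub>0 \<le> L \<and> L \<le> 2 - local_hoelder_exponent H t\<^sub>0))
       \<and> (AE \<omega> in M. \<forall>t\<^sub>0\<ge>0.
            ((\<lambda>\<rho>. hausdorff_dim (path_range X \<omega> (half_line_ball t\<^sub>0 \<rho>))) \<longlongrightarrow> 1) (at_right 0))
       \<and> ((\<forall>t\<ge>0. H t < \<beta>) \<longrightarrow>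
          (AE \<omega> in M. \<forall>t\<^sub>0\<ge>0.
            ((\<lambda>\<rho>. hausdorff_dim (path_graph X \<omega> (half_line_ball t\<^sub>0 \<rho>)))
               \<longlongrightarrow> 2 - ereal (H t\<^sub>0)) (at_right 0)))"
proof -
  interpret multifractional_setting M W H X \<beta>
    using assms by unfold_locales
  \<comment> \<open>Stated for every \<open>\<omega>\<close> in the common event, so that it serves
    a fixed point and all points simultaneously. With \<open>m = H t\<^sub>0\<close> the two bounds
    of \<open>graph_limit_bounds\<close> coincide.\<close>
  have exact: "((\<lambda>\<rho>. hausdorff_dim (path_graph X \<omega> (half_line_ball t\<^sub>0 \<rho>))) \<longlongrightarrow> 2 - ereal (H t\<^sub>0)) (at_right 0)"
    if \<omega>: "rational_bounds \<omega>" and t0: "0 \<le> t\<^sub>0" and lt: "ereal (H t\<^sub>0) < local_hoelder_exponent H t\<^sub>0" for \<omega> t\<^sub>0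
  proof -
    have "\<exists>\<delta> L. 0 < \<delta> \<and> 0 \<le> L \<and>
      (\<forall>s\<in>half_line_ball t\<^sub>0 \<delta>. \<forall>t\<in>half_line_ball t\<^sub>0 \<delta>. \<bar>H t - H s\<bar> \<le> L * \<bar>t - s\<bar> powr q)"
      if q: "0 < q" "q < H t\<^sub>0" for q
    proof -
      have "ereal q < local_hoelder_exponent H t\<^sub>0" by (rule less_trans[OF _ lt]) (use q in simp)
      then obtain \<delta> L where "0 < \<delta>" "0 \<le> L"
        "\<And>s t. s \<in> half_line_ball t\<^sub>0 \<delta> \<Longrightarrow> t \<in> half_line_ball t\<^sub>0 \<delta> \<Longrightarrow> \<bar>H t - H s\<bar> \<le> L * \<bar>t - s\<bar> powr q"
        by (rule local_hoelder_bound[OF _ q(1)]) (rule that; assumption)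
      then show ?thesis by blast
    qed
    from graph_limit_bounds[OF \<omega> t0 _ order_refl this] H01[OF t0]
    obtain l where "((\<lambda>\<rho>. hausdorff_dim (path_graph X \<omega> (half_line_ball t\<^sub>0 \<rho>))) \<longlongrightarrow> l) (at_right 0)"
      "ereal (2 - H t\<^sub>0) \<le> l" "l \<le> ereal (2 - H t\<^sub>0)" by blast
    then show ?thesis by (metis antisym two_minus_ereal)
  qed
  have i: "AE \<omega> in M. ((\<lambda>\<rho>. hausdorff_dim (path_graph X \<omega> (half_line_ball t\<^sub>0 \<rho>))) \<longlongrightarrow> 2 - ereal (H t\<^sub>0)) (at_right 0)"
    if "0 \<le> t\<^sub>0" "ereal (H t\<^sub>0) < local_hoelder_exponent H t\<^sub>0" for t\<^sub>0
    using AE_rational_bounds by eventually_elim (rule exact[OF _ that])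
  have ii: "AE \<omega> in M. \<exists>L. ((\<lambda>\<rho>. hausdorff_dim (path_graph X \<omega> (half_line_ball t\<^sub>0 \<rho>))) \<longlongrightarrow> L) (at_right 0) \<and>
      2 - ereal (H t\<^sub>0) \<le> L \<and> L \<le> 2 - local_hoelder_exponent H t\<^sub>0"
    if t0: "0 \<le> t\<^sub>0" and lt: "local_hoelder_exponent H t\<^sub>0 < ereal (H t\<^sub>0)" for t\<^sub>0
  proof -
    \<comment> \<open>The global Hoelder condition makes the local exponent positive. Being below
      \<open>H t\<^sub>0\<close> it is finite too, hence a real number that can serve as
      \<open>m\<close>.\<close>
    have ge: "ereal \<beta> \<le> local_hoelder_exponent H t\<^sub>0" by (rule hoelder_le_local_exponent[OF hoelder \<beta>])
    then obtain m where m: "local_hoelder_exponent H t\<^sub>0 = ereal m"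
      using lt by (cases "local_hoelder_exponent H t\<^sub>0") auto
    have m0: "0 < m" "m \<le> H t\<^sub>0" using ge lt \<beta> by (auto simp: m)
    have hold: "\<exists>\<delta> L. 0 < \<delta> \<and> 0 \<le> L \<and>
      (\<forall>s\<in>half_line_ball t\<^sub>0 \<delta>. \<forall>t\<in>half_line_ball t\<^sub>0 \<delta>. \<bar>H t - H s\<bar> \<le> L * \<bar>t - s\<bar> powr q)"
      if q: "0 < q" "q < m" for q
    proof -
      have "ereal q < local_hoelder_exponent H t\<^sub>0" using q m by simp
      then obtain \<delta> L where "0 < \<delta>" "0 \<le> L"
        "\<And>s t. s \<in> half_line_ball t\<^sub>0 \<delta> \<Longrightarrow> t \<in> half_line_ball t\<^sub>0 \<delta> \<Longrightarrow> \<bar>H t - H s\<bar> \<le> L * \<bar>t - s\<bar> powr q"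
        by (rule local_hoelder_bound[OF _ q(1)]) (rule that; assumption)
      then show ?thesis by blast
    qed
    show ?thesis
      unfolding m two_minus_ereal
      using AE_rational_bounds by eventually_elim (rule graph_limit_bounds[OF _ t0 m0 hold])
  qed
  \<comment> \<open>\<open>H\<close> stays below 1, whereas the local sub-exponent of a continuous
    function is at least 1.\<close>
  have iii: False if "0 \<le> t\<^sub>0" "local_sub_exponent H t\<^sub>0 < ereal (H t\<^sub>0)" for t\<^sub>0
  proof -
    have "1 \<le> local_sub_exponent H t\<^sub>0" by (rule local_sub_exponent_ge_1[OF H_continuous that(1)])
    then have "1 < ereal (H t\<^sub>0)" using that(2) by (rule le_less_trans)
    then show False using H01[OF that(1)] by simp
  qed
  have range: "AE \<omega> in M. \<forall>t\<^sub>0\<ge>0. ((\<lambda>\<rho>. hausdorff_dim (path_range X \<omega> (half_line_ball t\<^sub>0 \<rho>))) \<longlongrightarrow> 1) (at_right 0)"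
  proof -
    have "AE \<omega> in M. continuous_on {0..} (\<lambda>t. X t \<omega>)"
      using mbm unfolding multifractional_brownian_motion_def by blast
    with AE_rational_bounds show ?thesis by eventually_elim (blast intro: range_limit)
  qed
  have last: "AE \<omega> in M. \<forall>t\<^sub>0\<ge>0. ((\<lambda>\<rho>. hausdorff_dim (path_graph X \<omega> (half_line_ball t\<^sub>0 \<rho>))) \<longlongrightarrow> 2 - ereal (H t\<^sub>0)) (at_right 0)"
    if lt: "\<forall>t\<ge>0. H t < \<beta>"
    using AE_rational_bounds
  proof eventually_elim
    case (elim \<omega>)
    show ?case
    proof (intro allI impI)
      fix t\<^sub>0 :: real assume t0: "0 \<le> t\<^sub>0"
      \<comment> \<open>The local exponent is at least \<open>\<beta>\<close> everywhere, so
        \<open>H < \<beta>\<close> allows \<open>exact\<close> to be applied at every point of the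
        same event.\<close>
      have "ereal (H t\<^sub>0) < ereal \<beta>" using lt t0 by simp
      also have "\<dots> \<le> local_hoelder_exponent H t\<^sub>0" by (rule hoelder_le_local_exponent[OF hoelder \<beta>])
      finally show "((\<lambda>\<rho>. hausdorff_dim (path_graph X \<omega> (half_line_ball t\<^sub>0 \<rho>))) \<longlongrightarrow> 2 - ereal (H t\<^sub>0)) (at_right 0)"
        by (rule exact[OF elim t0])
    qed
  qed
  show ?thesis using i ii iii range last by blast
qed

end
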